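(* Let $p>2$ and let $(\mathcal{U}_j)_{j\in\mathbb{N}}$ be a sequence of maps $\mathcal{U}_j:\Omega\to\mathbb{R}^{2n+2}$ that is bounded in $W^{1,p}(\Omega;\mathbb{R}^{2n+2})$. Suppose that $$\int_\Omega \operatorname{dist}(D\mathcal{U}_j(x),C_{\mathcal{A}})\,\eta(x)\,dx\to 0\quad\text{as } j\to\infty,\qquad \forall\,\eta\in C_c^\infty(\Omega).$$ Then there exist a subsequence (not relabeled) and a map $\mathcal{U}:\Omega\to\mathbb{R}^{2n+2}$ such that $\mathcal{U}_j\to\mathcal{U}$ strongly in $W^{1,\bar p}(\Omega;\mathbb{R}^{2n+2})$ for every $1\le\bar p<p$. Moreover, $D\mathcal{U}(x)\in C_{\mathcal{A}}$ for a.e. $x\in\Omega$.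
   Context: Throughout, $n\ge 1$ is fixed and $\Omega\subset\mathbb{R}^2$ is a bounded, convex, open set. $\|\cdot\|$ denotes the Euclidean (Hilbert–Schmidt) norm on matrices and $\operatorname{dist}$ the corresponding distance. For $X\in\mathbb{R}^{n\times 2}$, $X^{ab}$ is the $2\times 2$ submatrix of $X$ formed by its $a$-th and $b$-th rows. The area function $\mathcal{A}:\mathbb{R}^{n\times 2}\to\mathbb{R}$ is $$\mathcal{A}(X)=\sqrt{1+\|X\|^2+\sum_{1\le a\le b\le n}\det(X^{ab})^2},$$ and $D\mathcal{A}(X)\in\mathbb{R}^{n\times 2}$ is its gradient. Put $J=\begin{pmatrix}0&1\\ -1&0\end{pmatrix}$, $A(X)=D\mathcal{A}(X)J\in\mathbb{R}^{n\times 2}$, $B(X)=X^TD\mathcal{A}(X)J-\mathcal{A}(X)J\in\mathbb{R}^{2\times 2}$, and $$C_{\mathcal{A}}=\left\{\begin{pmatrix}X\\ A(X)\\ B(X)\end{pmatrix}: X\in\mathbb{R}^{n\times 2}\right\}\subset\mathbb{R}^{(2n+2)\times 2}.$$ *)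

theory Defs
  imports "HOL-Analysis.Analysis"
begin

section \<open>Test functions\<close>

text \<open>\<open>Ck k f\<close>: all iterated directional derivatives of \<open>f\<close> of order less than \<open>k\<close> are
  differentiable everywhere, and those of order at most \<open>k\<close> are continuous.\<close>

primrec Ck :: "nat \<Rightarrow> (real ^ 'd \<Rightarrow> real) \<Rightarrow> bool" where
  "Ck 0 f \<longleftrightarrow> continuous_on UNIV f"
| "Ck (Suc k) f \<longleftrightarrow> continuous_on UNIV f \<and> (\<forall>x. f differentiable at x) \<and>
     (\<forall>v. Ck k (\<lambda>x. frechet_derivative f (at x) v))"

text \<open>\<open>C\<^sub>c\<^sup>\<infinity>(\<Omega>)\<close>; its elements are identified with their extensions by zero to the whole space.\<close>

definition test_functions :: "(real ^ 'd) set \<Rightarrow> (real ^ 'd \<Rightarrow> real) set" where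
  "test_functions \<Omega> = {\<phi>. (\<forall>k. Ck k \<phi>) \<and>
     compact (closure {x. \<phi> x \<noteq> 0}) \<and> closure {x. \<phi> x \<noteq> 0} \<subseteq> \<Omega>}"


section \<open>Sobolev spaces of vector-valued maps\<close>

text \<open>Maps on \<open>\<Omega>\<close> are represented by total functions. Everything below depends only on the
  values on \<open>\<Omega>\<close>, up to null sets.\<close>

definition locally_integrable ::
    "(real ^ 'd) set \<Rightarrow> (real ^ 'd \<Rightarrow> 'b::euclidean_space) \<Rightarrow> bool" where
  "locally_integrable \<Omega> f \<longleftrightarrow> (\<forall>K. compact K \<and> K \<subseteq> \<Omega> \<longrightarrow> integrable (lebesgue_on K) f)"

definition has_weak_derivative ::
    "(real ^ 'd) set \<Rightarrow> (real ^ 'd \<Rightarrow> real ^ 'm) \<Rightarrow> (real ^ 'd \<Rightarrow> real ^ 'd ^ 'm) \<Rightarrow> bool" where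
  "has_weak_derivative \<Omega> u G \<longleftrightarrow>
     locally_integrable \<Omega> u \<and> locally_integrable \<Omega> G \<and>
     (\<forall>\<phi>\<in>test_functions \<Omega>. \<forall>i k.
        (LINT x|lebesgue_on \<Omega>. u x $ i * frechet_derivative \<phi> (at x) (axis k 1)) =
        - (LINT x|lebesgue_on \<Omega>. G x $ i $ k * \<phi> x))"

text \<open>A representative of the weak derivative, which is unique up to null sets for open \<open>\<Omega>\<close>;
  row \<open>i\<close> of the matrix is the gradient of component \<open>i\<close>.\<close>

definition weak_D ::
    "(real ^ 'd) set \<Rightarrow> (real ^ 'd \<Rightarrow> real ^ 'm) \<Rightarrow> real ^ 'd \<Rightarrow> real ^ 'd ^ 'm" where
  "weak_D \<Omega> u = (SOME G. has_weak_derivative \<Omega> u G)"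

definition Lp :: "real \<Rightarrow> (real ^ 'd) set \<Rightarrow> (real ^ 'd \<Rightarrow> 'b::euclidean_space) set" where
  "Lp p \<Omega> = {f \<in> borel_measurable (lebesgue_on \<Omega>).
     integrable (lebesgue_on \<Omega>) (\<lambda>x. norm (f x) powr p)}"

definition W1p :: "real \<Rightarrow> (real ^ 'd) set \<Rightarrow> (real ^ 'd \<Rightarrow> real ^ 'm) set" where
  "W1p p \<Omega> = {u \<in> Lp p \<Omega>. \<exists>G. has_weak_derivative \<Omega> u G \<and> G \<in> Lp p \<Omega>}"

text \<open>Meaningful only for \<open>u \<in> W1p p \<Omega>\<close>, as a divergent integral has the value \<open>0\<close>.\<close>

definition W1p_norm :: "real \<Rightarrow> (real ^ 'd) set \<Rightarrow> (real ^ 'd \<Rightarrow> real ^ 'm) \<Rightarrow> real" where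
  "W1p_norm p \<Omega> u =
     ((LINT x|lebesgue_on \<Omega>. norm (u x) powr p) +
      (LINT x|lebesgue_on \<Omega>. norm (weak_D \<Omega> u x) powr p)) powr (1 / p)"

definition bounded_in_W1p ::
    "real \<Rightarrow> (real ^ 'd) set \<Rightarrow> (nat \<Rightarrow> real ^ 'd \<Rightarrow> real ^ 'm) \<Rightarrow> bool" where
  "bounded_in_W1p p \<Omega> u \<longleftrightarrow>
     (\<forall>j. u j \<in> W1p p \<Omega>) \<and> (\<exists>M. \<forall>j. W1p_norm p \<Omega> (u j) \<le> M)"

definition converges_in_W1p ::
    "real \<Rightarrow> (real ^ 'd) set \<Rightarrow> (nat \<Rightarrow> real ^ 'd \<Rightarrow> real ^ 'm) \<Rightarrow> (real ^ 'd \<Rightarrow> real ^ 'm) \<Rightarrow> bool"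
  where
  "converges_in_W1p p \<Omega> u v \<longleftrightarrow>
     (\<forall>j. u j \<in> W1p p \<Omega>) \<and> v \<in> W1p p \<Omega> \<and>
     (\<lambda>j. W1p_norm p \<Omega> (\<lambda>x. u j x - v x)) \<longlonglongrightarrow> 0"


section \<open>The area function and its differential inclusion\<close>

text \<open>The rows of an \<open>n \<times> 2\<close> matrix are indexed by a finite linearly ordered type \<open>'n\<close>.
  The norm and the inner product of the type \<open>real ^ 2 ^ 'n\<close> are the Hilbert--Schmidt ones.\<close>

definition rows_submatrix :: "real ^ 2 ^ 'n \<Rightarrow> 'n \<Rightarrow> 'n \<Rightarrow> real ^ 2 ^ 2" where
  "rows_submatrix X a b = vector [X $ a, X $ b]"

definition area :: "real ^ 2 ^ 'n::{finite,linorder} \<Rightarrow> real" where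
  "area X = sqrt (1 + (norm X)\<^sup>2 + (\<Sum>(a, b)\<in>{(a, b). a \<le> b}. (det (rows_submatrix X a b))\<^sup>2))"

definition gradient :: "('a::real_inner \<Rightarrow> real) \<Rightarrow> 'a \<Rightarrow> 'a" where
  "gradient f x = (THE D. GDERIV f x :> D)"

definition J :: "real ^ 2 ^ 2" where
  "J = vector [vector [0, 1], vector [-1, 0]]"

definition A_area :: "real ^ 2 ^ 'n::{finite,linorder} \<Rightarrow> real ^ 2 ^ 'n::{finite,linorder}" where
  "A_area X = gradient area X ** J"

definition B_area :: "real ^ 2 ^ 'n::{finite,linorder} \<Rightarrow> real ^ 2 ^ 2" where
  "B_area X = transpose X ** gradient area X ** J - area X *\<^sub>R J"

text \<open>The \<open>2n + 2\<close> rows of a block matrix are indexed by the sum type \<open>'n + 'n + 2\<close>.\<close>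

definition stack ::
    "real ^ 2 ^ 'n \<Rightarrow> real ^ 2 ^ 'n \<Rightarrow> real ^ 2 ^ 2 \<Rightarrow> real ^ 2 ^ ('n + 'n + 2)" where
  "stack X Y Z =
     (\<chi> i. case i of Inl a \<Rightarrow> X $ a | Inr (Inl a) \<Rightarrow> Y $ a | Inr (Inr c) \<Rightarrow> Z $ c)"

definition C_area :: "(real ^ 2 ^ ('n::{finite,linorder} + 'n + 2)) set" where
  "C_area = {stack X (A_area X) (B_area X) | X. True}"


subsection \<open>The gradient of the area function exists\<close>

lemma gradient_eqI:
  assumes "GDERIV f x :> D"
  shows "gradient f x = D"
  unfolding gradient_def
proof (rule the_equality[where P = "\<lambda>D. GDERIV f x :> D", OF assms])
  fix E assume "GDERIV f x :> E"
  with assms have "(\<lambda>h. h \<bullet> D) = (\<lambda>h. h \<bullet> E)"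
    unfolding gderiv_def by (rule has_derivative_unique)
  then have "\<forall>h. h \<bullet> (E - D) = 0" by (metis inner_diff_right right_minus_eq)
  then show "E = D" by (metis inner_eq_zero_iff right_minus_eq)
qed

lemma gderiv_gradient:
  fixes f :: "'a::euclidean_space \<Rightarrow> real"
  assumes "f differentiable at x"
  shows "GDERIV f x :> gradient f x"
proof -
  obtain f' where f': "(f has_derivative f') (at x)"
    using assms by (auto simp: differentiable_def)
  then interpret linear f' by (rule has_derivative_linear)
  have "f' = (\<lambda>h. h \<bullet> adjoint f' 1)"
    using adjoint_works[OF linear_axioms, of _ "1 :: real"] by (auto simp: fun_eq_iff)
  with f' have "GDERIV f x :> adjoint f' 1" by (simp add: gderiv_def)
  then show ?thesis using gradient_eqI by metis
qed

lemma differentiable_area: "area differentiable at (X :: real ^ 2 ^ 'n::{finite,linorder})"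
proof -
  have 1: "(\<lambda>X::real^2^'n::{finite,linorder}. X $ a $ k) differentiable at X" for a k
    by (intro bounded_linear_imp_differentiable bounded_linear_compose[OF bounded_linear_vec_nth]
        bounded_linear_vec_nth)
  have 2: "(\<lambda>X::real^2^'n::{finite,linorder}. (norm X)\<^sup>2) differentiable at X"
    unfolding power2_norm_eq_inner by simp
  let ?S = "\<lambda>X::real^2^'n::{finite,linorder}. 1 + (norm X)\<^sup>2 +
    (\<Sum>(a, b)\<in>{(a, b). a \<le> b}. (det (rows_submatrix X a b))\<^sup>2)"
  have 4: "(\<lambda>X::real^2^'n::{finite,linorder}. (det (rows_submatrix X a b))\<^sup>2) differentiable at X" for a b
    unfolding det_2 rows_submatrix_def vector_2
    by (intro differentiable_power differentiable_diff differentiable_mult 1)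
  have 3: "?S differentiable at X"
    by (intro differentiable_add differentiable_const 2 differentiable_sum)
      (auto simp: case_prod_beta intro: 4)
  have "?S X > 0" by (intro add_pos_nonneg sum_nonneg) auto
  then have "sqrt differentiable at (?S X)"
    using DERIV_real_sqrt real_differentiable_def by blast
  with 3 have "(sqrt \<circ> ?S) differentiable at X"
    by (intro differentiable_chain_at)
  then show ?thesis by (simp add: area_def[abs_def] o_def)
qed

end

theory Submission
  imports Defs "HOL-Computational_Algebra.Polynomial" "HOL-Complex_Analysis.Great_Picard"
begin

text \<open>
  With \<open>g = I + X\<^sup>T X\<close> and \<open>h = g / \<surd>det g\<close>, the elements of \<open>C_area\<close> have blocks \<open>A(X) = X J h\<close> and
  \<open>B(X) = - J h\<close>, where \<open>h\<close> is symmetric and positive with \<open>det h = 1\<close>. For two such matrices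
  \<open>det (h\<^sub>1 - h\<^sub>2) \<le> 0\<close>, with equality only if \<open>h\<^sub>1 = h\<^sub>2\<close>; and if \<open>h\<^sub>1 = h\<^sub>2 = h\<close>, then the sum
      over the
  rows \<open>a\<close> of the minors formed by the \<open>a\<close>-th rows of \<open>X\<^sub>1 - X\<^sub>2\<close> and of \<open>(X\<^sub>1 - X\<^sub>2) J h\<close> is a
      positive
  definite quadratic form in \<open>X\<^sub>1 - X\<^sub>2\<close>. So two combinations of minors, evaluated on differences,
      have
  a sign on the set and separate its points.

  After passing to a subsequence that is Cauchy in \<open>L\<^sup>1\<close>, minors of \<open>D U\<^sub>j - D U\<^sub>k\<close> integrate to \<open>0\<close>
      in the limit
  against every test function, because they are null Lagrangians. As they are bounded in
  \<open>L\<^sup>p\<^sup>/\<^sup>2\<close> with \<open>p/2 > 1\<close>, a combination whose negative part tends to \<open>0\<close> in measure tends to \<open>0\<close>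
      in
  measure itself. Applied to the two combinations in turn, this shows that \<open>D U\<^sub>j\<close> is Cauchy
  in measure. Working with differences over pairs \<open>(j, k)\<close> avoids weak limits and Young measures.
\<close>

section \<open>Convergence in measure\<close>

text \<open>The data on \<open>\<Omega>\<close> are extended by zero, which creates jumps at the
  boundary. So smoothing, the weak equation and the distance hypothesis can be used only against
  compactly supported functions. Convergence in measure suits this: what remains near the boundary
  has small measure, and the \<open>L^p\<close> bounds hold up to the boundary. Local convergence in
  measure therefore becomes strong convergence on \<open>\<Omega>\<close> for every exponent below
  \<open>p\<close>. The quadratic form in the \<open>X\<close> and \<open>A\<close> rows has a sign
  only where the matrices \<open>h\<close> agree, and along the sequence they agree only in the
  limit. This is why implications between exact zero sets are made quantitative on balls of
  matrices, where compactness applies, while Markov's inequality discards the points with large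
  gradients. The sign of \<open>det (h1 - h2)\<close> has a geometric origin: \<open>det\<close> is
  a Lorentzian form on symmetric 2 by 2 matrices, and two distinct points on one sheet of
  \<open>det = 1\<close> differ by a spacelike vector. The analysis runs over \<open>lborel\<close>
  with Borel representatives, where translations and Tonelli's theorem are at hand; Lebesgue measure
  enters only in the transfer.\<close>

definition conv_meas :: "'a measure \<Rightarrow> 'i filter \<Rightarrow> ('i \<Rightarrow> 'a \<Rightarrow> real) \<Rightarrow> bool" where
  "conv_meas N F f \<longleftrightarrow>
     (\<forall>e>0. ((\<lambda>i. measure N {x\<in>space N. e < f i x}) \<longlongrightarrow> 0) F)"

lemma conv_measI:
  assumes "\<And>e r. e > 0 \<Longrightarrow> r > 0 \<Longrightarrow> \<forall>\<^sub>F i in F. measure N {x\<in>space N. e < f i x} < r"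
  shows "conv_meas N F f"
  unfolding conv_meas_def tendsto_iff using assms by (auto simp: dist_real_def)

lemma conv_measD:
  assumes "conv_meas N F f" "e > 0" "r > 0"
  shows "\<forall>\<^sub>F i in F. measure N {x\<in>space N. e < f i x} < r"
  using assms unfolding conv_meas_def tendsto_iff by (auto simp: dist_real_def)

context finite_measure begin

lemma conv_meas_markov:
  assumes int: "\<And>i. integrable M (f i)" and nn: "\<And>i x. x \<in> space M \<Longrightarrow> 0 \<le> f i x"
    and lim: "((\<lambda>i. LINT x|M. f i x) \<longlongrightarrow> 0) F"
  shows "conv_meas M F f"
proof (rule conv_measI)
  fix e r :: real assume e: "e > 0" "r > 0"
  have [measurable]: "f i \<in> borel_measurable M" for i using int by auto
  have "\<forall>\<^sub>F i in F. (LINT x|M. f i x) < e * r"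
    using order_tendstoD(2)[OF lim, of "e * r"] e by simp
  then show "\<forall>\<^sub>F i in F. measure M {x\<in>space M. e < f i x} < r"
  proof eventually_elim
    case (elim i)
    have "measure M {x\<in>space M. e < f i x} \<le> measure M {x\<in>space M. e \<le> f i x}"
      by (intro finite_measure_mono) auto
    also have "\<dots> \<le> (LINT x|M. f i x) / e"
      using int nn e by (intro integral_Markov_inequality_measure[where A="space M - {x\<in>space M. \<not>
          True}"]) auto
    also have "\<dots> < r" using elim e by (simp add: field_simps)
    finally show ?case .
  qed
qed

text \<open>\<open>conv_meas\<close> is one-sided: only values above \<open>e\<close> count, so an
  upper bound on \<open>f\<close> suffices. Applied to \<open>- D\<close>, the notion says that the
  negative part of \<open>D\<close> tends to 0 in measure.\<close>

lemma conv_meas_mono: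
  assumes [measurable]: "\<And>i. f i \<in> borel_measurable M" "\<And>i. g i \<in> borel_measurable M"
    and "conv_meas M F g" and le: "\<And>i x. x \<in> space M \<Longrightarrow> f i x \<le> g i x"
  shows "conv_meas M F f"
proof (rule conv_measI)
  fix e r :: real assume e: "e > 0" "r > 0"
  from conv_measD[OF assms(3) e] show "\<forall>\<^sub>F i in F. measure M {x\<in>space M. e < f i x} < r"
  proof eventually_elim
    case (elim i)
    have "measure M {x\<in>space M. e < f i x} \<le> measure M {x\<in>space M. e < g i x}"
      by (intro finite_measure_mono) (auto dest: le[of _ i] intro: less_le_trans)
    then show ?case using elim by linarith
  qed
qed

lemma conv_meas_max:
  assumes [measurable]: "\<And>i. f i \<in> borel_measurable M" "\<And>i. g i \<in> borel_measurable M"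
    and "conv_meas M F f" "conv_meas M F g"
  shows "conv_meas M F (\<lambda>i x. max (f i x) (g i x))"
proof (rule conv_measI)
  fix e r :: real assume e: "e > 0" "r > 0"
  from e have r2: "r/2 > 0" by simp
  from conv_measD[OF assms(3) e(1) r2] conv_measD[OF assms(4) e(1) r2]
  show "\<forall>\<^sub>F i in F. measure M {x\<in>space M. e < max (f i x) (g i x)} < r"
  proof eventually_elim
    case (elim i)
    have "measure M {x\<in>space M. e < max (f i x) (g i x)}
       \<le> measure M ({x\<in>space M. e < f i x} \<union> {x\<in>space M. e < g i x})"
      by (intro finite_measure_mono) auto
    also have "\<dots> \<le> measure M {x\<in>space M. e < f i x} + measure M {x\<in>space M. e < g i x}"
      by (intro measure_Un_le) auto
    finally show ?case using elim by linarith
  qed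
qed

text \<open>Off a set of measure at most \<open>r/2\<close>, supplied by Markov's inequality, the
  weight \<open>b\<close> is bounded by \<open>R\<close>, and there smallness of \<open>g\<close>
  forces smallness of \<open>f\<close> uniformly. With a \<open>p\<close>-th power of gradients as
  weight, an implication known on bounded sets of matrices suffices.\<close>

lemma conv_meas_soft:
  fixes b :: "'i \<Rightarrow> 'a \<Rightarrow> real" and f g :: "'i \<Rightarrow> 'a \<Rightarrow> real"
  assumes [measurable]: "\<And>i. f i \<in> borel_measurable M" "\<And>i. g i \<in> borel_measurable M"
    and g: "conv_meas M F g"
    and b: "\<And>i. integrable M (b i)" "\<And>i x. x \<in> space M \<Longrightarrow> 0 \<le> b i x"
      "\<And>i. (LINT x|M. b i x) \<le> C"
    and pt: "\<And>R e. e > 0 \<Longrightarrow>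
       \<exists>d>0. \<forall>i. \<forall>x\<in>space M. b i x \<le> R \<longrightarrow> g i x \<le> d \<longrightarrow> f i x \<le> e"
  shows "conv_meas M F f"
proof (rule conv_measI)
  fix e r :: real assume e: "e > 0" "r > 0"
  \<comment> \<open>The level at which Markov's inequality yields \<open>r/2\<close>; the
    \<open>+ 1\<close> keeps it positive for \<open>C = 0\<close>.\<close>
  define R where "R = 2 * (\<bar>C\<bar> + 1) / r"
  have R: "R > 0" using e by (simp add: R_def)
  have [measurable]: "b i \<in> borel_measurable M" for i using b(1) by auto
  obtain d where d: "d > 0" "\<And>i x. x \<in> space M \<Longrightarrow> b i x \<le> R \<Longrightarrow> g i x \<le> d \<Longrightarrow> f i x \<le> e"
    using pt[OF e(1), of R] by blast
  from e have r2: "r/2 > 0" by simp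
  from conv_measD[OF g d(1) r2]
  show "\<forall>\<^sub>F i in F. measure M {x\<in>space M. e < f i x} < r"
  proof eventually_elim
    case (elim i)
    have 1: "measure M {x\<in>space M. R \<le> b i x} \<le> (LINT x|M. b i x) / R"
      using b R by (intro integral_Markov_inequality_measure[where A="space M - {x\<in>space M. \<not>
          True}"]) auto
    also have "\<dots> \<le> (\<bar>C\<bar> + 1) / R" using b(3)[of i] R by (intro divide_right_mono) auto
    also have "\<dots> = r/2" using e by (simp add: R_def field_simps)
    finally have 1: "measure M {x\<in>space M. R \<le> b i x} \<le> r/2" .
    have "measure M {x\<in>space M. e < f i x}
       \<le> measure M ({x\<in>space M. R \<le> b i x} \<union> {x\<in>space M. d < g i x})"
    proof (intro finite_measure_mono subsetI)
      fix x assume "x \<in> {x\<in>space M. e < f i x}"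
      then have x: "x \<in> space M" "e < f i x" by auto
      then have "\<not> (b i x \<le> R \<and> g i x \<le> d)" using d(2)[OF x(1), of i] by linarith
      then show "x \<in> {x\<in>space M. R \<le> b i x} \<union> {x\<in>space M. d < g i x}" using x(1) by auto
    qed measurable
    also have "\<dots> \<le> measure M {x\<in>space M. R \<le> b i x} + measure M {x\<in>space M. d < g i x}"
      by (intro measure_Un_le) auto
    finally show ?case using elim 1 by linarith
  qed
qed

text \<open>Finiteness of the measure makes the constant in \<open>t^q \<le> 1 + t^p\<close>
  integrable.\<close>

lemma integrable_powr_le:
  fixes p q :: real and f :: "'a \<Rightarrow> real"
  assumes [measurable]: "f \<in> borel_measurable M" and nn: "\<And>x. x \<in> space M \<Longrightarrow> 0 \<le> f x"
    and p: "0 < q" "q \<le> p" and int: "integrable M (\<lambda>x. f x powr p)"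
  shows "integrable M (\<lambda>x. f x powr q)"
proof (rule Bochner_Integration.integrable_bound[where f="\<lambda>x. 1 + f x powr p"])
  show "AE x in M. norm (f x powr q) \<le> norm (1 + f x powr p)"
  proof (rule AE_I2)
    fix x assume "x \<in> space M"
    then have 0: "0 \<le> f x" by (rule nn)
    show "norm (f x powr q) \<le> norm (1 + f x powr p)"
    proof (cases "f x \<le> 1")
      case True
      then have "f x powr q \<le> 1" using 0 p powr_mono2[of q "f x" 1] by simp
      then show ?thesis by (simp add: add_increasing2)
    next
      case False
      then have "f x powr q \<le> f x powr p" using p by (intro powr_mono) auto
      then show ?thesis by simp
    qed
  qed
qed (use int in auto)

text \<open>The bound in the higher power \<open>p\<close> replaces equi-integrability. Values below
  \<open>s\<close> contribute little since the measure is finite, values between \<open>s\<close>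
  and \<open>K\<close> live on a set of small measure, and above \<open>K\<close> one has
  \<open>f^q \<le> K^(q-p) f^p\<close>.\<close>

lemma conv_meas_vitali:
  assumes [measurable]: "\<And>i. f i \<in> borel_measurable M"
    and nn: "\<And>i x. x \<in> space M \<Longrightarrow> 0 \<le> f i x"
    and p: "0 < q" "q < p" and int: "\<And>i. integrable M (\<lambda>x. f i x powr p)"
    and C: "\<And>i. (LINT x|M. f i x powr p) \<le> C"
    and f: "conv_meas M F f"
  shows "((\<lambda>i. LINT x|M. f i x powr q) \<longlongrightarrow> 0) F"
proof (rule tendstoI)
  fix e :: real assume e: "e > 0"
  define \<mu> where "\<mu> = measure M (space M) + 1"
  have \<mu>: "\<mu> > 0" by (simp add: \<mu>_def add_nonneg_pos)
  define s where "s = (e / (4 * \<mu>)) powr (1/q)"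
  have s: "s > 0" "s powr q * \<mu> = e/4" using e \<mu> p by (auto simp: s_def powr_powr)
  \<comment> \<open>Solves \<open>K^(q-p) (\<bar>C\<bar> + 1) = e/4\<close>; the three contributions
    then add up to at most \<open>3e/4\<close>.\<close>
  define K where "K = (4 * (\<bar>C\<bar> + 1) / e) powr (1 / (p - q))"
  have K: "K > 0" using e by (auto simp: K_def)
  have "K powr (q - p) = (4 * (\<bar>C\<bar> + 1) / e) powr (1 / (p - q) * (q - p))"
    by (simp only: K_def powr_powr)
  also have "1 / (p - q) * (q - p) = -1" using p by (simp add: field_simps)
  also have "(4 * (\<bar>C\<bar> + 1) / e) powr (-1) = e / (4 * (\<bar>C\<bar> + 1))"
    using e by (simp add: powr_minus powr_one field_simps)
  finally have K2: "K powr (q - p) * (\<bar>C\<bar> + 1) = e/4"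
    by (simp add: divide_simps) (simp add: field_simps add_nonneg_eq_0_iff split: if_splits)
  define t where "t = e / 4 / K powr q"
  have t: "t > 0" "K powr q * t = e/4" using K e by (auto simp: t_def)
  from conv_measD[OF f s(1) t(1)]
  show "\<forall>\<^sub>F i in F. dist (LINT x|M. f i x powr q) 0 < e"
  proof eventually_elim
    case (elim i)
    have le: "f i x powr q \<le> s powr q + K powr q * indicator {x\<in>space M. s < f i x} x
         + K powr (q - p) * f i x powr p" if x: "x \<in> space M" for x
    proof -
      have 0: "0 \<le> f i x" using nn x by auto
      consider "f i x \<le> s" | "s < f i x" "f i x \<le> K" | "K < f i x" by linarith
      then show ?thesis
      proof cases
        case 1
        then have "f i x powr q \<le> s powr q" using 0 p by (intro powr_mono2) auto
        then show ?thesis using 0 by (auto intro!: add_increasing2)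
      next
        case 2
        then have "f i x powr q \<le> K powr q" using 0 p by (intro powr_mono2) auto
        moreover have "0 \<le> s powr q" "0 \<le> K powr (q - p) * f i x powr p" by auto
        ultimately have "f i x powr q \<le> s powr q + K powr q * 1 + K powr (q - p) * f i x powr p"
          by linarith
        then show ?thesis using x 2 by simp
      next
        case 3
        have "f i x powr q = f i x powr (q - p) * f i x powr p"
          by (simp add: powr_add[symmetric])
        also have "\<dots> \<le> K powr (q - p) * f i x powr p"
          using 3 K p by (intro mult_right_mono powr_mono2') auto
        finally show ?thesis by (auto intro!: add_increasing)
      qed
    qed
    have "(LINT x|M. f i x powr q) \<le> (LINT x|M. s powr q + K powr q * indicator {x\<in>space M. s < f i
        x} x
         + K powr (q - p) * f i x powr p)"
      using p nn by (intro integral_mono le integrable_powr_le[OF _ _ _ _ int]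
          Bochner_Integration.integrable_add
         integrable_mult_right int integrable_real_indicator) (auto simp: emeasure_eq_measure)
    also have "\<dots> = s powr q * measure M (space M) + K powr q * measure M {x\<in>space M. s < f i x}
         + K powr (q - p) * (LINT x|M. f i x powr p)"
    proof -
      have "integrable M (\<lambda>x. K powr q * indicator {x\<in>space M. s < f i x} x)"
        by (intro integrable_mult_right integrable_real_indicator) (auto simp: emeasure_eq_measure)
      moreover have "integrable M (\<lambda>x. K powr (q - p) * f i x powr p)" by (intro
          integrable_mult_right int)
      moreover have "{x\<in>space M. s < f i x} \<inter> space M = {x\<in>space M. s < f i x}" by auto
      ultimately show ?thesis by (simp add: mult.commute)
    qed
    also have "\<dots> \<le> s powr q * \<mu> + K powr q * t + K powr (q - p) * (\<bar>C\<bar> + 1)"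
      using elim C[of i] K(1) s(1)
      by (intro add_mono mult_left_mono) (auto simp: \<mu>_def)
    also have "\<dots> < e" using s t K2 e by simp
    finally show ?case by (simp add: Bochner_Integration.integral_nonneg_AE)
  qed
qed

lemma conv_meas_exhaust:
  assumes [measurable]: "\<And>i. f i \<in> borel_measurable M" "\<And>n::nat. A n \<in> sets M"
    and cov: "(\<Union>n. A n) = space M"
    and f: "\<And>n. conv_meas M F (\<lambda>i x. f i x * indicator (A n) x)"
  shows "conv_meas M F f"
proof (rule conv_measI)
  fix e r :: real assume e: "e > 0" "r > 0"
  \<comment> \<open>These sets decrease to the empty set, so finitely many \<open>A i\<close> cover
    everything up to measure \<open>r/2\<close>.\<close>
  define B where "B n = space M - (\<Union>i<n. A i)" for n
  have "(\<lambda>n. measure M (B n)) \<longlonglongrightarrow> measure M (\<Inter>n. B n)"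
    by (intro finite_Lim_measure_decseq) (auto simp: B_def decseq_def)
  also have "(\<Inter>n. B n) = {}" using cov by (auto simp: B_def)
  finally have "\<forall>\<^sub>F n in sequentially. measure M (B n) < r/2"
    using e by (intro order_tendstoD) auto
  then obtain n where n: "measure M (B n) < r/2" by (meson eventually_happens' sequentially_bot)
  have "\<forall>\<^sub>F i in F. \<forall>k\<in>{..<n}. measure M {x\<in>space M. e < f i x * indicator (A k) x} < r / (2 * real
      n)"
    using e by (intro eventually_ball_finite ballI conv_measD[OF f]) auto
  then show "\<forall>\<^sub>F i in F. measure M {x\<in>space M. e < f i x} < r"
  proof eventually_elim
    case (elim i)
    have "measure M {x\<in>space M. e < f i x}
       \<le> measure M (B n \<union> (\<Union>k<n. {x\<in>space M. e < f i x * indicator (A k) x}))"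
      by (intro finite_measure_mono) (auto simp: B_def)
    also have "\<dots> \<le> measure M (B n) + measure M (\<Union>k<n. {x\<in>space M. e < f i x * indicator (A k) x})"
      by (intro measure_Un_le) (auto simp: B_def)
    also have "measure M (\<Union>k<n. {x\<in>space M. e < f i x * indicator (A k) x})
       \<le> (\<Sum>k<n. measure M {x\<in>space M. e < f i x * indicator (A k) x})"
      by (intro measure_UNION_le) auto
    also have "\<dots> \<le> (\<Sum>k<n. r / (2 * real n))" using elim by (intro sum_mono less_imp_le) auto
    also have "\<dots> \<le> r / 2" using e by simp
    finally show ?case using n by linarith
  qed
qed

text \<open>With \<open>D' = max 0 (- D)\<close> one has \<open>\<bar>D\<bar> = D + 2 D'\<close>.
  The bound in a power \<open>s > 1\<close> lets \<open>conv_meas_vitali\<close> turn smallness of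
  \<open>D'\<close> in measure into smallness in mean, so the integral of
  \<open>\<eta> \<bar>D\<bar>\<close> tends to 0 together with that of
  \<open>\<eta> D\<close>.\<close>

lemma conv_meas_signed:
  assumes [measurable]: "\<And>i. D i \<in> borel_measurable M" "\<eta> \<in> borel_measurable M"
    and s: "1 < s" and int: "\<And>i. integrable M (\<lambda>x. \<bar>D i x\<bar> powr s)"
    and C: "\<And>i. (LINT x|M. \<bar>D i x\<bar> powr s) \<le> C"
    and neg: "conv_meas M F (\<lambda>i x. - D i x)"
    and eta: "\<And>x. x \<in> space M \<Longrightarrow> 0 \<le> \<eta> x" "\<And>x. x \<in> space M \<Longrightarrow> \<eta> x \<le> B"
    and lim: "((\<lambda>i. LINT x|M. \<eta> x * D i x) \<longlongrightarrow> 0) F"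
    and c: "c > 0"
  shows "conv_meas M F (\<lambda>i x. \<bar>D i x\<bar> * indicator {x\<in>space M. c < \<eta> x} x)"
proof -
  define D' where "D' i x = max 0 (- D i x)" for i x
  have [measurable]: "D' i \<in> borel_measurable M" for i unfolding D'_def by measurable
  have le: "\<bar>D' i x\<bar> powr s \<le> \<bar>D i x\<bar> powr s" for i x
    using s by (intro powr_mono2) (auto simp: D'_def)
  have intD: "integrable M (D i)" for i
  proof -
    have "integrable M (\<lambda>x. \<bar>D i x\<bar> powr 1)"
      using s int by (intro integrable_powr_le[where p=s, OF _ _ _ _ int]) auto
    then have "integrable M (\<lambda>x. \<bar>D i x\<bar>)" by simp
    then show ?thesis by (rule Bochner_Integration.integrable_bound) auto
  qed
  have intD': "integrable M (D' i)" for i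
    by (rule Bochner_Integration.integrable_bound[OF intD[of i]]) (auto simp: D'_def)
  have intp: "integrable M (\<lambda>x. \<bar>D' i x\<bar> powr s)" for i
    by (rule Bochner_Integration.integrable_bound[OF int[of i]]) (use le in auto)
  have convD': "conv_meas M F D'"
    using neg unfolding conv_meas_def D'_def by (auto simp: less_max_iff_disj)
  have nnD': "0 \<le> D' i x" for i x by (simp add: D'_def)
  have "((\<lambda>i. LINT x|M. D' i x powr 1) \<longlongrightarrow> 0) F"
  proof (rule conv_meas_vitali[where p=s and C=C])
    fix i
    show "integrable M (\<lambda>x. D' i x powr s)" using intp[of i] nnD' by simp
    have "(LINT x|M. D' i x powr s) \<le> (LINT x|M. \<bar>D i x\<bar> powr s)"
      using integral_mono[OF intp[of i] int[of i] le] nnD' by simp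
    then show "(LINT x|M. D' i x powr s) \<le> C" using C[of i] by linarith
  qed (use s convD' nnD' in auto)
  then have lim': "((\<lambda>i. LINT x|M. D' i x) \<longlongrightarrow> 0) F"
    using nnD' by simp
  have abs_eq: "\<bar>D i x\<bar> = D i x + 2 * D' i x" for i x by (auto simp: D'_def)
  have bnd: "integrable M (\<lambda>x. \<eta> x * g x)" if g: "integrable M g" for g
  proof (rule Bochner_Integration.integrable_bound[where f="\<lambda>x. B * g x"])
    show "AE x in M. norm (\<eta> x * g x) \<le> norm (B * g x)"
    proof (rule AE_I2)
      fix x assume "x \<in> space M"
      with eta have "\<bar>\<eta> x\<bar> \<le> \<bar>B\<bar>" by fastforce
      then show "norm (\<eta> x * g x) \<le> norm (B * g x)" by (simp add: abs_mult mult_right_mono)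
    qed
  qed (use g in auto)
  have "((\<lambda>i. LINT x|M. \<eta> x * D' i x) \<longlongrightarrow> 0) F"
  proof (rule tendsto_sandwich[OF _ _ tendsto_const])
    show "((\<lambda>i. B * (LINT x|M. D' i x)) \<longlongrightarrow> 0) F" using tendsto_mult_right_zero[OF lim', of B] by simp
    show "\<forall>\<^sub>F i in F. (LINT x|M. \<eta> x * D' i x) \<le> B * (LINT x|M. D' i x)"
    proof (intro always_eventually allI)
      fix i
      have "(LINT x|M. \<eta> x * D' i x) \<le> (LINT x|M. B * D' i x)"
        using eta nnD' by (intro integral_mono bnd intD' integrable_mult_right) (auto intro!:
            mult_right_mono)
      then show "(LINT x|M. \<eta> x * D' i x) \<le> B * (LINT x|M. D' i x)" by simp
    qed
    show "\<forall>\<^sub>F i in F. 0 \<le> (LINT x|M. \<eta> x * D' i x)"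
      using eta by (intro always_eventually allI integral_nonneg_AE AE_I2) (auto simp: D'_def)
  qed
  then have "((\<lambda>i. (LINT x|M. \<eta> x * D i x) + 2 * (LINT x|M. \<eta> x * D' i x)) \<longlongrightarrow> 0) F"
    using tendsto_add[OF lim tendsto_mult_right_zero, of _ 2] by simp
  also have "(\<lambda>i. (LINT x|M. \<eta> x * D i x) + 2 * (LINT x|M. \<eta> x * D' i x)) = (\<lambda>i. LINT x|M. \<eta> x * \<bar>D
      i x\<bar>)"
  proof
    fix i
    have "(LINT x|M. \<eta> x * \<bar>D i x\<bar>) = (LINT x|M. \<eta> x * D i x + 2 * (\<eta> x * D' i x))"
      unfolding abs_eq by (simp add: algebra_simps)
    also have "\<dots> = (LINT x|M. \<eta> x * D i x) + 2 * (LINT x|M. \<eta> x * D' i x)"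
      by (simp only: Bochner_Integration.integral_add[OF bnd[OF intD] integrable_mult_right[OF
          bnd[OF intD']]]
          integral_mult_right_zero)
    finally show "(LINT x|M. \<eta> x * D i x) + 2 * (LINT x|M. \<eta> x * D' i x) = (LINT x|M. \<eta> x * \<bar>D i
        x\<bar>)" ..
  qed
  finally have "((\<lambda>i. (1/c) * (LINT x|M. \<eta> x * \<bar>D i x\<bar>)) \<longlongrightarrow> 0) F"
    by (rule tendsto_mult_right_zero)
  then have lim2: "((\<lambda>i. LINT x|M. (1/c) * (\<eta> x * \<bar>D i x\<bar>)) \<longlongrightarrow> 0) F"
    by (simp only: integral_mult_right_zero)
  have "conv_meas M F (\<lambda>i x. (1/c) * (\<eta> x * \<bar>D i x\<bar>))"
  proof (rule conv_meas_markov[OF _ _ lim2])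
    show "integrable M (\<lambda>x. (1/c) * (\<eta> x * \<bar>D i x\<bar>))" for i
      by (intro integrable_mult_right bnd integrable_abs intD)
    show "0 \<le> (1/c) * (\<eta> x * \<bar>D i x\<bar>)" if "x \<in> space M" for i x
      using eta(1)[OF that] c by simp
  qed
  then show ?thesis
  proof (rule conv_meas_mono[rotated 2])
    fix i x assume x: "x \<in> space M"
    show "\<bar>D i x\<bar> * indicator {x\<in>space M. c < \<eta> x} x \<le> (1/c) * (\<eta> x * \<bar>D i x\<bar>)"
    proof (cases "c < \<eta> x")
      case True
      then have "1 * \<bar>D i x\<bar> \<le> \<eta> x / c * \<bar>D i x\<bar>" using c by (intro mult_right_mono) auto
      then show ?thesis using True x by simp
    next
      case False
      then show ?thesis using c eta(1)[OF x] by simp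
    qed
  qed measurable
qed

text \<open>The Riesz-Fischer argument: along a sparse subsequence the integrals of the norms of the
  increments are summable, so the telescoping series converges absolutely almost everywhere. Values
  lie in a general Banach space so that maps and gradients can be treated as one pair-valued
  sequence.\<close>

lemma Cauchy_L1_AE_subseq:
  fixes f :: "nat \<Rightarrow> 'a \<Rightarrow> 'b::{banach,second_countable_topology}"
  assumes int: "\<And>n. integrable M (f n)"
    and lim: "((\<lambda>(j,k). LINT x|M. norm (f j x - f k x)) \<longlongrightarrow> 0) (sequentially \<times>\<^sub>F sequentially)"
  shows "\<exists>r. strict_mono r \<and> (AE x in M. convergent (\<lambda>n. f (r n) x))"
proof -
  have [measurable]: "f n \<in> borel_measurable M" for n using int by auto
  have "\<exists>N. \<forall>j\<ge>N. \<forall>k\<ge>N. (LINT x|M. norm (f j x - f k x)) < (1/2)^n" for n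
  proof -
    have "\<forall>\<^sub>F z in sequentially \<times>\<^sub>F sequentially. (case z of (j,k) \<Rightarrow> LINT x|M. norm (f j x - f k x))
        < (1/2)^n"
      by (rule order_tendstoD(2)[OF lim]) simp
    then obtain P Q where "eventually P sequentially" "eventually Q sequentially" and
      PQ: "\<And>j k. P j \<Longrightarrow> Q k \<Longrightarrow> (LINT x|M. norm (f j x - f k x)) < (1/2)^n"
      unfolding eventually_prod_filter by auto
    then obtain N1 N2 where "\<forall>j\<ge>N1. P j" "\<forall>j\<ge>N2. Q j"
      unfolding eventually_sequentially by blast
    then show ?thesis using PQ by (intro exI[of _ "max N1 N2"]) auto
  qed
  then obtain N where N: "\<And>n j k. j \<ge> N n \<Longrightarrow> k \<ge> N n \<Longrightarrow> (LINT x|M. norm (f j x - f k x)) < (1/2)^n"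
    by metis
  \<comment> \<open>It has to stay beyond the thresholds \<open>N n\<close> and to increase
    strictly; the maximum secures both.\<close>
  define r where "r = rec_nat (N 0) (\<lambda>n m. max (N (Suc n)) (Suc m))"
  have r: "r (Suc n) = max (N (Suc n)) (Suc (r n))" "r 0 = N 0" for n by (auto simp: r_def)
  have mono: "strict_mono r" by (auto simp: strict_mono_Suc_iff r)
  have rN: "r n \<ge> N n" for n by (cases n) (auto simp: r)
  have small: "(LINT x|M. norm (f (r (Suc n)) x - f (r n) x)) < (1/2)^n" for n
    by (rule N) (use rN[of n] strict_mono_leD[OF mono, of n "Suc n"] in linarith)+
  have intd: "integrable M (\<lambda>x. norm (f (r (Suc n)) x - f (r n) x))" for n
    using int by auto
  have "(\<integral>\<^sup>+x. (\<Sum>n. ennreal (norm (f (r (Suc n)) x - f (r n) x))) \<partial>M) =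
     (\<Sum>n. \<integral>\<^sup>+x. ennreal (norm (f (r (Suc n)) x - f (r n) x)) \<partial>M)"
    by (rule nn_integral_suminf) simp
  also have "\<dots> = (\<Sum>n. ennreal (LINT x|M. norm (f (r (Suc n)) x - f (r n) x)))"
    by (simp add: nn_integral_eq_integral[OF intd])
  also have "\<dots> \<le> (\<Sum>n. ennreal ((1/2)^n))"
    using small by (intro suminf_le ennreal_leI less_imp_le) auto
  also have "\<dots> < \<infinity>"
    using geometric_sums[of "1/2::real"] by (subst suminf_ennreal_eq[where x=2]) auto
  finally have "(\<integral>\<^sup>+x. (\<Sum>n. ennreal (norm (f (r (Suc n)) x - f (r n) x))) \<partial>M) \<noteq> \<infinity>" by simp
  then have "AE x in M. (\<Sum>n. ennreal (norm (f (r (Suc n)) x - f (r n) x))) \<noteq> \<infinity>"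
    by (intro nn_integral_PInf_AE) auto
  then have "AE x in M. convergent (\<lambda>n. f (r n) x)"
  proof (rule AE_mp, intro AE_I2 impI)
    fix x assume "(\<Sum>n. ennreal (norm (f (r (Suc n)) x - f (r n) x))) \<noteq> \<infinity>"
    then have "summable (\<lambda>n. norm (f (r (Suc n)) x - f (r n) x))"
      by (intro summable_suminf_not_top) auto
    then have "summable (\<lambda>n. f (r (Suc n)) x - f (r n) x)" by (rule summable_norm_cancel)
    then have "convergent (\<lambda>n. \<Sum>i<n. f (r (Suc i)) x - f (r i) x)"
      by (simp add: summable_iff_convergent)
    then have "convergent (\<lambda>n. (f (r n) x - f (r 0) x) + f (r 0) x)"
      by (intro convergent_add convergent_const) (simp only: sum_lessThan_telescope[where f="\<lambda>n. f
          (r n) x"])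
    then show "convergent (\<lambda>n. f (r n) x)" by simp
  qed
  with mono show ?thesis by blast
qed

text \<open>Fatou's lemma keeps the limit in the space with exponent \<open>p\<close>. The
  differences are then bounded in that power and tend to 0 in measure, which
  \<open>conv_meas_vitali\<close> converts into convergence for the smaller exponents.\<close>

lemma AE_limit_Lp:
  fixes f :: "nat \<Rightarrow> 'a \<Rightarrow> 'b::{real_normed_vector,second_countable_topology}"
  assumes [measurable]: "\<And>n. f n \<in> borel_measurable M" "g \<in> borel_measurable M"
    and int: "\<And>i. integrable M (\<lambda>x. norm (f i x) powr p)"
    and C: "\<And>i. (LINT x|M. norm (f i x) powr p) \<le> C"
    and p: "1 < p"
    and ae: "AE x in M. (\<lambda>n. f n x) \<longlonglongrightarrow> g x"
  shows "integrable M (\<lambda>x. norm (g x) powr p)"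
    and "\<And>q. 1 \<le> q \<Longrightarrow> q < p \<Longrightarrow> (\<lambda>n. LINT x|M. norm (f n x - g x) powr q) \<longlonglongrightarrow> 0"
proof -
  have lim: "AE x in M. (\<lambda>n. norm (f n x) powr p) \<longlonglongrightarrow> norm (g x) powr p"
    using ae by eventually_elim (use p in \<open>auto intro!: tendsto_intros\<close>)
  have "(\<integral>\<^sup>+x. ennreal (norm (g x) powr p) \<partial>M) = (\<integral>\<^sup>+x. liminf (\<lambda>n. ennreal (norm (f n x) powr p))
      \<partial>M)"
    using lim by (intro nn_integral_cong_AE, eventually_elim)
      (auto intro!: lim_imp_Liminf[symmetric] tendsto_ennrealI)
  also have "\<dots> \<le> liminf (\<lambda>n. \<integral>\<^sup>+x. ennreal (norm (f n x) powr p) \<partial>M)"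
    by (rule nn_integral_liminf) auto
  also have "\<dots> \<le> liminf (\<lambda>n::nat. ennreal C)"
    using C by (intro Liminf_mono always_eventually allI)
      (auto simp: nn_integral_eq_integral[OF int] intro!: ennreal_leI)
  also have "\<dots> < \<infinity>" by (simp add: Liminf_const)
  finally have fin: "(\<integral>\<^sup>+x. ennreal (norm (g x) powr p) \<partial>M) < \<infinity>" .
  then show intg: "integrable M (\<lambda>x. norm (g x) powr p)"
    by (auto simp: integrable_iff_bounded)
  fix q assume q: "1 \<le> q" "q < p"
  \<comment> \<open>Truncation at 1 makes the constant 1 a dominating function. It leaves the sets
    \<open>norm > e\<close> unchanged for \<open>e < 1\<close>, whence the threshold
    \<open>min e (1/2)\<close> below.\<close>
  have meas0: "(\<lambda>n. LINT x|M. min 1 (norm (f n x - g x))) \<longlonglongrightarrow> (LINT x|M. 0)"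
  proof (rule integral_dominated_convergence[where w="\<lambda>_. 1"])
    show "AE x in M. (\<lambda>n. min 1 (norm (f n x - g x))) \<longlonglongrightarrow> 0"
      using ae
    proof eventually_elim
      case (elim x)
      have "(\<lambda>n. min 1 (norm (f n x - g x))) \<longlonglongrightarrow> min 1 (norm (g x - g x))"
        by (intro tendsto_intros elim)
      then show ?case by simp
    qed
  qed auto
  then have cm: "conv_meas M sequentially (\<lambda>n x. min 1 (norm (f n x - g x)))"
    by (intro conv_meas_markov) (auto intro!: integrable_const_bound[where B=1])
  have cm: "conv_meas M sequentially (\<lambda>n x. norm (f n x - g x))"
  proof (rule conv_measI)
    fix e r :: real assume e: "e > 0" "r > 0"
    then have "min e (1/2) > 0" by simp
    from conv_measD[OF cm this e(2)]
    show "\<forall>\<^sub>F n in sequentially. measure M {x\<in>space M. e < norm (f n x - g x)} < r"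
    proof eventually_elim
      case (elim n)
      have "measure M {x\<in>space M. e < norm (f n x - g x)}
        \<le> measure M {x\<in>space M. min e (1/2) < min 1 (norm (f n x - g x))}"
        by (intro finite_measure_mono) auto
      then show ?case using elim by linarith
    qed
  qed
  define K where "K = 2 powr p"
  have le: "norm (f n x - g x) powr p \<le> K * (norm (f n x) powr p + norm (g x) powr p)" for n x
  proof -
    have "norm (f n x - g x) powr p \<le> (2 * max (norm (f n x)) (norm (g x))) powr p"
      using p norm_triangle_ineq4[of "f n x" "g x"] by (intro powr_mono2) auto
    also have "\<dots> = K * max (norm (f n x)) (norm (g x)) powr p"
      by (simp add: powr_mult K_def)
    also have "\<dots> \<le> K * (norm (f n x) powr p + norm (g x) powr p)"
      by (intro mult_left_mono) (auto simp: max_def K_def)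
    finally show ?thesis .
  qed
  have intb: "integrable M (\<lambda>x. K * (norm (f n x) powr p + norm (g x) powr p))" for n
    using int intg by auto
  have intp: "integrable M (\<lambda>x. norm (f n x - g x) powr p)" for n
    by (rule Bochner_Integration.integrable_bound[OF intb[of n]])
      (auto intro!: AE_I2 order_trans[OF le abs_ge_self])
  show "(\<lambda>n. LINT x|M. norm (f n x - g x) powr q) \<longlonglongrightarrow> 0"
  proof (rule conv_meas_vitali[where p=p and C="K * (C + (LINT x|M. norm (g x) powr p))", OF _ _ _ _
      intp _ cm])
    fix n
    have "(LINT x|M. norm (f n x - g x) powr p) \<le> (LINT x|M. K * (norm (f n x) powr p + norm (g x)
        powr p))"
      by (intro integral_mono intp intb le)
    also have "\<dots> = K * ((LINT x|M. norm (f n x) powr p) + (LINT x|M. norm (g x) powr p))"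
      using int intg by simp
    also have "\<dots> \<le> K * (C + (LINT x|M. norm (g x) powr p))"
      using C[of n] by (intro mult_left_mono) (auto simp: K_def)
    finally show "(LINT x|M. norm (f n x - g x) powr p) \<le> K * (C + (LINT x|M. norm (g x) powr p))" .
  qed (use q in auto)
qed

end

section \<open>Smooth functions and test functions\<close>

definition pd :: "'d \<Rightarrow> (real ^ 'd \<Rightarrow> real) \<Rightarrow> real ^ 'd \<Rightarrow> real" where
  "pd i \<phi> x = frechet_derivative \<phi> (at x) (axis i 1)"

lemma frechet_derivative_eqI: "(f has_derivative f') (at x) \<Longrightarrow> frechet_derivative f (at x) = f'"
  by (rule frechet_derivative_at[symmetric])

lemma Ck_continuous: "Ck k f \<Longrightarrow> continuous_on UNIV f"
  by (cases k) auto

lemma Ck_SucI: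
  assumes "\<And>x. (f has_derivative f' x) (at x)" "\<And>v. Ck k (\<lambda>x. f' x v)"
  shows "Ck (Suc k) f"
proof -
  have "frechet_derivative f (at x) = f' x" for x by (rule frechet_derivative_eqI[OF assms(1)])
  moreover have "continuous_on UNIV f"
    using has_derivative_continuous[OF assms(1)] by (auto simp: continuous_on_eq_continuous_at)
  ultimately show ?thesis using assms by (auto simp: differentiable_def)
qed

lemma Ck_SucD: "Ck (Suc k) f \<Longrightarrow> Ck k f"
  by (induction k arbitrary: f) auto

lemma Ck_has_derivative: "Ck (Suc k) f \<Longrightarrow> (f has_derivative frechet_derivative f (at x)) (at x)"
  by (simp add: frechet_derivative_works)

lemma Ck_const: "Ck k (\<lambda>x. c)"
  by (induction k arbitrary: c) auto

lemma Ck_add: "Ck k f \<Longrightarrow> Ck k g \<Longrightarrow> Ck k (\<lambda>x. f x + g x)"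
proof (induction k arbitrary: f g)
  case 0 then show ?case by (auto intro: continuous_on_add)
next
  case (Suc k)
  show ?case
    by (rule Ck_SucI[OF has_derivative_add[OF Ck_has_derivative[OF Suc.prems(1)]
        Ck_has_derivative[OF Suc.prems(2)]]])
      (use Suc in auto)
qed

lemma Ck_mult: "Ck k f \<Longrightarrow> Ck k g \<Longrightarrow> Ck k (\<lambda>x. f x * g x)"
proof (induction k arbitrary: f g)
  case 0 then show ?case by (auto intro: continuous_on_mult)
next
  case (Suc k)
  note Ck_SucD[OF Suc.prems(1)] Ck_SucD[OF Suc.prems(2)]
  then show ?case
    by (intro Ck_SucI[OF has_derivative_mult[OF Ck_has_derivative[OF Suc.prems(1)]
        Ck_has_derivative[OF Suc.prems(2)]]])
      (use Suc in \<open>auto intro!: Ck_add Suc.IH simp del: Ck.simps(1)\<close>)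
qed

lemma Ck_prod: "finite I \<Longrightarrow> (\<And>i. i \<in> I \<Longrightarrow> Ck k (f i)) \<Longrightarrow> Ck k (\<lambda>x. \<Prod>i\<in>I. f i x)"
  by (induction I rule: finite_induct) (auto intro: Ck_const Ck_mult)

lemma Ck_affine: "Ck k f \<Longrightarrow> Ck k (\<lambda>x. f (c *\<^sub>R x + a))"
proof (induction k arbitrary: f)
  case 0 then show ?case
    by (auto intro!: continuous_on_compose2[of UNIV f UNIV] continuous_intros)
next
  case (Suc k)
  have d: "((\<lambda>x. f (c *\<^sub>R x + a)) has_derivative (\<lambda>h. frechet_derivative f (at (c *\<^sub>R x + a)) (c *\<^sub>R
      h))) (at x)" for x
    by (rule has_derivative_compose[OF _ Ck_has_derivative[OF Suc.prems], of "\<lambda>x. c *\<^sub>R x + a" "\<lambda>h.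
        c *\<^sub>R h", unfolded o_def])
      (auto intro!: derivative_eq_intros)
  show ?case
    by (rule Ck_SucI[OF d]) (use Suc in auto)
qed

text \<open>The functions \<open>P(1/t) e\<^sup>-\<^sup>1\<^sup>/\<^sup>t\<close>, extended by \<open>0\<close> to \<open>t \<le> 0\<close>, are closed under
  differentiation.\<close>

definition flat :: "real poly \<Rightarrow> real \<Rightarrow> real" where
  "flat P t = (if t > 0 then poly P (inverse t) * exp (- inverse t) else 0)"

text \<open>In the variable \<open>s = 1/t\<close> every monomial is beaten by
  \<open>exp s\<close>.\<close>

lemma flat_tendsto_0: "(flat P \<longlongrightarrow> 0) (at 0)"
proof -
  have "((\<lambda>s. poly P s * exp (- s)) \<longlongrightarrow> (\<Sum>i\<le>degree P. coeff P i * 0)) at_top"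
  proof -
    have "((\<lambda>s. \<Sum>i\<le>degree P. coeff P i * (s ^ i / exp s)) \<longlongrightarrow> (\<Sum>i\<le>degree P. coeff P i * 0)) at_top"
      by (intro tendsto_intros tendsto_power_div_exp_0)
    then show ?thesis
      by (simp add: poly_altdef exp_minus field_simps sum_distrib_left sum_divide_distrib)
  qed
  then have "((\<lambda>t. poly P (inverse t) * exp (- inverse t)) \<longlongrightarrow> 0) (at_right (0::real))"
    by (intro filterlim_compose[OF _ filterlim_inverse_at_top_right]) simp
  then have "(flat P \<longlongrightarrow> 0) (at_right 0)"
    by (rule Lim_transform_eventually) (auto simp: flat_def eventually_at_right_less intro:
        eventually_at_rightI[of 0 1])
  moreover have "(flat P \<longlongrightarrow> 0) (at_left 0)"
    by (rule Lim_transform_eventually[OF tendsto_const]) (auto simp: flat_def intro: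
        eventually_at_leftI[of "-1"])
  ultimately show ?thesis by (simp add: filterlim_split_at)
qed

text \<open>For \<open>t > 0\<close> the chain rule gives
  \<open>t^(-2) (P - P')(1/t) e^(-1/t)\<close>, and \<open>[:0,0,1:]\<close> is the polynomial whose
  value at \<open>1/t\<close> is \<open>t^(-2)\<close>. At 0 the difference quotient is again a flat
  function.\<close>

lemma flat_DERIV: "(flat P has_real_derivative flat ([:0,0,1:] * (P - pderiv P)) t) (at t)"
proof -
  consider "t > 0" | "t < 0" | "t = 0" by linarith
  then show ?thesis
  proof cases
    case 1
    have "((\<lambda>t. poly P (inverse t) * exp (- inverse t)) has_real_derivative
       flat ([:0,0,1:] * (P - pderiv P)) t) (at t)"
      using 1 by (auto intro!: derivative_eq_intros DERIV_chain2[OF poly_DERIV] simp: flat_def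
          field_simps power2_eq_square)
    then show ?thesis
      by (rule DERIV_cong_ev[THEN iffD1, rotated 3])
        (use 1 in \<open>auto simp: flat_def intro!: eventually_mono[OF eventually_gt_at_top]
            t1_space_nhds eventually_nhds_in_open[of "{0<..}", THEN eventually_mono]\<close>)
  next
    case 2
    have "((\<lambda>t. 0) has_real_derivative flat ([:0,0,1:] * (P - pderiv P)) t) (at t)"
      using 2 by (simp add: flat_def)
    then show ?thesis
      by (rule DERIV_cong_ev[THEN iffD1, rotated 3])
        (use 2 in \<open>auto simp: flat_def intro!: eventually_nhds_in_open[of "{..<0}", THEN
            eventually_mono]\<close>)
  next
    case 3
    \<comment> \<open>Division by \<open>h\<close> multiplies the polynomial by its variable, which
      is evaluated at \<open>1/h\<close>.\<close>
    have "(\<lambda>h. flat P h / h) = flat ([:0,1:] * P)"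
      by (auto simp: fun_eq_iff flat_def field_simps)
    then show ?thesis using flat_tendsto_0[of "[:0,1:] * P"] 3
      by (simp add: DERIV_def flat_def)
  qed
qed

text \<open>The induction runs over all \<open>P\<close>, because each derivative changes the
  polynomial.\<close>

lemma Ck_flat: "Ck k (\<lambda>x::real^'d. flat P (c * x $ i + a))"
proof (induction k arbitrary: P)
  case 0
  have "continuous_on UNIV (flat P)"
    using flat_DERIV by (meson DERIV_isCont continuous_at_imp_continuous_on)
  then show ?case by (auto intro!: continuous_on_compose2[of UNIV "flat P" UNIV] continuous_intros)
next
  case (Suc k)
  have d: "((\<lambda>x::real^'d. flat P (c * x $ i + a)) has_derivative
     (\<lambda>h. flat ([:0,0,1:] * (P - pderiv P)) (c * x $ i + a) * (c * h $ i))) (at x)" for x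
    by (rule has_derivative_eq_rhs[OF has_derivative_compose[OF _ flat_DERIV[unfolded
        has_field_derivative_def], of "\<lambda>x. c * x $ i + a" "\<lambda>h. c * h $ i"]])
      (auto intro!: derivative_eq_intros bounded_linear_imp_has_derivative bounded_linear_vec_nth)
  show ?case by (rule Ck_SucI[OF d]) (intro Ck_mult Ck_const Suc)
qed

section \<open>Test functions and their Taylor estimates\<close>

lemma test_functionsD:
  assumes "\<phi> \<in> test_functions \<Omega>"
  shows "Ck k \<phi>" "compact (closure {x. \<phi> x \<noteq> 0})" "closure {x. \<phi> x \<noteq> 0} \<subseteq> \<Omega>"
    "continuous_on UNIV \<phi>" "\<And>x. \<phi> differentiable at x" "x \<notin> \<Omega> \<Longrightarrow> \<phi> x = 0"
proof -
  show C: "Ck k \<phi>" for k using assms by (simp add: test_functions_def)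
  show "compact (closure {x. \<phi> x \<noteq> 0})" and sub: "closure {x. \<phi> x \<noteq> 0} \<subseteq> \<Omega>"
    using assms by (simp_all add: test_functions_def)
  show "continuous_on UNIV \<phi>" by (rule Ck_continuous[OF C])
  show "\<phi> differentiable at x" for x using C[of "Suc 0"] by simp
  show "\<phi> x = 0" if "x \<notin> \<Omega>" using that sub closure_subset[of "{x. \<phi> x \<noteq> 0}"] by auto
qed

lemma test_functionsI:
  assumes "\<And>k. Ck k \<phi>" "compact K" "K \<subseteq> \<Omega>" "\<And>x. x \<notin> K \<Longrightarrow> \<phi> x = 0"
  shows "\<phi> \<in> test_functions \<Omega>"
proof -
  have "closure {x. \<phi> x \<noteq> 0} \<subseteq> K"
    using assms(2,4) by (intro closure_minimal compact_imp_closed) auto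
  moreover from this have "compact (closure {x. \<phi> x \<noteq> 0})"
    using assms(2) by (meson closed_closure compact_Int_closed compact_closure bounded_subset
        compact_imp_bounded bounded_closure closure_subset order_trans)
  ultimately show ?thesis using assms unfolding test_functions_def by auto
qed

lemma test_functions_mult:
  assumes "\<phi> \<in> test_functions \<Omega>" "\<And>k. Ck k g"
  shows "(\<lambda>x. \<phi> x * g x) \<in> test_functions \<Omega>"
proof (rule test_functionsI[OF _ test_functionsD(2,3)[OF assms(1)]])
  show "Ck k (\<lambda>x. \<phi> x * g x)" for k by (intro Ck_mult assms test_functionsD(1)[OF assms(1)])
  show "\<phi> x * g x = 0" if "x \<notin> closure {x. \<phi> x \<noteq> 0}" for x
    using that closure_subset[of "{x. \<phi> x \<noteq> 0}"] by auto
qed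

lemma test_functions_deriv:
  assumes "\<phi> \<in> test_functions \<Omega>"
  shows "(\<lambda>x. frechet_derivative \<phi> (at x) v) \<in> test_functions \<Omega>"
proof (rule test_functionsI[OF _ test_functionsD(2,3)[OF assms]])
  show "Ck k (\<lambda>x. frechet_derivative \<phi> (at x) v)" for k
    using test_functionsD(1)[OF assms, of "Suc k"] by auto
  fix x assume x: "x \<notin> closure {x. \<phi> x \<noteq> 0}"
  have "(\<phi> has_derivative (\<lambda>h. 0)) (at x)"
    by (rule has_derivative_transform_within_open[where f="\<lambda>x. 0" and s="- closure {x. \<phi> x \<noteq> 0}"])
      (use x closure_subset[of "{x. \<phi> x \<noteq> 0}"] in auto)
  then show "frechet_derivative \<phi> (at x) v = 0" by (simp add: frechet_derivative_eqI)
qed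

lemma test_functions_pd: "\<phi> \<in> test_functions \<Omega> \<Longrightarrow> pd i \<phi> \<in> test_functions \<Omega>"
  using test_functions_deriv[of \<phi> \<Omega> "axis i 1"] by (simp add: pd_def[abs_def])

lemma test_functions_bounded:
  assumes "\<phi> \<in> test_functions \<Omega>"
  obtains B where "B > 0" "\<And>x. \<bar>\<phi> x\<bar> \<le> B"
proof -
  have "bounded (\<phi> ` closure {x. \<phi> x \<noteq> 0})"
    using test_functionsD[OF assms] by (intro compact_imp_bounded compact_continuous_image) (auto
        intro: continuous_on_subset)
  then obtain B where B: "B > 0" "\<And>x. x \<in> closure {x. \<phi> x \<noteq> 0} \<Longrightarrow> \<bar>\<phi> x\<bar> \<le> B"
    unfolding bounded_pos by auto
  have "\<bar>\<phi> x\<bar> \<le> B" for x using B closure_subset[of "{x. \<phi> x \<noteq> 0}"] by (cases "\<phi> x = 0") auto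
  with B(1) show ?thesis using that by blast
qed

lemma frechet_derivative_sum_pd:
  assumes "f differentiable at x"
  shows "frechet_derivative f (at x) h = (\<Sum>i\<in>UNIV. h $ i * pd i f x)"
proof -
  interpret linear "frechet_derivative f (at x)"
    using assms by (simp add: frechet_derivative_works has_derivative_linear)
  have "frechet_derivative f (at x) h = frechet_derivative f (at x) (\<Sum>i\<in>UNIV. h $ i *\<^sub>R axis i 1)"
    by (simp add: basis_expansion[where 'a=real, unfolded scalar_mult_eq_scaleR])
  then show ?thesis by (simp add: sum scale pd_def)
qed

lemma segment_mvt:
  fixes f :: "real ^ 'd \<Rightarrow> real"
  assumes "\<And>x. f differentiable at x"
  obtains t where "0 < t" "t < 1" "f (z + h) - f z = frechet_derivative f (at (z + t *\<^sub>R h)) h"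
proof -
  have d: "((\<lambda>t. f (z + t *\<^sub>R h)) has_derivative (\<lambda>s. frechet_derivative f (at (z + t *\<^sub>R h)) (s *\<^sub>R
      h))) (at t)" for t
    by (rule has_derivative_compose[OF _ frechet_derivative_works[THEN iffD1, OF assms], of "\<lambda>t. z +
        t *\<^sub>R h" "\<lambda>s. s *\<^sub>R h"])
      (auto intro!: derivative_eq_intros)
  have "\<exists>t\<in>{0<..<1}. f (z + 1 *\<^sub>R h) - f (z + 0 *\<^sub>R h) = frechet_derivative f (at (z + t *\<^sub>R h)) ((1
      - 0) *\<^sub>R h)"
    by (rule mvt_simple[where f="\<lambda>t. f (z + t *\<^sub>R h)"]) (auto intro: has_derivative_at_withinI[OF
        d])
  then show ?thesis using that by auto
qed

lemma test_functions_lipschitz: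
  assumes "\<phi> \<in> test_functions \<Omega>"
  obtains L where "L > 0" "\<And>x y. \<bar>\<phi> x - \<phi> y\<bar> \<le> L * norm (x - y)"
proof -
  have "\<forall>i. \<exists>B>0. \<forall>x. \<bar>pd i \<phi> x\<bar> \<le> B"
    by (metis test_functions_bounded test_functions_pd[OF assms])
  then obtain B where B: "\<And>i. B i > 0" "\<And>i x. \<bar>pd i \<phi> x\<bar> \<le> B i" by metis
  have "\<bar>\<phi> x - \<phi> y\<bar> \<le> (\<Sum>i\<in>UNIV. B i) * norm (x - y)" for x y
  proof -
    obtain t where "\<phi> (y + (x - y)) - \<phi> y = frechet_derivative \<phi> (at (y + t *\<^sub>R (x - y))) (x - y)"
      using segment_mvt[OF test_functionsD(5)[OF assms]] by metis
    also have "\<dots> = (\<Sum>i\<in>UNIV. (x - y) $ i * pd i \<phi> (y + t *\<^sub>R (x - y)))"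
      by (rule frechet_derivative_sum_pd[OF test_functionsD(5)[OF assms]])
    also have "\<bar>\<dots>\<bar> \<le> (\<Sum>i\<in>UNIV. norm (x - y) * B i)"
      by (intro order_trans[OF sum_abs] sum_mono) (auto simp: abs_mult simp del:
          vector_minus_component intro!: mult_mono B component_le_norm_cart)
    finally show ?thesis by (simp add: sum_distrib_right mult.commute)
  qed
  moreover have "(\<Sum>i\<in>UNIV. B i) > 0" using B by (intro sum_pos) auto
  ultimately show ?thesis using that by blast
qed

text \<open>The partial derivatives are test functions themselves and hence Lipschitz. The resulting
  remainder bound is uniform in \<open>z\<close>, so derivatives can be taken under a convolution
  with any integrable function.\<close>

lemma test_functions_quadratic:
  assumes "\<phi> \<in> test_functions \<Omega>"
  obtains L where "L > 0"
    "\<And>z h. \<bar>\<phi> (z + h) - \<phi> z - frechet_derivative \<phi> (at z) h\<bar> \<le> L * (norm h)\<^sup>2"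
proof -
  have "\<forall>i. \<exists>L>0. \<forall>x y. \<bar>pd i \<phi> x - pd i \<phi> y\<bar> \<le> L * norm (x - y)"
    by (metis test_functions_lipschitz test_functions_pd[OF assms])
  then obtain B where B: "\<And>i. B i > 0" "\<And>i x y. \<bar>pd i \<phi> x - pd i \<phi> y\<bar> \<le> B i * norm (x - y)" by metis
  have "\<bar>\<phi> (z + h) - \<phi> z - frechet_derivative \<phi> (at z) h\<bar> \<le> (\<Sum>i\<in>UNIV. B i) * (norm h)\<^sup>2" for z h
  proof -
    obtain t where t: "0 < t" "t < 1" "\<phi> (z + h) - \<phi> z = frechet_derivative \<phi> (at (z + t *\<^sub>R h)) h"
      using segment_mvt[OF test_functionsD(5)[OF assms]] by metis
    have "\<phi> (z + h) - \<phi> z - frechet_derivative \<phi> (at z) h = (\<Sum>i\<in>UNIV. h $ i * (pd i \<phi> (z + t *\<^sub>R h)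
        - pd i \<phi> z))"
      unfolding t(3) by (simp add: frechet_derivative_sum_pd[OF test_functionsD(5)[OF assms]]
          right_diff_distrib sum_subtractf)
    also have "\<bar>\<dots>\<bar> \<le> (\<Sum>i\<in>UNIV. norm h * (B i * norm h))"
    proof (intro order_trans[OF sum_abs] sum_mono)
      fix i
      have "\<bar>pd i \<phi> (z + t *\<^sub>R h) - pd i \<phi> z\<bar> \<le> B i * norm (t *\<^sub>R h)"
        using B(2)[of i "z + t *\<^sub>R h" z] by simp
      also have "\<dots> \<le> B i * norm h" using t B(1)[of i] by (intro mult_left_mono) (auto simp:
          mult_left_le_one_le)
      finally show "\<bar>h $ i * (pd i \<phi> (z + t *\<^sub>R h) - pd i \<phi> z)\<bar> \<le> norm h * (B i * norm h)"
        by (auto simp: abs_mult intro!: mult_mono component_le_norm_cart)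
    qed
    finally show ?thesis by (simp add: sum_distrib_left[symmetric] sum_distrib_right[symmetric]
        power2_eq_square mult_ac)
  qed
  moreover have "(\<Sum>i\<in>UNIV. B i) > 0" using B by (intro sum_pos) auto
  ultimately show ?thesis using that by blast
qed

text \<open>The second difference of \<open>\<phi>\<close> over a square of side \<open>s\<close> is
  symmetric in \<open>i\<close> and \<open>j\<close>. Two mean value steps write it as
  \<open>s^2\<close> times a mixed derivative at a point within \<open>2 s\<close> of
  \<open>x\<close>, and continuity gives the claim as \<open>s\<close> tends to 0.\<close>

lemma pd_commute:
  assumes C: "Ck 2 \<phi>"
  shows "pd i (pd j \<phi>) x = pd j (pd i \<phi>) x"
proof -
  let ?e = "\<lambda>i. axis i (1::real)"
  have d1: "\<phi> differentiable at x" for x using C by (auto simp: numeral_2_eq_2)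
  have d2: "pd i \<phi> differentiable at x" for x i using C by (auto simp: numeral_2_eq_2
      pd_def[abs_def])
  have c: "isCont (pd j (pd i \<phi>)) x" for x i j
    using C by (auto simp: numeral_2_eq_2 pd_def[abs_def] continuous_on_eq_continuous_at)
  have ex: "\<exists>\<xi>. norm (\<xi> - x) \<le> 2 * s \<and>
      \<phi> (x + s *\<^sub>R ?e i + s *\<^sub>R ?e j) - \<phi> (x + s *\<^sub>R ?e i) - \<phi> (x + s *\<^sub>R ?e j) + \<phi> x = s * (s * pd
          j (pd i \<phi>) \<xi>)"
    if s: "s > 0" for s i j
  proof -
    define F where "F y = \<phi> (y + s *\<^sub>R ?e j) - \<phi> y" for y
    have dF: "(F has_derivative (\<lambda>h. frechet_derivative \<phi> (at (y + s *\<^sub>R ?e j)) h -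
        frechet_derivative \<phi> (at y) h)) (at y)" for y
      unfolding F_def
      by (intro has_derivative_diff frechet_derivative_works[THEN iffD1, OF d1]
         has_derivative_compose[OF _ frechet_derivative_works[THEN iffD1, OF d1], of "\<lambda>y. y + s *\<^sub>R
             ?e j" "\<lambda>h. h"])
        (auto intro!: derivative_eq_intros)
    then have "F differentiable at y" for y by (auto simp: differentiable_def)
    then obtain t where t: "0 < t" "t < 1"
      "F (x + s *\<^sub>R ?e i) - F x = frechet_derivative F (at (x + t *\<^sub>R (s *\<^sub>R ?e i))) (s *\<^sub>R ?e i)"
      using segment_mvt[of F x "s *\<^sub>R ?e i"] by metis
    define y where "y = x + t *\<^sub>R (s *\<^sub>R ?e i)"
    have lin: "frechet_derivative f (at z) (s *\<^sub>R v) = s * frechet_derivative f (at z) v"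
      if "f differentiable at z" for f :: "real^'a \<Rightarrow> real" and z v
      using that linear_frechet_derivative[OF that] by (simp add: linear_cmul)
    have "F (x + s *\<^sub>R ?e i) - F x = s * (pd i \<phi> (y + s *\<^sub>R ?e j) - pd i \<phi> y)"
      unfolding t(3) frechet_derivative_eqI[OF dF] y_def[symmetric] by (simp add: lin d1 pd_def
          right_diff_distrib)
    moreover obtain t' where t': "0 < t'" "t' < 1"
      "pd i \<phi> (y + s *\<^sub>R ?e j) - pd i \<phi> y = frechet_derivative (pd i \<phi>) (at (y + t' *\<^sub>R (s *\<^sub>R ?e
          j))) (s *\<^sub>R ?e j)"
      using segment_mvt[of "pd i \<phi>" y "s *\<^sub>R ?e j", OF d2] by metis
    ultimately have "F (x + s *\<^sub>R ?e i) - F x = s * (s * pd j (pd i \<phi>) (y + t' *\<^sub>R (s *\<^sub>R ?e j)))"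
      by (simp add: lin d2 pd_def[of j])
    moreover have "norm (y + t' *\<^sub>R (s *\<^sub>R ?e j) - x) \<le> 2 * s"
    proof -
      have "norm (y + t' *\<^sub>R (s *\<^sub>R ?e j) - x) \<le> norm (t *\<^sub>R (s *\<^sub>R ?e i)) + norm (t' *\<^sub>R (s *\<^sub>R ?e
          j))"

        using norm_triangle_ineq[of "t *\<^sub>R (s *\<^sub>R ?e i)" "t' *\<^sub>R (s *\<^sub>R ?e j)"] by (simp add: y_def
            algebra_simps)
      also have "\<dots> \<le> s + s" using t t' s by (intro add_mono) (auto simp: mult_left_le_one_le)
      finally show ?thesis by simp
    qed
    ultimately show ?thesis by (intro exI[of _ "y + t' *\<^sub>R (s *\<^sub>R ?e j)"]) (auto simp: F_def
        algebra_simps)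
  qed
  define s where "s n = inverse (real (Suc n))" for n
  have s: "s n > 0" for n by (simp add: s_def)
  have "\<exists>\<xi> \<xi>'. norm (\<xi> - x) \<le> 2 * s n \<and> norm (\<xi>' - x) \<le> 2 * s n \<and> pd j (pd i \<phi>) \<xi> = pd i (pd j \<phi>)
      \<xi>'" for n
  proof -
    obtain \<xi> where 1: "norm (\<xi> - x) \<le> 2 * s n"
      "\<phi> (x + s n *\<^sub>R ?e i + s n *\<^sub>R ?e j) - \<phi> (x + s n *\<^sub>R ?e i) - \<phi> (x + s n *\<^sub>R ?e j) + \<phi> x = s n
          * (s n * pd j (pd i \<phi>) \<xi>)"
      using ex[OF s] by blast
    obtain \<xi>' where 2: "norm (\<xi>' - x) \<le> 2 * s n"
      "\<phi> (x + s n *\<^sub>R ?e j + s n *\<^sub>R ?e i) - \<phi> (x + s n *\<^sub>R ?e j) - \<phi> (x + s n *\<^sub>R ?e i) + \<phi> x = s n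
          * (s n * pd i (pd j \<phi>) \<xi>')"
      using ex[OF s] by blast
    have "s n * (s n * pd j (pd i \<phi>) \<xi>) = s n * (s n * pd i (pd j \<phi>) \<xi>')"
      using 1(2) 2(2) by (simp add: algebra_simps)
    then have "pd j (pd i \<phi>) \<xi> = pd i (pd j \<phi>) \<xi>'"
      using s[of n] by (metis less_irrefl mult_left_cancel)
    with 1(1) 2(1) show ?thesis by blast
  qed
  then obtain \<xi> \<xi>' where \<xi>: "\<And>n. norm (\<xi> n - x) \<le> 2 * s n" "\<And>n. norm (\<xi>' n - x) \<le> 2 * s n"
    "\<And>n. pd j (pd i \<phi>) (\<xi> n) = pd i (pd j \<phi>) (\<xi>' n)" by metis
  have s0: "(\<lambda>n. 2 * s n) \<longlonglongrightarrow> 0" unfolding s_def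
    by (rule tendsto_mult_right_zero[OF LIMSEQ_inverse_real_of_nat])
  have "\<xi> \<longlonglongrightarrow> x" "\<xi>' \<longlonglongrightarrow> x"
    using \<xi>(1,2) by (auto intro!: Lim_null[THEN iffD2] Lim_null_comparison[OF _ s0]
        always_eventually)
  then have "(\<lambda>n. pd j (pd i \<phi>) (\<xi> n)) \<longlonglongrightarrow> pd j (pd i \<phi>) x" "(\<lambda>n. pd i (pd j \<phi>) (\<xi>' n)) \<longlonglongrightarrow> pd i (pd j
      \<phi>) x"
    by (auto intro: isCont_tendsto_compose[OF c])
  then show ?thesis using \<xi>(3) LIMSEQ_unique by fastforce
qed

text \<open>\<open>flat 1 t\<close> is \<open>e^(-1/t)\<close> for \<open>t > 0\<close>, and one
  factor belongs to each face of the box. These functions serve as localizing cutoffs and, after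
  normalization, as mollifiers.\<close>

definition bump :: "real ^ 'd \<Rightarrow> real ^ 'd \<Rightarrow> real ^ 'd \<Rightarrow> real" where
  "bump a b x = (\<Prod>i\<in>UNIV. flat 1 (x $ i - a $ i) * flat 1 (b $ i - x $ i))"

lemma flat_1: "flat 1 t \<ge> 0" "flat 1 t \<le> 1" "flat 1 t > 0 \<longleftrightarrow> t > 0"
  by (auto simp: flat_def)

lemma bump_bounds: "0 \<le> bump a b x" "bump a b x \<le> 1"
  unfolding bump_def by (auto intro!: prod_nonneg prod_le_1 mult_le_one simp: flat_1)

lemma bump_pos_iff: "0 < bump a b x \<longleftrightarrow> x \<in> box a b"
proof -
  have "bump a b x = 0 \<longleftrightarrow> (\<exists>i. flat 1 (x $ i - a $ i) = 0 \<or> flat 1 (b $ i - x $ i) = 0)"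
    by (auto simp: bump_def)
  then have "0 < bump a b x \<longleftrightarrow> (\<forall>i. 0 < flat 1 (x $ i - a $ i) \<and> 0 < flat 1 (b $ i - x $ i))"
    by (metis bump_bounds(1) flat_1(1) less_le)
  then show ?thesis by (auto simp: flat_1 mem_box_cart)
qed

lemma bump_test:
  assumes "cbox a b \<subseteq> \<Omega>"
  shows "bump a b \<in> test_functions \<Omega>"
proof (rule test_functionsI[OF _ compact_cbox assms])
  show "Ck k (bump a b)" for k
  proof -
    have "Ck k (\<lambda>x. \<Prod>i\<in>UNIV. flat 1 (1 * x $ i + (- a $ i)) * flat 1 ((-1) * x $ i + b $ i))"
      by (intro Ck_prod Ck_mult Ck_flat) auto
    then show ?thesis by (simp add: bump_def[abs_def])
  qed
  fix x assume "x \<notin> cbox a b"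
  then have "\<not> 0 < bump a b x" using box_subset_cbox by (auto simp: bump_pos_iff)
  then show "bump a b x = 0" using bump_bounds(1)[of a b x] by simp
qed

section \<open>Translations and convolutions\<close>

lemma integrable_translate:
  fixes f :: "'a::euclidean_space \<Rightarrow> 'b::{banach,second_countable_topology}"
  assumes "integrable lborel f"
  shows "integrable lborel (\<lambda>x. f (x + a))"
proof -
  have [measurable]: "f \<in> borel_measurable borel" using assms by auto
  have "integrable (distr lborel borel ((+) a)) f" using assms by (simp add: lborel_distr_plus)
  then have "integrable lborel (\<lambda>x. f (a + x))" by (subst (asm) integrable_distr_eq) auto
  then show ?thesis by (simp add: add.commute)
qed

lemma integral_translate:
  fixes f :: "'a::euclidean_space \<Rightarrow> 'b::{banach,second_countable_topology}"
  assumes "f \<in> borel_measurable borel"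
  shows "(LINT x|lborel. f (x + a)) = (LINT x|lborel. f x)"
proof -
  have "(LINT x|lborel. f x) = (LINT x|distr lborel borel ((+) a). f x)" by (simp add:
      lborel_distr_plus)
  also have "\<dots> = (LINT x|lborel. f (a + x))" using assms by (subst integral_distr) auto
  finally show ?thesis by (simp add: add.commute)
qed

lemma nn_integral_translate:
  fixes f :: "'a::euclidean_space \<Rightarrow> ennreal"
  assumes "f \<in> borel_measurable borel"
  shows "(\<integral>\<^sup>+x. f (x + a) \<partial>lborel) = (\<integral>\<^sup>+x. f x \<partial>lborel)"
proof -
  have "(\<integral>\<^sup>+x. f x \<partial>lborel) = (\<integral>\<^sup>+x. f x \<partial>distr lborel borel ((+) a))" by (simp add:
      lborel_distr_plus)
  also have "\<dots> = (\<integral>\<^sup>+x. f (a + x) \<partial>lborel)" using assms by (subst nn_integral_distr) auto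
  finally show ?thesis by (simp add: add.commute)
qed

text \<open>Induction over integrable functions reduces the claim to indicators of Borel sets, and
  outer regularity reduces it further to open sets, whose points stay inside under small
  shifts.\<close>

lemma translation_continuous_L1:
  fixes f :: "'a::euclidean_space \<Rightarrow> real"
  assumes f: "integrable lborel f" and h: "h \<longlonglongrightarrow> 0"
  shows "(\<lambda>n. LINT x|lborel. \<bar>f (x + h n) - f x\<bar>) \<longlonglongrightarrow> 0"
  using f
proof (induct rule: integrable_induct)
  case (base A c)
  then have A: "A \<in> sets borel" "emeasure lborel A < \<infinity>" by auto
  have opn: "(\<lambda>n. LINT x|lborel. \<bar>indicator U (x + h n) - indicator U x\<bar>) \<longlonglongrightarrow> (0::real)"
    if U: "open U" "emeasure lborel U < \<infinity>" for U :: "'a set"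
  proof -
    have [measurable]: "U \<in> sets borel" using U by auto
    have iU: "integrable lborel (indicator U :: _ \<Rightarrow> real)" using U by simp
    \<comment> \<open>The first bracket integrates to 0 by translation invariance; the second term
      is dominated by \<open>indicator U\<close> and tends to 0 at every point. So no common
      dominating function for the shifted indicators has to be found.\<close>
    have eq: "\<bar>indicator U (x + h n) - indicator U x :: real\<bar> =
        (indicator U (x + h n) - indicator U x) + 2 * max 0 (indicator U x - indicator U (x + h n))"
            for x n
      by (auto simp: indicator_def)
    have im: "integrable lborel (\<lambda>x. max 0 (indicator U x - indicator U (x + h n) :: real))" for n
      by (rule Bochner_Integration.integrable_bound[OF iU]) (auto simp: indicator_def)
    have "(\<lambda>n. LINT x|lborel. max 0 (indicator U x - indicator U (x + h n))) \<longlonglongrightarrow> (LINT x::'a|lborel.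
        (0::real))"
    proof (rule integral_dominated_convergence[where w="indicator U"])
      show "AE x in lborel. (\<lambda>n. max 0 (indicator U x - indicator U (x + h n)) :: real) \<longlonglongrightarrow> 0"
      proof (intro always_eventually allI)
        fix x
        show "(\<lambda>n. max 0 (indicator U x - indicator U (x + h n)) :: real) \<longlonglongrightarrow> 0"
        proof (cases "x \<in> U")
          case True
          have "(\<lambda>n. x + h n) \<longlonglongrightarrow> x + 0" by (intro tendsto_intros h)
          then have "\<forall>\<^sub>F n in sequentially. x + h n \<in> U" using U True by (intro
              topological_tendstoD) auto
          then show ?thesis
            by (intro tendsto_eventually) (auto elim!: eventually_mono simp: indicator_def)
        qed (auto simp: indicator_def)
      qed
    qed (use iU in \<open>auto simp: indicator_def\<close>)
    then have "(\<lambda>n. 2 * (LINT x|lborel. max 0 (indicator U x - indicator U (x + h n)))) \<longlonglongrightarrow> (0::real)"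
      by (intro tendsto_mult_right_zero) simp
    also have "(\<lambda>n. 2 * (LINT x|lborel. max 0 (indicator U x - indicator U (x + h n)))) =
       (\<lambda>n. LINT x|lborel. \<bar>indicator U (x + h n) - indicator U x\<bar> :: real)"
    proof
      fix n
      have "(LINT x|lborel. \<bar>indicator U (x + h n) - indicator U x\<bar> :: real) =
         ((LINT x|lborel. indicator U (x + h n)) - (LINT x|lborel. indicator U x)) +
         2 * (LINT x|lborel. max 0 (indicator U x - indicator U (x + h n)))"
        unfolding eq using iU im integrable_translate[OF iU, of "h n"] by simp
      also have "(LINT x|lborel. indicator U (x + h n)) = (LINT x|lborel. indicator U x :: real)"
        by (rule integral_translate) auto
      finally show "2 * (LINT x|lborel. max 0 (indicator U x - indicator U (x + h n))) =
        (LINT x|lborel. \<bar>indicator U (x + h n) - indicator U x\<bar> :: real)" by simp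
    qed
    finally show ?thesis .
  qed
  have ind: "(\<lambda>n. LINT x|lborel. \<bar>indicator A (x + h n) - indicator A x\<bar>) \<longlonglongrightarrow> (0::real)"
  proof (rule LIMSEQ_I)
    fix e :: real assume e: "0 < e"
    have Al: "A \<in> sets lebesgue" using A by simp
    obtain U where U: "open U" "A \<subseteq> U" "emeasure lebesgue (U - A) < ennreal (e/4)"
      by (rule sets_lebesgue_outer_open[OF Al, of "e/4"]) (use e in simp)
    have mU[measurable]: "U \<in> sets borel" "A \<in> sets borel" using U A by auto
    have UA: "emeasure lborel (U - A) < ennreal (e/4)" using U(3) mU by simp
    have "emeasure lborel U \<le> emeasure lborel A + emeasure lborel (U - A)"
      using U(2) mU by (intro order_trans[OF _ emeasure_subadditive]) (auto intro!: emeasure_mono)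
    also have "\<dots> < \<infinity>"
    proof -
      have "emeasure lborel (U - A) \<noteq> top" using UA by auto
      then show ?thesis using A by (simp add: less_top)
    qed
    finally have fU: "emeasure lborel U < \<infinity>" .
    have iUA: "integrable lborel (indicator (U - A) :: _ \<Rightarrow> real)"
      using UA mU by (intro integrable_real_indicator) (auto simp: less_top intro:
          order.strict_trans)
    have mUA: "(LINT x|lborel. indicator (U - A) x :: real) < e/4"
    proof -
      have "ennreal (measure lborel (U - A)) = emeasure lborel (U - A)"
        using UA by (intro emeasure_eq_ennreal_measure[symmetric]) auto
      then have "ennreal (measure lborel (U - A)) < ennreal (e/4)" using UA by simp
      then show ?thesis using e by (simp add: ennreal_less_iff)
    qed
    obtain N where N: "\<And>n. n \<ge> N \<Longrightarrow> norm ((LINT x|lborel. \<bar>indicator U (x + h n) - indicator U x\<bar>) -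
        (0::real)) < e/2"
      using LIMSEQ_D[OF opn[OF U(1) fU], of "e/2"] e by auto
    show "\<exists>N. \<forall>n\<ge>N. norm ((LINT x|lborel. \<bar>indicator A (x + h n) - indicator A x\<bar>) - (0::real)) < e"
    proof (intro exI[of _ N] allI impI)
      fix n assume "n \<ge> N"
      note n = N[OF this]
      have iU: "integrable lborel (indicator U :: _ \<Rightarrow> real)" using fU by simp
      have iA: "integrable lborel (indicator A :: _ \<Rightarrow> real)" using A by simp
      note its = integrable_translate[OF iUA, of "h n"]
      note i1 = integrable_abs[OF Bochner_Integration.integrable_diff[OF integrable_translate[OF iU,
          of "h n"] iU]]
      note i2 = Bochner_Integration.integrable_add[OF its iUA]
      \<comment> \<open>Replacing \<open>A\<close> by \<open>U\<close> costs the measure of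
        \<open>U - A\<close> once at \<open>x\<close> and once at \<open>x + h n\<close>, less than
        \<open>e/4\<close> each time.\<close>
      have "(LINT x|lborel. \<bar>indicator A (x + h n) - indicator A x\<bar> :: real) \<le>
         (LINT x|lborel. \<bar>indicator U (x + h n) - indicator U x\<bar> + (indicator (U - A) (x + h n) +
             indicator (U - A) x))"
      proof (rule integral_mono)
        show "integrable lborel (\<lambda>x. \<bar>indicator A (x + h n) - indicator A x :: real\<bar>)"
          by (rule integrable_abs[OF Bochner_Integration.integrable_diff[OF integrable_translate[OF
              iA] iA]])
        show "integrable lborel (\<lambda>x. \<bar>indicator U (x + h n) - indicator U x\<bar> + (indicator (U - A) (x
            + h n) + indicator (U - A) x :: real))"
          by (rule Bochner_Integration.integrable_add[OF i1 i2])
      qed (use U(2) in \<open>auto simp: indicator_def\<close>)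
      also have "\<dots> = (LINT x|lborel. \<bar>indicator U (x + h n) - indicator U x\<bar>) +
         ((LINT x|lborel. indicator (U - A) (x + h n)) + (LINT x|lborel. indicator (U - A) x))"
        by (simp only: Bochner_Integration.integral_add[OF i1 i2]
            Bochner_Integration.integral_add[OF its iUA])
      also have "(LINT x|lborel. indicator (U - A) (x + h n)) = (LINT x|lborel. indicator (U - A) x
          :: real)"
        by (rule integral_translate) auto
      finally show "norm ((LINT x|lborel. \<bar>indicator A (x + h n) - indicator A x\<bar>) - (0::real)) < e"
        using n mUA by (simp add: integral_nonneg_AE)
    qed
  qed
  have "(\<lambda>n. \<bar>c\<bar> * (LINT x|lborel. \<bar>indicator A (x + h n) - indicator A x\<bar>)) \<longlonglongrightarrow> 0"
    by (rule tendsto_mult_right_zero[OF ind])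
  moreover have "\<bar>indicator A (x + h n) *\<^sub>R c - indicator A x *\<^sub>R c\<bar> = \<bar>c\<bar> * \<bar>indicator A (x + h n)
      - indicator A x\<bar>" for n x
    by (simp add: abs_mult[symmetric] algebra_simps)
  ultimately show ?case by simp
next
  case (add f g)
  have [measurable]: "f \<in> borel_measurable borel" "g \<in> borel_measurable borel" using add by auto
  show ?case
  proof (rule tendsto_sandwich[OF _ _ tendsto_const])
    show "(\<lambda>n. (LINT x|lborel. \<bar>f (x + h n) - f x\<bar>) + (LINT x|lborel. \<bar>g (x + h n) - g x\<bar>)) \<longlonglongrightarrow> 0"
      using tendsto_add[OF add(2,4)] by simp
    show "\<forall>\<^sub>F n in sequentially. (LINT x|lborel. \<bar>f (x + h n) + g (x + h n) - (f x + g x)\<bar>)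
      \<le> (LINT x|lborel. \<bar>f (x + h n) - f x\<bar>) + (LINT x|lborel. \<bar>g (x + h n) - g x\<bar>)"
    proof (intro always_eventually allI)
      fix n
      have i: "integrable lborel (\<lambda>x. f (x + h n))" "integrable lborel (\<lambda>x. g (x + h n))"
        using add by (auto intro: integrable_translate)
      have "(LINT x|lborel. \<bar>f (x + h n) + g (x + h n) - (f x + g x)\<bar>)
        \<le> (LINT x|lborel. \<bar>f (x + h n) - f x\<bar> + \<bar>g (x + h n) - g x\<bar>)"
        by (rule integral_mono) (use i add(1,3) in auto)
      also have "\<dots> = (LINT x|lborel. \<bar>f (x + h n) - f x\<bar>) + (LINT x|lborel. \<bar>g (x + h n) - g x\<bar>)"
        by (rule Bochner_Integration.integral_add) (use i add(1,3) in auto)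
      finally show "(LINT x|lborel. \<bar>f (x + h n) + g (x + h n) - (f x + g x)\<bar>)
        \<le> (LINT x|lborel. \<bar>f (x + h n) - f x\<bar>) + (LINT x|lborel. \<bar>g (x + h n) - g x\<bar>)" .
    qed
  qed (auto intro!: always_eventually integral_nonneg_AE)
next
  case (lim f s)
  have [measurable]: "f \<in> borel_measurable borel" "\<And>i. s i \<in> borel_measurable borel" using lim by
      auto
  have "(\<lambda>i. LINT x|lborel. \<bar>f x - s i x\<bar>) \<longlonglongrightarrow> (LINT x::'a|lborel. (0::real))"
  proof (rule integral_dominated_convergence[where w="\<lambda>x. 3 * \<bar>f x\<bar>"])
    show "AE x in lborel. (\<lambda>i. \<bar>f x - s i x\<bar>) \<longlonglongrightarrow> 0"
    proof (intro always_eventually allI)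
      fix x
      have "(\<lambda>i. \<bar>f x - s i x\<bar>) \<longlonglongrightarrow> \<bar>f x - f x\<bar>" by (intro tendsto_intros lim) auto
      then show "(\<lambda>i. \<bar>f x - s i x\<bar>) \<longlonglongrightarrow> 0" by simp
    qed
    show "AE x in lborel. norm \<bar>f x - s i x\<bar> \<le> 3 * \<bar>f x\<bar>" for i
    proof (intro always_eventually allI)
      fix x show "norm \<bar>f x - s i x\<bar> \<le> 3 * \<bar>f x\<bar>" using lim(4)[of x i] by auto
    qed
  qed (use lim in auto)
  then have l0: "(\<lambda>i. LINT x|lborel. \<bar>f x - s i x\<bar>) \<longlonglongrightarrow> 0" by simp
  show ?case
  proof (rule LIMSEQ_I)
    fix e :: real assume e: "0 < e"
    obtain i where i: "\<bar>LINT x|lborel. \<bar>f x - s i x\<bar>\<bar> < e/4"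
      using LIMSEQ_D[OF l0, of "e/4"] e by auto
    obtain N where N: "\<And>n. n \<ge> N \<Longrightarrow> \<bar>LINT x|lborel. \<bar>s i (x + h n) - s i x\<bar>\<bar> < e/2"
      using LIMSEQ_D[OF lim(2)[of i], of "e/2"] e by auto
    have fs: "integrable lborel (\<lambda>x. \<bar>f x - s i x\<bar>)" using lim by auto
    have "norm ((LINT x|lborel. \<bar>f (x + h n) - f x\<bar>) - 0) < e" if n: "n \<ge> N" for n
    proof -
      have it: "integrable lborel (\<lambda>x. \<bar>f (x + h n) - s i (x + h n)\<bar>)" "integrable lborel (\<lambda>x. \<bar>s i
          (x + h n) - s i x\<bar>)"
        using integrable_translate[OF fs] integrable_translate[OF lim(1)] lim(1) by auto
      have "(LINT x|lborel. \<bar>f (x + h n) - f x\<bar>) \<le>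
         (LINT x|lborel. \<bar>f (x + h n) - s i (x + h n)\<bar> + (\<bar>s i (x + h n) - s i x\<bar> + \<bar>f x - s i x\<bar>))"
        by (rule integral_mono) (use it fs integrable_translate[OF lim(5)] lim(5) in auto)
      also have "\<dots> = (LINT x|lborel. \<bar>f (x + h n) - s i (x + h n)\<bar>) + ((LINT x|lborel. \<bar>s i (x + h
          n) - s i x\<bar>) + (LINT x|lborel. \<bar>f x - s i x\<bar>))"
        by (simp only: Bochner_Integration.integral_add[OF it(1)
            Bochner_Integration.integrable_add[OF it(2) fs]] Bochner_Integration.integral_add[OF
            it(2) fs])
      also have "(LINT x|lborel. \<bar>f (x + h n) - s i (x + h n)\<bar>) = (LINT x|lborel. \<bar>f x - s i x\<bar>)"
        by (rule integral_translate[where f="\<lambda>x. \<bar>f x - s i x\<bar>"]) auto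
      finally show ?thesis using i N[OF n] by (simp add: integral_nonneg_AE)
    qed
    then show "\<exists>N. \<forall>n\<ge>N. norm ((LINT x|lborel. \<bar>f (x + h n) - f x\<bar>) - 0) < e" by blast
  qed
qed

section \<open>Convolution with test functions, and weak gradients\<close>

definition conv :: "(real ^ 'd \<Rightarrow> real) \<Rightarrow> (real ^ 'd \<Rightarrow> real) \<Rightarrow> real ^ 'd \<Rightarrow> real" where
  "conv \<rho> f x = (LINT y|lborel. \<rho> (x - y) * f y)"

lemma test_functions_measurable: "\<phi> \<in> test_functions \<Omega> \<Longrightarrow> \<phi> \<in> borel_measurable borel"
  by (intro borel_measurable_continuous_onI test_functionsD)

lemma integrable_bounded_mult:
  fixes f g :: "'a \<Rightarrow> real"
  assumes [measurable]: "g \<in> borel_measurable M" and g: "\<And>x. \<bar>g x\<bar> \<le> B" and f: "integrable M f"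
  shows "integrable M (\<lambda>x. g x * f x)"
proof (rule Bochner_Integration.integrable_bound[where f="\<lambda>x. B * f x"])
  show "AE x in M. norm (g x * f x) \<le> norm (B * f x)"
  proof (intro AE_I2)
    fix x
    have "\<bar>g x\<bar> \<le> \<bar>B\<bar>" using g[of x] by linarith
    then show "norm (g x * f x) \<le> norm (B * f x)" by (simp add: abs_mult mult_right_mono)
  qed
qed (use f in auto)

lemma test_mult_integrable:
  assumes "\<phi> \<in> test_functions \<Omega>" "integrable lborel f"
  shows "integrable lborel (\<lambda>x. \<phi> x * f x)"
proof -
  obtain B where "\<And>x. \<bar>\<phi> x\<bar> \<le> B" using test_functions_bounded[OF assms(1)] by metis
  then show ?thesis
    using test_functions_measurable[OF assms(1)] assms(2) by (intro integrable_bounded_mult[where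
        B=B]) auto
qed

lemma test_integrable:
  fixes \<phi> :: "real^'d \<Rightarrow> real"
  assumes "\<phi> \<in> test_functions \<Omega>"
  shows "integrable lborel \<phi>"
proof -
  let ?K = "closure {x. \<phi> x \<noteq> 0}"
  have "integrable lborel (\<lambda>x. \<phi> x * indicator ?K x)"
    using test_functionsD(2)[OF assms]
    by (intro test_mult_integrable[OF assms] integrable_real_indicator emeasure_compact_finite) auto
  also have "(\<lambda>x. \<phi> x * indicator ?K x) = \<phi>"
    using closure_subset[of "{x. \<phi> x \<noteq> 0}"] by (auto simp: fun_eq_iff indicator_def)
  finally show ?thesis .
qed

lemma conv_integrable:
  assumes "\<rho> \<in> test_functions UNIV" "integrable lborel f"
  shows "integrable lborel (\<lambda>y. \<rho> (x - y) * f y)"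
proof -
  obtain B where "\<And>x. \<bar>\<rho> x\<bar> \<le> B" using test_functions_bounded[OF assms(1)] by metis
  moreover have "(\<lambda>y. \<rho> (x - y)) \<in> borel_measurable lborel"
    using test_functions_measurable[OF assms(1)] by measurable
  ultimately show ?thesis using assms by (intro integrable_bounded_mult[where B=B]) auto
qed

text \<open>\<open>test_functions_quadratic\<close> bounds the remainder by
  \<open>L (norm (z - x))^2\<close> times the \<open>L^1\<close> norm of \<open>f\<close>. As the
  derivative is again a convolution with a test function, smoothness of all orders follows by
  iteration.\<close>

lemma conv_has_derivative:
  assumes \<rho>: "\<rho> \<in> test_functions UNIV" and f: "integrable lborel f"
  shows "(conv \<rho> f has_derivative (\<lambda>h. conv (\<lambda>z. frechet_derivative \<rho> (at z) h) f x)) (at x)"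
proof -
  obtain L where L: "L > 0"
    "\<And>z h. \<bar>\<rho> (z + h) - \<rho> z - frechet_derivative \<rho> (at z) h\<bar> \<le> L * (norm h)\<^sup>2"
    using test_functions_quadratic[OF \<rho>] by metis
  note int1 = conv_integrable[OF \<rho> f]
  note int2 = conv_integrable[OF test_functions_deriv[OF \<rho>] f]
  have lin: "linear (frechet_derivative \<rho> (at z))" for z
    by (rule linear_frechet_derivative[OF test_functionsD(5)[OF \<rho>]])
  define D where "D h = conv (\<lambda>z. frechet_derivative \<rho> (at z) h) f x" for h
  have "linear D"
  proof (rule linearI)
    fix h k :: "real^'a" and c :: real
    show "D (h + k) = D h + D k"
      unfolding D_def conv_def linear_add[OF lin] distrib_right by (intro
          Bochner_Integration.integral_add int2)
    show "D (c *\<^sub>R h) = c *\<^sub>R D h"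
      unfolding D_def conv_def linear_cmul[OF lin] by (simp add: mult.assoc)
  qed
  then have bl: "bounded_linear D" by (rule linear_conv_bounded_linear[THEN iffD1])
  define F where "F = (LINT y|lborel. \<bar>f y\<bar>)"
  have F: "F \<ge> 0" by (simp add: F_def integral_nonneg_AE)
  have est: "\<bar>conv \<rho> f z - conv \<rho> f x - D (z - x)\<bar> \<le> L * (norm (z - x))\<^sup>2 * F" for z
  proof -
    note i12 = Bochner_Integration.integrable_diff[OF int1[of z] int1[of x]]
    note i3 = Bochner_Integration.integrable_diff[OF i12 int2[of x "z - x"]]
    have "conv \<rho> f z - conv \<rho> f x - D (z - x) =
       (LINT y|lborel. \<rho> (z - y) * f y - \<rho> (x - y) * f y - frechet_derivative \<rho> (at (x - y)) (z - x)
           * f y)"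
      unfolding conv_def D_def
      by (simp only: Bochner_Integration.integral_diff[OF i12 int2]
          Bochner_Integration.integral_diff[OF int1 int1])
    then have "\<bar>conv \<rho> f z - conv \<rho> f x - D (z - x)\<bar> \<le> (LINT y|lborel. \<bar>\<rho> (z - y) * f y - \<rho> (x - y)
        * f y - frechet_derivative \<rho> (at (x - y)) (z - x) * f y\<bar>)"
      by (simp only: integral_abs_bound)
    also have "\<dots> \<le> (LINT y|lborel. L * (norm (z - x))\<^sup>2 * \<bar>f y\<bar>)"
    proof (rule integral_mono[OF integrable_abs[OF i3] integrable_mult_right[OF integrable_abs[OF
        f]]])
      fix y
      have "\<rho> (z - y) * f y - \<rho> (x - y) * f y - frechet_derivative \<rho> (at (x - y)) (z - x) * f y =
         (\<rho> ((x - y) + (z - x)) - \<rho> (x - y) - frechet_derivative \<rho> (at (x - y)) (z - x)) * f y"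
        by (simp add: algebra_simps)
      then show "\<bar>\<rho> (z - y) * f y - \<rho> (x - y) * f y - frechet_derivative \<rho> (at (x - y)) (z - x) * f
          y\<bar> \<le> L * (norm (z - x))\<^sup>2 * \<bar>f y\<bar>"
        using L(2)[of "x - y" "z - x"] by (simp add: abs_mult mult_right_mono)
    qed
    finally show ?thesis by (simp add: F_def)
  qed
  have "(conv \<rho> f has_derivative D) (at x)"
  proof (rule has_derivativeI_sandwich[of 1])
    show "norm ((conv \<rho> f z - conv \<rho> f x) - D (z - x)) / norm (z - x) \<le> L * F * norm (z - x)" if "z
        \<noteq> x" for z
      using est[of z] that by (simp add: field_simps power2_eq_square)
    have "((\<lambda>z. L * F * norm (z - x)) \<longlongrightarrow> L * F * norm (x - x)) (at x)" by (intro tendsto_intros)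
    then show "((\<lambda>z. L * F * norm (z - x)) \<longlongrightarrow> 0) (at x)" by simp
  qed (use bl in auto)
  then show ?thesis by (simp add: D_def[abs_def])
qed

lemma conv_Ck:
  assumes "\<rho> \<in> test_functions UNIV" "integrable lborel f"
  shows "Ck k (conv \<rho> f)"
  using assms(1)
proof (induction k arbitrary: \<rho>)
  case 0
  then show ?case using conv_has_derivative[OF 0 assms(2)]
    by (auto simp: continuous_on_eq_continuous_at intro: has_derivative_continuous)
next
  case (Suc k)
  show ?case
    by (rule Ck_SucI[OF conv_has_derivative[OF Suc.prems assms(2)]]) (intro Suc.IH
        test_functions_deriv Suc.prems)
qed

lemma conv_measurable [measurable]:
  "\<rho> \<in> test_functions UNIV \<Longrightarrow> integrable lborel f \<Longrightarrow> conv \<rho> f \<in> borel_measurable borel"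
  by (intro borel_measurable_continuous_onI Ck_continuous[of 0] conv_Ck)

lemma pd_conv:
  assumes "\<rho> \<in> test_functions UNIV" "integrable lborel f"
  shows "pd i (conv \<rho> f) x = conv (pd i \<rho>) f x"
  unfolding pd_def[abs_def] frechet_derivative_eqI[OF conv_has_derivative[OF assms]] ..

text \<open>Integrals extend over the whole space because \<open>\<phi>\<close> and its derivatives
  vanish off \<open>\<Omega>\<close>. Integrability of \<open>u\<close> and \<open>g\<close> is kept
  apart, as a hypothesis wherever it matters.\<close>

definition weak_grad ::
    "(real ^ 'd) set \<Rightarrow> (real ^ 'd \<Rightarrow> real) \<Rightarrow> ('d \<Rightarrow> real ^ 'd \<Rightarrow> real) \<Rightarrow> bool" where
  "weak_grad \<Omega> u g \<longleftrightarrow> (\<forall>\<phi>\<in>test_functions \<Omega>. \<forall>k.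
     (LINT x|lborel. u x * pd k \<phi> x) = - (LINT x|lborel. g k x * \<phi> x))"

lemma weak_grad_diff:
  assumes "weak_grad \<Omega> u g" "weak_grad \<Omega> v h"
    and i: "integrable lborel u" "integrable lborel v" "\<And>k. integrable lborel (g k)" "\<And>k. integrable
        lborel (h k)"
  shows "weak_grad \<Omega> (\<lambda>x. u x - v x) (\<lambda>k x. g k x - h k x)"
  unfolding weak_grad_def
proof (intro ballI allI)
  fix \<phi> k assume \<phi>: "\<phi> \<in> test_functions \<Omega>"
  note I = test_mult_integrable[OF \<phi> i(3)] test_mult_integrable[OF \<phi> i(4)]
     test_mult_integrable[OF test_functions_pd[OF \<phi>] i(1)] test_mult_integrable[OF
         test_functions_pd[OF \<phi>] i(2)]
  show "(LINT x|lborel. (u x - v x) * pd k \<phi> x) = - (LINT x|lborel. (g k x - h k x) * \<phi> x)"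
    unfolding mult.commute[of _ "pd k \<phi> _"] mult.commute[of _ "\<phi> _"] right_diff_distrib
    using assms(1,2)[unfolded weak_grad_def, rule_format, OF \<phi>, of k] I
    by (simp add: mult.commute)
qed

lemma test_reflect:
  assumes \<rho>: "\<rho> \<in> test_functions UNIV" and r: "\<And>z. \<rho> z \<noteq> 0 \<Longrightarrow> norm z \<le> r" and x: "cball x r \<subseteq> \<Omega>"
  shows "(\<lambda>y. \<rho> (x - y)) \<in> test_functions \<Omega>"
proof (rule test_functionsI[OF _ compact_cball x])
  show "Ck k (\<lambda>y. \<rho> (x - y))" for k
    using Ck_affine[OF test_functionsD(1)[OF \<rho>], of k "-1" x] by simp
  show "\<rho> (x - y) = 0" if "y \<notin> cball x r" for y
    using that r[of "x - y"] by (auto simp: dist_norm)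
qed

lemma pd_reflect:
  assumes \<rho>: "\<rho> \<in> test_functions \<Omega>"
  shows "pd i (\<lambda>y. \<rho> (x - y)) y = - pd i \<rho> (x - y)"
proof -
  have "((\<lambda>y. \<rho> (x - y)) has_derivative (\<lambda>h. frechet_derivative \<rho> (at (x - y)) (- h))) (at y)"
    by (rule has_derivative_compose[OF _ frechet_derivative_works[THEN iffD1, OF
        test_functionsD(5)[OF \<rho>]], of "\<lambda>y. x - y" "\<lambda>h. - h"])
      (auto intro!: derivative_eq_intros)
  then show ?thesis
    using linear_frechet_derivative[OF test_functionsD(5)[OF \<rho>], of "x - y"]
    by (simp add: pd_def frechet_derivative_eqI linear_neg)
qed

text \<open>As the ball of radius \<open>r\<close> about \<open>x\<close> lies in
  \<open>\<Omega>\<close>, the function \<open>y \<mapsto> \<rho> (x - y)\<close> is an admissible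
  test function, and the sign from the reflection cancels the sign in the weak equation. For
  functions extended by zero the identity can fail closer to the boundary.\<close>

lemma pd_conv_weak:
  assumes \<rho>: "\<rho> \<in> test_functions UNIV" and r: "\<And>z. \<rho> z \<noteq> 0 \<Longrightarrow> norm z \<le> r" and x: "cball x r \<subseteq> \<Omega>"
    and u: "integrable lborel u" "weak_grad \<Omega> u g"
  shows "pd i (conv \<rho> u) x = conv \<rho> (g i) x"
proof -
  have "pd i (conv \<rho> u) x = (LINT y|lborel. pd i \<rho> (x - y) * u y)"
    unfolding pd_conv[OF \<rho> u(1)] conv_def ..
  also have "\<dots> = - (LINT y|lborel. u y * pd i (\<lambda>y. \<rho> (x - y)) y)"
    by (simp add: pd_reflect[OF \<rho>] mult.commute)
  also have "\<dots> = (LINT y|lborel. g i y * \<rho> (x - y))"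
    using u(2) test_reflect[OF \<rho> r x] unfolding weak_grad_def by simp
  finally show ?thesis by (simp add: conv_def mult.commute)
qed

section \<open>Mollifiers\<close>

text \<open>Evenness is required so that \<open>conv \<rho> f x\<close> is the average of the
  translates \<open>f (x + h)\<close> with weight \<open>\<rho> h\<close>.\<close>

definition mollifier :: "real \<Rightarrow> (real ^ 'd \<Rightarrow> real) \<Rightarrow> bool" where
  "mollifier r \<rho> \<longleftrightarrow> \<rho> \<in> test_functions UNIV \<and> (\<forall>z. 0 \<le> \<rho> z) \<and> (\<forall>z. \<rho> (- z) = \<rho> z) \<and>
     (\<forall>z. \<rho> z \<noteq> 0 \<longrightarrow> norm z \<le> r) \<and> (LINT z|lborel. \<rho> z) = 1"

lemma mollifierD:
  assumes "mollifier r \<rho>"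
  shows "\<rho> \<in> test_functions UNIV" "0 \<le> \<rho> z" "\<rho> (- z) = \<rho> z" "\<rho> z \<noteq> 0 \<Longrightarrow> norm z \<le> r"
    "(LINT z|lborel. \<rho> z) = 1" "\<rho> \<in> borel_measurable borel" "integrable lborel \<rho>"
    "(\<integral>\<^sup>+z. ennreal (\<rho> z) \<partial>lborel) = 1"
proof -
  show t: "\<rho> \<in> test_functions UNIV" and "0 \<le> \<rho> z" "\<rho> (- z) = \<rho> z" "\<rho> z \<noteq> 0 \<Longrightarrow> norm z \<le> r"
    and i: "(LINT z|lborel. \<rho> z) = 1"
    using assms by (auto simp: mollifier_def)
  show "\<rho> \<in> borel_measurable borel" "integrable lborel \<rho>"
    using test_functions_measurable[OF t] test_integrable[OF t] by auto
  then show "(\<integral>\<^sup>+z. ennreal (\<rho> z) \<partial>lborel) = 1"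
    using i assms by (subst nn_integral_eq_integral) (auto simp: mollifier_def)
qed

lemma mollifier_exists:
  assumes r: "r > 0"
  shows "\<exists>\<rho> :: real ^ 'd \<Rightarrow> real. mollifier r \<rho>"
proof -
  \<comment> \<open>Half the side of a cube on which the absolute values of the coordinates, and so
    the norm, sum up to at most \<open>r\<close>.\<close>
  define s :: "real ^ 'd" where "s = (\<chi> i. r / CARD('d))"
  have s: "s $ i > 0" for i using r by (simp add: s_def)
  define \<beta> where "\<beta> = bump (- s) s"
  have t: "\<beta> \<in> test_functions UNIV" unfolding \<beta>_def by (rule bump_test) simp
  have nn: "0 \<le> \<beta> z" for z unfolding \<beta>_def by (rule bump_bounds)
  have box: "\<beta> z \<noteq> 0 \<longleftrightarrow> z \<in> box (- s) s" for z
    using bump_pos_iff[of "- s" s z] nn[of z] by (auto simp: \<beta>_def)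
  define c where "c = (LINT z|lborel. \<beta> z)"
  \<comment> \<open>A vanishing integral would make an open box around 0 a null set.\<close>
  have "c \<noteq> 0"
  proof
    assume "c = 0"
    then have "AE z in lborel. \<beta> z = 0"
      unfolding c_def using nn test_integrable[OF t] by (subst (asm) integral_nonneg_eq_0_iff_AE)
          auto
    then have "AE z in lborel. z \<notin> box (- s) s" using box by auto
    then have "box (- s) s \<in> null_sets lborel" by (subst AE_iff_null_sets) auto
    then have "negligible (box (- s) s)" by (simp add: negligible_iff_null_sets
        null_sets_completionI)
    moreover have "0 \<in> box (- s) s" using s by (auto simp: mem_box_cart)
    ultimately show False using open_not_negligible[OF open_box] by auto
  qed
  then have c: "c > 0" using nn Bochner_Integration.integral_nonneg[of lborel \<beta>] unfolding c_def by
      fastforce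
  have "mollifier r (\<lambda>z. \<beta> z * (1 / c))"
    unfolding mollifier_def
  proof (intro conjI allI impI)
    show "(\<lambda>z. \<beta> z * (1 / c)) \<in> test_functions UNIV" by (rule test_functions_mult[OF t Ck_const])
    fix z
    show "0 \<le> \<beta> z * (1 / c)" using nn c by simp
    show "\<beta> (- z) * (1 / c) = \<beta> z * (1 / c)" by (simp add: \<beta>_def bump_def mult.commute add.commute)
    assume "\<beta> z * (1 / c) \<noteq> 0"
    then have z: "z \<in> box (- s) s" using box by auto
    have "norm z \<le> (\<Sum>i\<in>UNIV. \<bar>z $ i\<bar>)" by (rule norm_le_l1_cart)
    also have "\<dots> \<le> (\<Sum>i\<in>(UNIV::'d set). r / CARD('d))"
    proof (rule sum_mono)
      fix i show "\<bar>z $ i\<bar> \<le> r / CARD('d)" using z[unfolded mem_box_cart, THEN spec, of i] by (simp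
          add: s_def abs_le_iff less_imp_le)
    qed
    also have "\<dots> = r" by simp
    finally show "norm z \<le> r" .
  next
    have "(LINT z|lborel. \<beta> z * (1 / c)) = c * (1 / c)" unfolding c_def by (rule
        integral_mult_left_zero)
    then show "(LINT z|lborel. \<beta> z * (1 / c)) = 1" using c by simp
  qed
  then show ?thesis by blast
qed

lemma conv_mollifier:
  assumes m: "mollifier r \<rho>" and f: "integrable lborel f"
  shows "conv \<rho> f x = (LINT h|lborel. \<rho> h * f (x + h))" and "integrable lborel (\<lambda>h. \<rho> h * f (x +
      h))"
proof -
  note [measurable] = mollifierD(6)[OF m]
  have [measurable]: "f \<in> borel_measurable borel" using f by auto
  have eq: "\<rho> (x - (h + x)) * f (h + x) = \<rho> h * f (x + h)" for h
    using mollifierD(3)[OF m, of h] by (simp add: add.commute)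
  show "conv \<rho> f x = (LINT h|lborel. \<rho> h * f (x + h))"
    unfolding conv_def using integral_translate[of "\<lambda>y. \<rho> (x - y) * f y" x] by (simp only: eq) simp
  show "integrable lborel (\<lambda>h. \<rho> h * f (x + h))"
    using integrable_translate[OF conv_integrable[OF mollifierD(1)[OF m] f, of x], of x] by (simp
        only: eq)
qed

text \<open>Tonelli's theorem, combined with the facts that \<open>\<rho>\<close> has mass 1 and
  vanishes outside the ball of radius \<open>r\<close>: a bound for every single shift
  \<open>h\<close> with \<open>norm h \<le> r\<close> passes to the average.\<close>

lemma mollifier_swap:
  fixes G :: "real ^ 'd \<Rightarrow> real ^ 'd \<Rightarrow> ennreal"
  assumes m: "mollifier r \<rho>" and [measurable]: "case_prod G \<in> borel_measurable (borel \<Otimes>\<^sub>M borel)"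
    and c: "\<And>h. norm h \<le> r \<Longrightarrow> (\<integral>\<^sup>+x. G x h \<partial>lborel) \<le> c"
  shows "(\<integral>\<^sup>+x. \<integral>\<^sup>+h. ennreal (\<rho> h) * G x h \<partial>lborel \<partial>lborel) \<le> c"
proof -
  note [measurable] = mollifierD(6)[OF m]
  have "(\<integral>\<^sup>+x. \<integral>\<^sup>+h. ennreal (\<rho> h) * G x h \<partial>lborel \<partial>lborel) = (\<integral>\<^sup>+h. \<integral>\<^sup>+x. ennreal (\<rho> h) * G x h
      \<partial>lborel \<partial>lborel)"
    by (rule lborel_pair.Fubini'[symmetric]) (simp add: case_prod_unfold, measurable)
  also have "\<dots> = (\<integral>\<^sup>+h. ennreal (\<rho> h) * (\<integral>\<^sup>+x. G x h \<partial>lborel) \<partial>lborel)"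
    by (intro nn_integral_cong nn_integral_cmult) measurable
  also have "\<dots> \<le> (\<integral>\<^sup>+h. ennreal (\<rho> h) * c \<partial>lborel)"
  proof (rule nn_integral_mono)
    fix h show "ennreal (\<rho> h) * (\<integral>\<^sup>+x. G x h \<partial>lborel) \<le> ennreal (\<rho> h) * c"
      using mollifierD(4)[OF m, of h] c[of h] by (cases "\<rho> h = 0") (auto intro: mult_left_mono)
  qed
  also have "\<dots> = c" using mollifierD(8)[OF m] by (simp add: nn_integral_multc)
  finally show ?thesis .
qed

text \<open>The set \<open>K\<close> is carried along because for functions on
  \<open>\<Omega>\<close> differences of translates are controlled only away from the
  boundary.\<close>

lemma mollifier_approx:
  assumes m: "mollifier r \<rho>" and f: "integrable lborel f" and [measurable]: "K \<in> sets borel"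
    and c: "\<And>h. norm h \<le> r \<Longrightarrow> (\<integral>\<^sup>+x. indicator K x * ennreal \<bar>f (x + h) - f x\<bar> \<partial>lborel) \<le> c"
  shows "(\<integral>\<^sup>+x. indicator K x * ennreal \<bar>conv \<rho> f x - f x\<bar> \<partial>lborel) \<le> c"
proof -
  note [measurable] = mollifierD(6)[OF m]
  have [measurable]: "f \<in> borel_measurable borel" using f by auto
  have "indicator K x * ennreal \<bar>conv \<rho> f x - f x\<bar> \<le>
      (\<integral>\<^sup>+h. ennreal (\<rho> h) * (indicator K x * ennreal \<bar>f (x + h) - f x\<bar>) \<partial>lborel)" for x
  proof -
    note i1 = conv_mollifier(2)[OF m f, of x]
    have i2: "integrable lborel (\<lambda>h. \<rho> h * f x)" using mollifierD(7)[OF m] by simp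
    have "conv \<rho> f x - f x = (LINT h|lborel. \<rho> h * f (x + h)) - (LINT h|lborel. \<rho> h * f x)"
      using conv_mollifier(1)[OF m f, of x] mollifierD(5)[OF m] by simp
    also have "\<dots> = (LINT h|lborel. \<rho> h * f (x + h) - \<rho> h * f x)"
      by (rule Bochner_Integration.integral_diff[OF i1 i2, symmetric])
    finally have e: "conv \<rho> f x - f x = (LINT h|lborel. \<rho> h * f (x + h) - \<rho> h * f x)" .
    have "ennreal \<bar>conv \<rho> f x - f x\<bar> \<le> (\<integral>\<^sup>+h. norm (\<rho> h * f (x + h) - \<rho> h * f x) \<partial>lborel)"
      unfolding e using integral_norm_bound_ennreal[OF Bochner_Integration.integrable_diff[OF i1
          i2]] by simp
    also have "\<dots> = (\<integral>\<^sup>+h. ennreal (\<rho> h) * ennreal \<bar>f (x + h) - f x\<bar> \<partial>lborel)"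
      using mollifierD(2)[OF m] by (intro nn_integral_cong) (simp add: right_diff_distrib[symmetric]
          abs_mult ennreal_mult)
    finally show ?thesis by (cases "x \<in> K") auto
  qed
  then have "(\<integral>\<^sup>+x. indicator K x * ennreal \<bar>conv \<rho> f x - f x\<bar> \<partial>lborel) \<le>
     (\<integral>\<^sup>+x. \<integral>\<^sup>+h. ennreal (\<rho> h) * (indicator K x * ennreal \<bar>f (x + h) - f x\<bar>) \<partial>lborel \<partial>lborel)"
    by (intro nn_integral_mono)
  also have "\<dots> \<le> c" by (rule mollifier_swap[OF m _ c]) (simp add: case_prod_unfold, measurable)
  finally show ?thesis .
qed

text \<open>A convex function lies above its tangent at \<open>b\<close>. Averaged over
  \<open>t\<close>, this becomes Jensen's inequality.\<close>

lemma powr_tangent: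
  fixes t b p :: real
  assumes "0 \<le> t" "0 < b" "1 \<le> p"
  shows "b powr p + p * b powr (p - 1) * (t - b) \<le> t powr p"
proof (cases "t = 0")
  \<comment> \<open>The tangent argument below runs on the open half line; here the left side is
    \<open>(1 - p) b^p\<close>, which is at most 0.\<close>
  case True
  have "b powr (p - 1) * b = b powr p" using assms by (simp add: powr_mult_base mult.commute)
  then have "b powr p + p * b powr (p - 1) * (t - b) = (1 - p) * b powr p" using True by (simp add:
      algebra_simps)
  then show ?thesis using True assms by (simp add: mult_nonpos_nonneg)
next
  case False
  have "p * b powr (p - 1) * (t - b) \<le> t powr p - b powr p"
  proof (rule convex_on_imp_above_tangent[OF powr_convex[OF assms(3)]])
    show "((\<lambda>x. x powr p) has_real_derivative p * b powr (p - 1)) (at b within {0<..})"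
      using assms by (auto intro!: derivative_eq_intros DERIV_subset[OF has_real_derivative_powr])
  qed (use False assms in \<open>auto simp: interior_open\<close>)
  then show ?thesis by linarith
qed

text \<open>Jensen's inequality for the probability weight \<open>\<rho>\<close>, obtained by
  integrating \<open>powr_tangent\<close> at \<open>b = \<bar>conv \<rho> f x\<bar>\<close>,
  followed by translation invariance. It bounds mollified gradients in the \<open>p\<close>-th power
  independently of the mollifier.\<close>

lemma mollifier_powr_le:
  assumes m: "mollifier r \<rho>" and f: "integrable lborel f"
    and p: "1 \<le> p" and fp: "integrable lborel (\<lambda>x. \<bar>f x\<bar> powr p)"
  shows "(\<integral>\<^sup>+x. ennreal (\<bar>conv \<rho> f x\<bar> powr p) \<partial>lborel) \<le> (\<integral>\<^sup>+x. ennreal (\<bar>f x\<bar> powr p) \<partial>lborel)"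
proof -
  note [measurable] = mollifierD(6)[OF m]
  have [measurable]: "f \<in> borel_measurable borel" using f by auto
  have "ennreal (\<bar>conv \<rho> f x\<bar> powr p) \<le> (\<integral>\<^sup>+h. ennreal (\<rho> h) * ennreal (\<bar>f (x + h)\<bar> powr p)
      \<partial>lborel)" for x
  proof (cases "conv \<rho> f x = 0")
    case False
    define b where "b = \<bar>conv \<rho> f x\<bar>"
    have b: "b > 0" using False by (simp add: b_def)
    define a where "a = p * b powr (p - 1)"
    have a: "a \<ge> 0" using p by (simp add: a_def)
    have i1: "integrable lborel (\<lambda>h. \<rho> h * \<bar>f (x + h)\<bar>)"
      using integrable_abs[OF conv_mollifier(2)[OF m f, of x]] mollifierD(2)[OF m] by (simp add:
          abs_mult)
    have i2: "integrable lborel (\<lambda>h. \<rho> h * \<bar>f (x + h)\<bar> powr p)"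
      by (rule conv_mollifier(2)[OF m fp])
    note i3 = mollifierD(7)[OF m]
    have "b = \<bar>LINT h|lborel. \<rho> h * f (x + h)\<bar>" by (simp add: b_def conv_mollifier(1)[OF m f])
    also have "\<dots> \<le> (LINT h|lborel. \<bar>\<rho> h * f (x + h)\<bar>)" by (rule integral_abs_bound)
    also have "\<dots> = (LINT h|lborel. \<rho> h * \<bar>f (x + h)\<bar>)" using mollifierD(2)[OF m] by (simp add:
        abs_mult)
    \<comment> \<open>The linear term of the tangent has a favourable sign, since \<open>b\<close>
      is at most the average of \<open>\<bar>f\<bar>\<close>.\<close>
    finally have ab: "0 \<le> a * ((LINT h|lborel. \<rho> h * \<bar>f (x + h)\<bar>) - b)" using a by simp
    have "b powr p \<le> (b powr p - a * b) * 1 + a * (LINT h|lborel. \<rho> h * \<bar>f (x + h)\<bar>)"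
      using ab by (simp add: algebra_simps)
    also have "\<dots> = (LINT h|lborel. (b powr p - a * b) * \<rho> h + a * (\<rho> h * \<bar>f (x + h)\<bar>))"
      unfolding mollifierD(5)[OF m, symmetric]
      by (simp only: integral_mult_right_zero[symmetric] Bochner_Integration.integral_add[OF
          integrable_mult_right[OF i3] integrable_mult_right[OF i1]])
    also have "\<dots> \<le> (LINT h|lborel. \<rho> h * \<bar>f (x + h)\<bar> powr p)"
    proof (rule integral_mono[OF Bochner_Integration.integrable_add[OF integrable_mult_right[OF i3]
        integrable_mult_right[OF i1]] i2])
      fix h
      have "\<rho> h * (b powr p + p * b powr (p - 1) * (\<bar>f (x + h)\<bar> - b)) \<le> \<rho> h * \<bar>f (x + h)\<bar> powr p"
        using p b mollifierD(2)[OF m] by (intro mult_left_mono powr_tangent) auto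
      then show "(b powr p - a * b) * \<rho> h + a * (\<rho> h * \<bar>f (x + h)\<bar>) \<le> \<rho> h * \<bar>f (x + h)\<bar> powr p"
        by (simp add: a_def algebra_simps)
    qed
    finally have "ennreal (b powr p) \<le> ennreal (LINT h|lborel. \<rho> h * \<bar>f (x + h)\<bar> powr p)" by (rule
        ennreal_leI)
    also have "\<dots> = (\<integral>\<^sup>+h. ennreal (\<rho> h) * ennreal (\<bar>f (x + h)\<bar> powr p) \<partial>lborel)"
      using mollifierD(2)[OF m] by (subst nn_integral_eq_integral[OF i2, symmetric]) (auto simp:
          ennreal_mult)
    finally show ?thesis by (simp add: b_def)
  qed simp
  then have "(\<integral>\<^sup>+x. ennreal (\<bar>conv \<rho> f x\<bar> powr p) \<partial>lborel) \<le>
     (\<integral>\<^sup>+x. \<integral>\<^sup>+h. ennreal (\<rho> h) * ennreal (\<bar>f (x + h)\<bar> powr p) \<partial>lborel \<partial>lborel)"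
    by (intro nn_integral_mono)
  also have "\<dots> \<le> (\<integral>\<^sup>+x. ennreal (\<bar>f x\<bar> powr p) \<partial>lborel)"
  proof (rule mollifier_swap[OF m])
    fix h
    show "(\<integral>\<^sup>+x. ennreal (\<bar>f (x + h)\<bar> powr p) \<partial>lborel) \<le> (\<integral>\<^sup>+x. ennreal (\<bar>f x\<bar> powr p) \<partial>lborel)"
      by (subst nn_integral_translate[of "\<lambda>x. ennreal (\<bar>f x\<bar> powr p)"]) auto
  qed (simp add: case_prod_unfold, measurable)
  finally show ?thesis .
qed

lemma mollifier_L1_le:
  assumes m: "mollifier r \<rho>" and f: "integrable lborel f"
  shows "(\<integral>\<^sup>+x. ennreal \<bar>conv \<rho> f x\<bar> \<partial>lborel) \<le> (\<integral>\<^sup>+x. ennreal \<bar>f x\<bar> \<partial>lborel)"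
  using mollifier_powr_le[OF m f, of 1] f by simp

lemma conv_mollifier_integrable:
  assumes m: "mollifier r \<rho>" and f: "integrable lborel f"
  shows "integrable lborel (conv \<rho> f)"
proof (rule integrableI_bounded)
  show "conv \<rho> f \<in> borel_measurable lborel" using conv_measurable[OF mollifierD(1)[OF m] f] by simp
  have "(\<integral>\<^sup>+x. ennreal \<bar>f x\<bar> \<partial>lborel) < \<infinity>" using f by (auto simp: integrable_iff_bounded)
  then show "(\<integral>\<^sup>+x. ennreal (norm (conv \<rho> f x)) \<partial>lborel) < \<infinity>"
    using mollifier_L1_le[OF m f] by (simp add: order.strict_trans1)
qed

lemma translation_small_L1:
  fixes f :: "'a::euclidean_space \<Rightarrow> real"
  assumes f: "integrable lborel f" and e: "e > 0"
  shows "\<exists>d>0. \<forall>h. norm h \<le> d \<longrightarrow> (LINT x|lborel. \<bar>f (x + h) - f x\<bar>) < e"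
proof (rule ccontr)
  assume "\<not> ?thesis"
  then have "\<forall>n. \<exists>h. norm h \<le> inverse (real (Suc n)) \<and> e \<le> (LINT x|lborel. \<bar>f (x + h) - f x\<bar>)"
    by (metis inverse_positive_iff_positive linorder_not_less of_nat_0_less_iff zero_less_Suc)
  then obtain h where h: "\<And>n. norm (h n) \<le> inverse (real (Suc n))"
    "\<And>n. e \<le> (LINT x|lborel. \<bar>f (x + h n) - f x\<bar>)" by metis
  have "h \<longlonglongrightarrow> 0"
    using h(1) by (intro Lim_null_comparison[OF _ LIMSEQ_inverse_real_of_nat] always_eventually)
        auto
  have "e \<le> 0"
    by (rule LIMSEQ_le_const[OF translation_continuous_L1[OF f \<open>h \<longlonglongrightarrow> 0\<close>]]) (use h(2) in auto)
  then show False using e by simp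
qed

lemma mollifier_tendsto_L1:
  fixes f :: "real ^ 'd \<Rightarrow> real"
  assumes m: "\<And>n. mollifier (r n) (\<rho> n)" and r: "r \<longlonglongrightarrow> 0" and f: "integrable lborel f"
  shows "(\<lambda>n. LINT x|lborel. \<bar>conv (\<rho> n) f x - f x\<bar>) \<longlonglongrightarrow> 0"
proof (rule LIMSEQ_I)
  fix e :: real assume e: "0 < e"
  obtain d where d: "d > 0" "\<And>h. norm h \<le> d \<Longrightarrow> (LINT x|lborel. \<bar>f (x + h) - f x\<bar>) < e/2"
    using translation_small_L1[OF f, of "e/2"] e by auto
  obtain N where N: "\<And>n. n \<ge> N \<Longrightarrow> r n < d"
    using order_tendstoD(2)[OF r d(1)] by (auto simp: eventually_sequentially)
  have "norm ((LINT x|lborel. \<bar>conv (\<rho> n) f x - f x\<bar>) - 0) < e" if n: "n \<ge> N" for n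
  proof -
    have ic: "integrable lborel (\<lambda>x. \<bar>conv (\<rho> n) f x - f x\<bar>)"
      using conv_mollifier_integrable[OF m f] f by auto
    have "(\<integral>\<^sup>+x. indicator UNIV x * ennreal \<bar>conv (\<rho> n) f x - f x\<bar> \<partial>lborel) \<le> ennreal (e/2)"
    proof (rule mollifier_approx[OF m f])
      fix h :: "real ^ 'd" assume h: "norm h \<le> r n"
      have "integrable lborel (\<lambda>x. \<bar>f (x + h) - f x\<bar>)" using integrable_translate[OF f] f by auto
      then have "(\<integral>\<^sup>+x. ennreal \<bar>f (x + h) - f x\<bar> \<partial>lborel) = ennreal (LINT x|lborel. \<bar>f (x + h) - f
          x\<bar>)"
        by (rule nn_integral_eq_integral) auto
      also have "\<dots> \<le> ennreal (e/2)" using d(2)[of h] h N[OF n] by (intro ennreal_leI) auto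
      finally show "(\<integral>\<^sup>+x. indicator UNIV x * ennreal \<bar>f (x + h) - f x\<bar> \<partial>lborel) \<le> ennreal (e/2)" by
          simp
    qed simp
    then have "ennreal (LINT x|lborel. \<bar>conv (\<rho> n) f x - f x\<bar>) \<le> ennreal (e/2)"
      by (subst nn_integral_eq_integral[OF ic, symmetric]) auto
    then have "(LINT x|lborel. \<bar>conv (\<rho> n) f x - f x\<bar>) \<le> e/2" using e by simp
    then show ?thesis using e by (simp add: integral_nonneg_AE)
  qed
  then show "\<exists>N. \<forall>n\<ge>N. norm ((LINT x|lborel. \<bar>conv (\<rho> n) f x - f x\<bar>) - 0) < e" by blast
qed

section \<open>Countable box covers and uniqueness of weak derivatives\<close>

lemma open_countable_box_cover:
  fixes \<Omega> :: "(real ^ 'd) set"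
  assumes "open \<Omega>"
  shows "\<exists>a b :: nat \<Rightarrow> real ^ 'd. (\<forall>n. cbox (a n) (b n) \<subseteq> \<Omega>) \<and> \<Omega> = (\<Union>n. box (a n) (b n))"
proof -
  define F where "F = {box a b | a b :: real ^ 'd. cbox a b \<subseteq> \<Omega>}"
  have un: "\<Union>F = \<Omega>"
  proof (intro subset_antisym subsetI)
    fix x assume "x \<in> \<Union>F"
    then obtain a b where "x \<in> box a b" "cbox a b \<subseteq> \<Omega>" by (auto simp: F_def)
    then show "x \<in> \<Omega>" using box_subset_cbox[of a b] by auto
  next
    fix x assume "x \<in> \<Omega>"
    then obtain a b where "cbox a b \<subseteq> \<Omega>" "x \<in> box a b" by (rule open_contains_cbox[OF assms])
    then show "x \<in> \<Union>F" by (auto simp: F_def)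
  qed
  obtain F' where F': "F' \<subseteq> F" "countable F'" "\<Union>F' = \<Union>F"
    using Lindelof[of F] by (auto simp: F_def)
  \<comment> \<open>\<open>box 1 0\<close> is empty. Adding it makes the family nonempty, so that it
    can be enumerated even for empty \<open>\<Omega>\<close>.\<close>
  have emp: "{} \<in> F"
    unfolding F_def
    by (rule CollectI, rule exI[of _ 1], rule exI[of _ "0 :: real^'d"])
      (auto simp: mem_box_cart set_eq_iff intro: order_trans dest!: spec)
  define X where "X = from_nat_into (insert {} F')"
  have rX: "range X = insert {} F'" unfolding X_def using F'(2) by (intro range_from_nat_into) auto
  have "X n \<in> F" for n using F'(1) emp rX rangeI[of X n] by auto
  then have "\<forall>n. \<exists>a b. X n = box a b \<and> cbox a b \<subseteq> \<Omega>" by (auto simp: F_def)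
  then obtain a b where ab: "\<And>n. X n = box (a n) (b n)" "\<And>n. cbox (a n) (b n) \<subseteq> \<Omega>" by metis
  have "(\<Union>n. box (a n) (b n)) = \<Union>(range X)" by (simp add: ab(1))
  also have "\<dots> = \<Omega>" unfolding rX using F'(3) un by simp
  finally show ?thesis using ab(2) by blast
qed

text \<open>The fundamental lemma of the calculus of variations. At a point of an open box the
  mollifications vanish once the radius is small, and along a subsequence they converge to
  \<open>G\<close> almost everywhere in the box.\<close>

lemma weak_derivative_unique:
  fixes G :: "real ^ 'd \<Rightarrow> real"
  assumes \<Omega>: "open \<Omega>"
    and int: "\<And>K. compact K \<Longrightarrow> K \<subseteq> \<Omega> \<Longrightarrow> integrable lborel (\<lambda>x. indicator K x * G x)"
    and zero: "\<And>\<phi>. \<phi> \<in> test_functions \<Omega> \<Longrightarrow> (LINT x|lborel. G x * \<phi> x) = 0"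
  shows "AE x in lborel. x \<in> \<Omega> \<longrightarrow> G x = 0"
proof -
  obtain a b :: "nat \<Rightarrow> real ^ 'd" where ab: "\<And>n. cbox (a n) (b n) \<subseteq> \<Omega>" "\<Omega> = (\<Union>n. box (a n) (b n))"
    using open_countable_box_cover[OF \<Omega>] by metis
  define s where "s n = inverse (real (Suc n))" for n
  have s: "s n > 0" for n by (simp add: s_def)
  have s0: "s \<longlonglongrightarrow> 0" unfolding s_def by (rule LIMSEQ_inverse_real_of_nat)
  have "\<forall>n. \<exists>\<rho> :: real^'d \<Rightarrow> real. mollifier (s n) \<rho>" using mollifier_exists[OF s] by blast
  then obtain \<rho> :: "nat \<Rightarrow> real^'d \<Rightarrow> real" where \<rho>: "\<And>n. mollifier (s n) (\<rho> n)" by metis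
  have "AE x in lborel. x \<in> box (a k) (b k) \<longrightarrow> G x = 0" for k
  proof -
    define f where "f x = indicator (cbox (a k) (b k)) x * G x" for x
    have f: "integrable lborel f" unfolding f_def by (rule int[OF compact_cbox ab(1)])
    \<comment> \<open>The kernel centred at \<open>x\<close> lives inside the box, so it does not
      see the cutoff in \<open>f\<close> and is a test function for \<open>G\<close>.\<close>
    have cz: "conv (\<rho> n) f x = 0" if x: "cball x (s n) \<subseteq> cbox (a k) (b k)" for n x
    proof -
      have "(\<lambda>y. \<rho> n (x - y)) \<in> test_functions \<Omega>"
        by (rule test_reflect[OF mollifierD(1)[OF \<rho>] mollifierD(4)[OF \<rho>]]) (use x ab(1)[of k] in
            auto)
      then have "(LINT y|lborel. G y * \<rho> n (x - y)) = 0" by (rule zero)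
      moreover have "\<rho> n (x - y) * f y = G y * \<rho> n (x - y)" for y
      proof (cases "\<rho> n (x - y) = 0")
        case False
        then have "y \<in> cball x (s n)" using mollifierD(4)[OF \<rho>, of n "x - y"] by (simp add:
            dist_norm)
        then show ?thesis using x by (auto simp: f_def)
      qed simp
      ultimately show ?thesis by (simp only: conv_def)
    qed
    have "\<exists>r. strict_mono r \<and> (AE x in lborel. (\<lambda>n. conv (\<rho> (r n)) f x) \<longlonglongrightarrow> f x)"
    proof -
      have "integrable lborel (\<lambda>x. conv (\<rho> n) f x - f x)" for n
        using conv_mollifier_integrable[OF \<rho> f] f by auto
      from tendsto_L1_AE_subseq[OF this] show ?thesis
        using mollifier_tendsto_L1[OF \<rho> s0 f] by (simp add: Lim_null[symmetric])
    qed
    then obtain r where r: "strict_mono r" "AE x in lborel. (\<lambda>n. conv (\<rho> (r n)) f x) \<longlonglongrightarrow> f x" by blast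
    show ?thesis using r(2)
    proof (eventually_elim, intro impI)
      fix x assume lim: "(\<lambda>n. conv (\<rho> (r n)) f x) \<longlonglongrightarrow> f x" and x: "x \<in> box (a k) (b k)"
      obtain e where e: "e > 0" "cball x e \<subseteq> box (a k) (b k)"
        using open_contains_cball[THEN iffD1, OF open_box] x by blast
      have "\<forall>\<^sub>F n in sequentially. s (r n) < e"
        using order_tendstoD(2)[OF LIMSEQ_subseq_LIMSEQ[OF s0 r(1)] e(1)] by (simp add: o_def)
      then have "\<forall>\<^sub>F n in sequentially. conv (\<rho> (r n)) f x = 0"
      proof eventually_elim
        case (elim n)
        have "cball x (s (r n)) \<subseteq> cball x e" using elim by (intro subset_cball) simp
        then show ?case using e(2) box_subset_cbox[of "a k" "b k"] by (intro cz) blast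
      qed
      then have "(\<lambda>n. conv (\<rho> (r n)) f x) \<longlonglongrightarrow> 0" by (rule tendsto_eventually)
      then have "f x = 0" using lim LIMSEQ_unique by blast
      then show "G x = 0" using x box_subset_cbox[of "a k" "b k"] by (auto simp: f_def indicator_def
          split: if_splits)
    qed
  qed
  then have "AE x in lborel. \<forall>k. x \<in> box (a k) (b k) \<longrightarrow> G x = 0" by (subst AE_all_countable) blast
  then show ?thesis by eventually_elim (use ab(2) in auto)
qed

section \<open>Rellich compactness\<close>

lemma has_vector_derivative_on_line:
  fixes f :: "real ^ 'd \<Rightarrow> real"
  assumes "\<And>x. f differentiable at x"
  shows "((\<lambda>t. f (x + t *\<^sub>R h)) has_vector_derivative (\<Sum>i\<in>UNIV. h $ i * pd i f (x + t *\<^sub>R h))) (at t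
      within S)"
proof -
  have "((\<lambda>t. f (x + t *\<^sub>R h)) has_derivative (\<lambda>s. frechet_derivative f (at (x + t *\<^sub>R h)) (s *\<^sub>R
      h))) (at t within S)"
    by (rule has_derivative_compose[OF _ frechet_derivative_works[THEN iffD1, OF assms], of "\<lambda>t. x +
        t *\<^sub>R h" "\<lambda>s. s *\<^sub>R h"])
      (auto intro!: derivative_eq_intros)
  then show ?thesis
    unfolding has_vector_derivative_def frechet_derivative_sum_pd[OF assms]
    by (simp add: sum_distrib_left mult.assoc)
qed

text \<open>For \<open>x\<close> in \<open>K\<close> the segment to \<open>x + h\<close>, enlarged
  by the kernel radius \<open>s\<close>, stays in \<open>\<Omega>\<close>, so along it the gradient
  of the mollified function is the mollified \<open>g\<close>. It remains to use the fundamental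
  theorem of calculus, Tonelli's theorem and the \<open>L^1\<close> bound for mollification.\<close>

lemma translation_estimate_mollified:
  fixes u :: "real ^ 'd \<Rightarrow> real"
  assumes m: "mollifier s \<rho>" and K[measurable]: "K \<in> sets borel"
    and r: "\<And>x. x \<in> K \<Longrightarrow> cball x r \<subseteq> \<Omega>" and h: "norm h + s \<le> r"
    and u: "integrable lborel u" and g: "\<And>i. integrable lborel (g i)" and w: "weak_grad \<Omega> u g"
  shows "(\<integral>\<^sup>+x. indicator K x * ennreal \<bar>conv \<rho> u (x + h) - conv \<rho> u x\<bar> \<partial>lborel)
    \<le> ennreal (norm h) * (\<Sum>i\<in>UNIV. \<integral>\<^sup>+x. ennreal \<bar>g i x\<bar> \<partial>lborel)"
proof -
  let ?G = "\<lambda>i. conv \<rho> (g i)"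
  have cG: "continuous_on UNIV (?G i)" for i
    by (rule Ck_continuous[where k=0, OF conv_Ck[OF mollifierD(1)[OF m] g]])
  have [measurable]: "?G i \<in> borel_measurable borel" for i by (intro borel_measurable_continuous_onI
      cG)
  have diff: "conv \<rho> u differentiable at x" for x
    using conv_has_derivative[OF mollifierD(1)[OF m] u] by (auto simp: differentiable_def)
  define W where "W x t = (\<Sum>i\<in>UNIV. ennreal (norm h) * ennreal \<bar>?G i (x + t *\<^sub>R h)\<bar>)" for x and t ::
      real
  have pt: "indicator K x * ennreal \<bar>conv \<rho> u (x + h) - conv \<rho> u x\<bar> \<le> (\<integral>\<^sup>+t. indicator {0..1} t * W
      x t \<partial>lborel)" for x
  proof (cases "x \<in> K")
    case True
    define D where "D t = (\<Sum>i\<in>UNIV. h $ i * ?G i (x + t *\<^sub>R h))" for t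
    have pdG: "pd i (conv \<rho> u) (x + t *\<^sub>R h) = ?G i (x + t *\<^sub>R h)" if t: "0 \<le> t" "t \<le> 1" for i t
    proof (rule pd_conv_weak[OF mollifierD(1)[OF m] mollifierD(4)[OF m] _ u w])
      have "norm (t *\<^sub>R h) \<le> norm h" using t by (simp add: mult_left_le_one_le)
      then have "cball (x + t *\<^sub>R h) s \<subseteq> cball x r" using h by (simp add: cball_subset_cball_iff
          dist_norm)
      then show "cball (x + t *\<^sub>R h) s \<subseteq> \<Omega>" using r[OF True] by blast
    qed
    have cD: "continuous_on {0..1} D" unfolding D_def
      by (intro continuous_intros continuous_on_compose2[OF cG]) auto
    have ftc: "(LINT t|lborel. indicator {0..1} t *\<^sub>R D t) = conv \<rho> u (x + 1 *\<^sub>R h) - conv \<rho> u (x +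
        0 *\<^sub>R h)"
    proof (rule integral_FTC_atLeastAtMost[OF _ _ cD])
      fix t :: real assume t: "0 \<le> t" "t \<le> 1"
      show "((\<lambda>t. conv \<rho> u (x + t *\<^sub>R h)) has_vector_derivative D t) (at t within {0..1})"
        using has_vector_derivative_on_line[OF diff, of x h t "{0..1}"] pdG[OF t] by (simp add:
            D_def)
    qed simp
    have iD: "integrable lborel (\<lambda>t. indicator {0..1} t *\<^sub>R D t)"
      using borel_integrable_compact[OF compact_Icc cD] by simp
    have "ennreal \<bar>conv \<rho> u (x + h) - conv \<rho> u x\<bar> \<le> (\<integral>\<^sup>+t. norm (indicator {0..1} t *\<^sub>R D t)
        \<partial>lborel)"
      using integral_norm_bound_ennreal[OF iD] unfolding ftc by simp
    also have "\<dots> \<le> (\<integral>\<^sup>+t. indicator {0..1} t * W x t \<partial>lborel)"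
    proof (rule nn_integral_mono)
      fix t
      have "\<bar>D t\<bar> \<le> (\<Sum>i\<in>UNIV. norm h * \<bar>?G i (x + t *\<^sub>R h)\<bar>)"
        unfolding D_def by (intro order_trans[OF sum_abs] sum_mono) (auto simp: abs_mult intro!:
            mult_right_mono component_le_norm_cart)
      then have "ennreal \<bar>D t\<bar> \<le> W x t" unfolding W_def
        by (simp add: ennreal_mult[symmetric] sum_ennreal ennreal_leI)
      then show "ennreal (norm (indicator {0..1} t *\<^sub>R D t)) \<le> indicator {0..1} t * W x t"
        by (auto simp: indicator_def)
    qed
    finally show ?thesis using True by simp
  qed simp
  have "(\<integral>\<^sup>+x. indicator K x * ennreal \<bar>conv \<rho> u (x + h) - conv \<rho> u x\<bar> \<partial>lborel)
    \<le> (\<integral>\<^sup>+x. \<integral>\<^sup>+t. indicator {0..1} t * W x t \<partial>lborel \<partial>lborel)"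
    by (intro nn_integral_mono pt)
  also have "\<dots> = (\<integral>\<^sup>+t. \<integral>\<^sup>+x. indicator {0..1} t * W x t \<partial>lborel \<partial>lborel)"
    by (rule lborel_pair.Fubini'[symmetric]) (simp add: W_def case_prod_unfold, measurable)
  also have "\<dots> \<le> (\<integral>\<^sup>+t. indicator {0..1::real} t * (ennreal (norm h) * (\<Sum>i\<in>UNIV. \<integral>\<^sup>+x. ennreal \<bar>g i
      x\<bar> \<partial>lborel)) \<partial>lborel)"
  proof (rule nn_integral_mono)
    fix t :: real
    have "(\<integral>\<^sup>+x. W x t \<partial>lborel) = (\<Sum>i\<in>UNIV. ennreal (norm h) * (\<integral>\<^sup>+x. ennreal \<bar>?G i (x + t *\<^sub>R h)\<bar>
        \<partial>lborel))"
      unfolding W_def by (simp add: nn_integral_sum nn_integral_cmult)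
    also have "\<dots> \<le> (\<Sum>i\<in>UNIV. ennreal (norm h) * (\<integral>\<^sup>+x. ennreal \<bar>g i x\<bar> \<partial>lborel))"
    proof (intro sum_mono mult_left_mono)
      fix i
      show "(\<integral>\<^sup>+x. ennreal \<bar>?G i (x + t *\<^sub>R h)\<bar> \<partial>lborel) \<le> (\<integral>\<^sup>+x. ennreal \<bar>g i x\<bar> \<partial>lborel)"
        using mollifier_L1_le[OF m g[of i]] by (subst nn_integral_translate[of "\<lambda>x. ennreal \<bar>?G i
            x\<bar>"]) auto
    qed simp
    finally have "(\<integral>\<^sup>+x. W x t \<partial>lborel) \<le> ennreal (norm h) * (\<Sum>i\<in>UNIV. \<integral>\<^sup>+x. ennreal \<bar>g i x\<bar>
        \<partial>lborel)"
      by (simp add: sum_distrib_left)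
    moreover have "(\<integral>\<^sup>+x. indicator {0..1} t * W x t \<partial>lborel) = indicator {0..1} t * (\<integral>\<^sup>+x. W x t
        \<partial>lborel)"
      unfolding W_def by (rule nn_integral_cmult) measurable
    ultimately show "(\<integral>\<^sup>+x. indicator {0..1} t * W x t \<partial>lborel) \<le> indicator {0..1} t * (ennreal
        (norm h) * (\<Sum>i\<in>UNIV. \<integral>\<^sup>+x. ennreal \<bar>g i x\<bar> \<partial>lborel))"
      by (auto intro: mult_left_mono)
  qed
  also have "\<dots> = ennreal (norm h) * (\<Sum>i\<in>UNIV. \<integral>\<^sup>+x. ennreal \<bar>g i x\<bar> \<partial>lborel)"
    by (subst nn_integral_multc) auto
  finally show ?thesis .
qed

lemma translation_estimate:
  fixes u :: "real ^ 'd \<Rightarrow> real"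
  assumes K[measurable]: "K \<in> sets borel"
    and r: "\<And>x. x \<in> K \<Longrightarrow> cball x r \<subseteq> \<Omega>" and h: "norm h < r"
    and u: "integrable lborel u" and g: "\<And>i. integrable lborel (g i)" and w: "weak_grad \<Omega> u g"
  shows "(\<integral>\<^sup>+x. indicator K x * ennreal \<bar>u (x + h) - u x\<bar> \<partial>lborel)
    \<le> ennreal (norm h) * (\<Sum>i\<in>UNIV. \<integral>\<^sup>+x. ennreal \<bar>g i x\<bar> \<partial>lborel)" (is "?L \<le> ?B")
proof -
  have [measurable]: "u \<in> borel_measurable borel" using u by auto
  \<comment> \<open>Radii that tend to 0 and fit into the gap \<open>r - norm h\<close> left by the
    shift.\<close>
  define s where "s n = (r - norm h) * inverse (real (Suc n))" for n
  have s: "s n > 0" "norm h + s n \<le> r" for n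
  proof -
    show "s n > 0" using h by (simp add: s_def)
    have "(r - norm h) * inverse (real (Suc n)) \<le> (r - norm h) * 1"
      using h by (intro mult_left_mono) (auto simp: field_simps)
    then show "norm h + s n \<le> r" by (simp add: s_def)
  qed
  have s0: "s \<longlonglongrightarrow> 0" unfolding s_def by (rule tendsto_mult_right_zero[OF LIMSEQ_inverse_real_of_nat])
  have "\<forall>n. \<exists>\<rho> :: real^'d \<Rightarrow> real. mollifier (s n) \<rho>" using mollifier_exists[OF s(1)] by blast
  then obtain \<rho> :: "nat \<Rightarrow> real^'d \<Rightarrow> real" where \<rho>: "\<And>n. mollifier (s n) (\<rho> n)" by metis
  define E where "E n = (LINT x|lborel. \<bar>conv (\<rho> n) u x - u x\<bar>)" for n
  have E0: "E \<longlonglongrightarrow> 0" unfolding E_def by (rule mollifier_tendsto_L1[OF \<rho> s0 u])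
  \<comment> \<open>The mollification error enters at \<open>x + h\<close> and at \<open>x\<close>;
    over the whole space both have the same integral, hence the factor 2.\<close>
  have le: "?L \<le> ?B + ennreal (2 * E n)" for n
  proof -
    let ?c = "conv (\<rho> n) u"
    have [measurable]: "?c \<in> borel_measurable borel" by (rule conv_measurable[OF mollifierD(1)[OF \<rho>]
        u])
    have nE: "(\<integral>\<^sup>+x. ennreal \<bar>?c x - u x\<bar> \<partial>lborel) = ennreal (E n)"
      unfolding E_def using conv_mollifier_integrable[OF \<rho> u] u by (intro nn_integral_eq_integral)
          auto
    have E_nn: "0 \<le> E n" unfolding E_def by (simp add: integral_nonneg_AE)
    have "?L \<le> (\<integral>\<^sup>+x. indicator K x * ennreal \<bar>?c (x + h) - ?c x\<bar> + (ennreal \<bar>?c (x + h) - u (x +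
        h)\<bar> + ennreal \<bar>?c x - u x\<bar>) \<partial>lborel)"
    proof (rule nn_integral_mono)
      fix x
      have "\<bar>u (x + h) - u x\<bar> \<le> \<bar>?c (x + h) - ?c x\<bar> + (\<bar>?c (x + h) - u (x + h)\<bar> + \<bar>?c x - u x\<bar>)" by
          linarith
      then have "ennreal \<bar>u (x + h) - u x\<bar> \<le> ennreal \<bar>?c (x + h) - ?c x\<bar> + (ennreal \<bar>?c (x + h) - u
          (x + h)\<bar> + ennreal \<bar>?c x - u x\<bar>)"
        by (simp add: ennreal_plus[symmetric] ennreal_leI del: ennreal_plus)
      then show "indicator K x * ennreal \<bar>u (x + h) - u x\<bar> \<le>
         indicator K x * ennreal \<bar>?c (x + h) - ?c x\<bar> + (ennreal \<bar>?c (x + h) - u (x + h)\<bar> + ennreal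
             \<bar>?c x - u x\<bar>)"
        by (auto simp: indicator_def)
    qed
    also have "\<dots> = (\<integral>\<^sup>+x. indicator K x * ennreal \<bar>?c (x + h) - ?c x\<bar> \<partial>lborel) +
        ((\<integral>\<^sup>+x. ennreal \<bar>?c (x + h) - u (x + h)\<bar> \<partial>lborel) + (\<integral>\<^sup>+x. ennreal \<bar>?c x - u x\<bar> \<partial>lborel))"
      by (simp add: nn_integral_add)
    also have "(\<integral>\<^sup>+x. ennreal \<bar>?c (x + h) - u (x + h)\<bar> \<partial>lborel) = (\<integral>\<^sup>+x. ennreal \<bar>?c x - u x\<bar>
        \<partial>lborel)"
      by (rule nn_integral_translate[of "\<lambda>x. ennreal \<bar>?c x - u x\<bar>"]) measurable
    also have "(\<integral>\<^sup>+x. indicator K x * ennreal \<bar>?c (x + h) - ?c x\<bar> \<partial>lborel) \<le> ?B"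
      by (rule translation_estimate_mollified[OF \<rho> K r s(2) u g w])
    also have "(\<integral>\<^sup>+x. ennreal \<bar>?c x - u x\<bar> \<partial>lborel) + (\<integral>\<^sup>+x. ennreal \<bar>?c x - u x\<bar> \<partial>lborel) = ennreal
        (2 * E n)"
      unfolding nE using E_nn by (simp add: ennreal_plus[symmetric] del: ennreal_plus)
    finally show ?thesis by (simp add: add_right_mono)
  qed
  have "(\<lambda>n. ?B + ennreal (2 * E n)) \<longlonglongrightarrow> ?B + ennreal (2 * 0)"
    by (intro tendsto_add tendsto_const tendsto_ennrealI tendsto_mult E0)
  then have "?L \<le> ?B + ennreal (2 * 0)"
    by (rule LIMSEQ_le_const) (use le in auto)
  then show ?thesis by simp
qed

text \<open>The Kolmogorov-Riesz scheme. At a fixed scale \<open>m\<close> the mollified functions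
  are bounded and Lipschitz with constants independent of \<open>j\<close>, so one subsequence
  converges at all points for every \<open>m\<close>; the translation estimate makes the
  mollification error on \<open>K\<close> small uniformly in \<open>j\<close>. The subsequence is
  fixed before \<open>K\<close>, \<open>s\<close> and \<open>e\<close>, so one choice serves a whole
  exhaustion of \<open>\<Omega>\<close>.\<close>

lemma rellich:
  fixes u :: "nat \<Rightarrow> real ^ 'd \<Rightarrow> real"
  assumes u: "\<And>j. integrable lborel (u j)" and g: "\<And>j i. integrable lborel (g j i)"
    and w: "\<And>j. weak_grad \<Omega> (u j) (g j)"
    and C: "\<And>j. (LINT x|lborel. \<bar>u j x\<bar>) \<le> C" "\<And>j i. (LINT x|lborel. \<bar>g j i x\<bar>) \<le> C"
  obtains r :: "nat \<Rightarrow> nat" where "strict_mono r"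
    "\<And>K s e. K \<in> sets borel \<Longrightarrow> emeasure lborel K < \<infinity> \<Longrightarrow> s > 0 \<Longrightarrow> (\<And>x. x \<in> K \<Longrightarrow> cball x s \<subseteq> \<Omega>) \<Longrightarrow> e > 0 \<Longrightarrow>
       \<forall>\<^sub>F (j, k) in sequentially \<times>\<^sub>F sequentially.
         (LINT x|lborel. indicator K x * \<bar>u (r j) x - u (r k) x\<bar>) < e"
proof -
  have quarter: "P * (e / (4 * P)) = e / 4" if "P > 0" for P e :: real using that by simp
  define \<epsilon> where "\<epsilon> n = inverse (real (Suc n))" for n
  have \<epsilon>: "\<epsilon> n > 0" for n by (simp add: \<epsilon>_def)
  have \<epsilon>0: "\<epsilon> \<longlonglongrightarrow> 0" unfolding \<epsilon>_def by (rule LIMSEQ_inverse_real_of_nat)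
  have "\<forall>n. \<exists>\<rho> :: real^'d \<Rightarrow> real. mollifier (\<epsilon> n) \<rho>" using mollifier_exists[OF \<epsilon>] by blast
  then obtain \<rho> :: "nat \<Rightarrow> real^'d \<Rightarrow> real" where \<rho>: "\<And>n. mollifier (\<epsilon> n) (\<rho> n)" by metis
  note t = mollifierD(1)[OF \<rho>]
  have "\<forall>m. \<exists>B>0. \<forall>x. \<bar>\<rho> m x\<bar> \<le> B" using test_functions_bounded[OF t] by metis
  then obtain B where B: "\<And>m. B m > 0" "\<And>m x. \<bar>\<rho> m x\<bar> \<le> B m" by metis
  have "\<forall>m. \<exists>L>0. \<forall>x y. \<bar>\<rho> m x - \<rho> m y\<bar> \<le> L * norm (x - y)" using test_functions_lipschitz[OF t] by
      metis
  then obtain L where L: "\<And>m. L m > 0" "\<And>m x y. \<bar>\<rho> m x - \<rho> m y\<bar> \<le> L m * norm (x - y)" by metis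
  have C0: "C \<ge> 0" by (rule order_trans[OF _ C(1)[of 0]]) (simp add: integral_nonneg_AE)
  define A where "A m j x = conv (\<rho> m) (u j) x" for m j x
  have bndA: "\<bar>A m j x\<bar> \<le> B m * C" for m j x
  proof -
    have "\<bar>A m j x\<bar> \<le> (LINT y|lborel. \<bar>\<rho> m (x - y) * u j y\<bar>)" unfolding A_def conv_def by (rule
        integral_abs_bound)
    also have "\<dots> \<le> (LINT y|lborel. B m * \<bar>u j y\<bar>)"
      by (intro integral_mono integrable_abs conv_integrable[OF t u] integrable_mult_right u)
        (auto simp: abs_mult intro!: mult_right_mono B)
    also have "\<dots> \<le> B m * C" using C(1)[of j] B(1)[of m] by (simp add: mult_left_mono)
    finally show ?thesis .
  qed
  have lipA: "\<bar>A m j x - A m j y\<bar> \<le> L m * C * norm (x - y)" for m j x y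
  proof -
    have "A m j x - A m j y = (LINT z|lborel. \<rho> m (x - z) * u j z - \<rho> m (y - z) * u j z)"
      unfolding A_def conv_def by (rule Bochner_Integration.integral_diff[OF conv_integrable[OF t u]
          conv_integrable[OF t u], symmetric])
    then have "\<bar>A m j x - A m j y\<bar> \<le> (LINT z|lborel. \<bar>\<rho> m (x - z) * u j z - \<rho> m (y - z) * u j z\<bar>)"
      by (simp only: integral_abs_bound)
    also have "\<dots> \<le> (LINT z|lborel. L m * norm (x - y) * \<bar>u j z\<bar>)"
    proof (intro integral_mono integrable_abs Bochner_Integration.integrable_diff conv_integrable[OF
        t u] integrable_mult_right u)
      fix z
      have "\<bar>\<rho> m (x - z) * u j z - \<rho> m (y - z) * u j z\<bar> = \<bar>\<rho> m (x - z) - \<rho> m (y - z)\<bar> * \<bar>u j z\<bar>"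
        by (simp add: left_diff_distrib[symmetric] abs_mult)
      also have "\<dots> \<le> L m * norm (x - y) * \<bar>u j z\<bar>" using L(2)[of m "x - z" "y - z"] by (intro
          mult_right_mono) auto
      finally show "\<bar>\<rho> m (x - z) * u j z - \<rho> m (y - z) * u j z\<bar> \<le> L m * norm (x - y) * \<bar>u j z\<bar>" .
    qed
    also have "\<dots> \<le> L m * norm (x - y) * C" using C(1)[of j] L(1)[of m] by (simp add: mult_left_mono)
    finally show ?thesis by (simp add: mult_ac)
  qed
  obtain Q :: "(real ^ 'd) set" where Q: "countable Q" "\<And>X. open X \<Longrightarrow> X \<noteq> {} \<Longrightarrow> \<exists>d\<in>Q. d \<in> X"
    using countable_dense_exists by blast
  \<comment> \<open>The normalization gives the common bound 1 at all scales, so a single diagonal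
    argument over pairs of a scale and a point of the dense set \<open>Q\<close> suffices.\<close>
  define F where "F j z = A (fst z) j (snd z) / (B (fst z) * C + 1)" for j and z :: "nat \<times>
      (real^'d)"
  have pos: "B m * C + 1 > 0" for m using B(1)[of m] C0 by (simp add: add_nonneg_pos)
  have "norm (F j z) \<le> 1" for j z
    using bndA[of "fst z" j "snd z"] pos[of "fst z"] by (simp add: F_def divide_le_eq)
  then obtain r where r: "strict_mono r" "\<And>z. z \<in> UNIV \<times> Q \<Longrightarrow> \<exists>l. (\<lambda>n. F (r n) z) \<longlonglongrightarrow> l"
    using function_convergent_subsequence[of "UNIV \<times> Q" F 1] Q(1) by (metis countable_SIGMA
        countableI_type)
  have convQ: "convergent (\<lambda>n. A m (r n) q)" if q: "q \<in> Q" for m q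
  proof -
    obtain l where "(\<lambda>n. F (r n) (m, q)) \<longlonglongrightarrow> l" using r(2)[of "(m, q)"] q by auto
    then have "(\<lambda>n. (B m * C + 1) * F (r n) (m, q)) \<longlonglongrightarrow> (B m * C + 1) * l" by (rule tendsto_mult_left)
    then show ?thesis using pos[of m] by (auto simp: F_def convergent_def)
  qed
  have convA: "convergent (\<lambda>n. A m (r n) x)" for m x
  proof (rule Cauchy_convergent, rule metric_CauchyI)
    fix e :: real assume e: "0 < e"
    \<comment> \<open>Moving from \<open>x\<close> to a dense point \<open>q\<close> within
      \<open>d\<close> changes every \<open>A m j\<close> by at most \<open>e/4\<close>.\<close>
    define d where "d = e / (4 * (L m * C + 1))"
    have LC: "L m * C + 1 > 0" using L(1)[of m] C0 by (simp add: add_nonneg_pos)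
    then have d: "d > 0" using e by (simp add: d_def)
    obtain q where q: "q \<in> Q" "norm (x - q) < d"
      using Q(2)[of "ball x d"] d by (auto simp: dist_norm)
    have "L m * C * norm (x - q) \<le> (L m * C + 1) * d" using q(2) L(1)[of m] C0 by (intro mult_mono)
        auto
    also have "\<dots> = e / 4" unfolding d_def by (rule quarter[OF LC])
    finally have small: "L m * C * norm (x - q) \<le> e / 4" .
    obtain N where N: "\<And>j k. j \<ge> N \<Longrightarrow> k \<ge> N \<Longrightarrow> \<bar>A m (r j) q - A m (r k) q\<bar> < e / 4"
      using metric_CauchyD[OF convergent_Cauchy[OF convQ[OF q(1)]], of "e/4" m] e by (auto simp:
          dist_real_def)
    have "dist (A m (r j) x) (A m (r k) x) < e" if "j \<ge> N" "k \<ge> N" for j k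
      using lipA[of m "r j" x q] lipA[of m "r k" x q] N[OF that] small e unfolding dist_real_def by
          linarith
    then show "\<exists>N. \<forall>j\<ge>N. \<forall>k\<ge>N. dist (A m (r j) x) (A m (r k) x) < e" by blast
  qed
  show ?thesis
  proof (rule that[OF r(1)])
    fix K :: "(real ^ 'd) set" and s e :: real
    assume K: "K \<in> sets borel" "emeasure lborel K < \<infinity>" "s > 0" "\<And>x. x \<in> K \<Longrightarrow> cball x s \<subseteq> \<Omega>" and e: "e
        > 0"
    note [measurable] = K(1)
    have mA[measurable]: "A m j \<in> borel_measurable borel" for m j
      unfolding A_def by (rule conv_measurable[OF t u])
    have mu[measurable]: "u j \<in> borel_measurable borel" for j using u[of j] by auto
    have [simp]: "integrable lborel (indicator K :: _ \<Rightarrow> real)" using K by simp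
    have iK: "integrable lborel (\<lambda>x. indicator K x * f x)" if "integrable lborel f" for f ::
        "real^'d \<Rightarrow> real"
      using that by (intro integrable_bounded_mult[where B=1]) (auto simp: indicator_def)
    have iA: "integrable lborel (A m j)" for m j unfolding A_def by (rule
        conv_mollifier_integrable[OF \<rho> u])
    define c where "c = real CARD('d) * C"
    have c0: "c \<ge> 0" using C0 by (simp add: c_def)
    \<comment> \<open>The first bound keeps shifts by at most \<open>\<epsilon> m\<close> inside
      \<open>\<Omega>\<close>; the second gives \<open>\<epsilon> m * c \<le> e/4\<close>, where
      \<open>c\<close> bounds the summed gradient integrals.\<close>
    have "\<forall>\<^sub>F m in sequentially. \<epsilon> m < min s (e / (4 * (c + 1)))"
      using order_tendstoD(2)[OF \<epsilon>0, of "min s (e / (4 * (c + 1)))"] K(3) e c0 by simp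
    then obtain m where m: "\<epsilon> m < s" "\<epsilon> m < e / (4 * (c + 1))" by (auto dest!: eventually_happens)
    have approx: "(LINT x|lborel. indicator K x * \<bar>A m j x - u j x\<bar>) \<le> e / 4" for j
    proof -
      have "(\<integral>\<^sup>+x. indicator K x * ennreal \<bar>conv (\<rho> m) (u j) x - u j x\<bar> \<partial>lborel) \<le> ennreal (\<epsilon> m *
          c)"
      proof (rule mollifier_approx[OF \<rho> u K(1)])
        fix h :: "real ^ 'd" assume h: "norm h \<le> \<epsilon> m"
        have "(\<integral>\<^sup>+x. indicator K x * ennreal \<bar>u j (x + h) - u j x\<bar> \<partial>lborel)
           \<le> ennreal (norm h) * (\<Sum>i\<in>UNIV. \<integral>\<^sup>+x. ennreal \<bar>g j i x\<bar> \<partial>lborel)"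
          by (rule translation_estimate[OF K(1) K(4) _ u g w]) (use h m in auto)
        also have "\<dots> \<le> ennreal (\<epsilon> m) * (\<Sum>i\<in>(UNIV::'d set). ennreal C)"
          using C(2) g by (intro mult_mono sum_mono ennreal_leI h) (auto simp:
              nn_integral_eq_integral ennreal_leI)
        also have "\<dots> = ennreal (\<epsilon> m * c)"
          using C0 \<epsilon>[of m] by (simp add: c_def ennreal_mult ennreal_of_nat_eq_real_of_nat)
        finally show "(\<integral>\<^sup>+x. indicator K x * ennreal \<bar>u j (x + h) - u j x\<bar> \<partial>lborel) \<le> ennreal (\<epsilon> m *
            c)" .
      qed
      moreover have "(\<integral>\<^sup>+x. indicator K x * ennreal \<bar>conv (\<rho> m) (u j) x - u j x\<bar> \<partial>lborel)
          = ennreal (LINT x|lborel. indicator K x * \<bar>A m j x - u j x\<bar>)"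
      proof -
        have i: "integrable lborel (\<lambda>x. indicator K x * \<bar>A m j x - u j x\<bar>)"
          by (intro iK integrable_abs Bochner_Integration.integrable_diff iA u)
        have "(\<integral>\<^sup>+x. indicator K x * ennreal \<bar>conv (\<rho> m) (u j) x - u j x\<bar> \<partial>lborel)
           = (\<integral>\<^sup>+x. ennreal (indicator K x * \<bar>A m j x - u j x\<bar>) \<partial>lborel)"
          by (intro nn_integral_cong) (simp add: A_def indicator_def)
        also have "\<dots> = ennreal (LINT x|lborel. indicator K x * \<bar>A m j x - u j x\<bar>)"
          by (rule nn_integral_eq_integral[OF i]) simp
        finally show ?thesis .
      qed
      moreover have "\<epsilon> m * c \<ge> 0" using c0 \<epsilon>[of m] by simp
      ultimately have "(LINT x|lborel. indicator K x * \<bar>A m j x - u j x\<bar>) \<le> \<epsilon> m * c" by simp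
      also have "\<dots> \<le> e / (4 * (c + 1)) * (c + 1)" using m(2) c0 \<epsilon>[of m] e by (intro mult_mono) auto
      also have "\<dots> = e / 4" using quarter[of "c + 1" e] c0 by (simp only: mult.commute)
      finally show ?thesis .
    qed
    \<comment> \<open>A common limit decouples the indices: \<open>j\<close> and \<open>k\<close>
      are compared with \<open>a\<close> separately. Two such errors and two mollification errors,
      each bounded by \<open>e/4\<close>, make up the claim.\<close>
    define a where "a x = lim (\<lambda>n. A m (r n) x)" for x
    have lima: "(\<lambda>n. A m (r n) x) \<longlonglongrightarrow> a x" for x unfolding a_def by (rule convergent_LIMSEQ_iff[THEN
        iffD1, OF convA])
    have [measurable]: "a \<in> borel_measurable borel" by (rule borel_measurable_LIMSEQ_real[OF lima])
        simp
    have bnda: "\<bar>a x\<bar> \<le> B m * C" for x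
      by (rule LIMSEQ_le_const2[OF tendsto_rabs[OF lima]]) (use bndA in auto)
    have "(\<lambda>n. LINT x|lborel. indicator K x * \<bar>A m (r n) x - a x\<bar>) \<longlonglongrightarrow> (LINT x::real^'d|lborel.
        (0::real))"
    proof (rule integral_dominated_convergence[where w="\<lambda>x. 2 * (B m * C) * indicator K x"])
      show "AE x in lborel. (\<lambda>n. indicator K x * \<bar>A m (r n) x - a x\<bar>) \<longlonglongrightarrow> 0"
      proof (intro always_eventually allI)
        fix x
        have "(\<lambda>n. indicator K x * \<bar>A m (r n) x - a x\<bar>) \<longlonglongrightarrow> indicator K x * \<bar>a x - a x\<bar>"
          by (intro tendsto_intros lima)
        then show "(\<lambda>n. indicator K x * \<bar>A m (r n) x - a x\<bar>) \<longlonglongrightarrow> 0" by simp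
      qed
      show "AE x in lborel. norm (indicator K x * \<bar>A m (r n) x - a x\<bar>) \<le> 2 * (B m * C) * indicator K
          x" for n
      proof (intro always_eventually allI)
        fix x
        show "norm (indicator K x * \<bar>A m (r n) x - a x\<bar>) \<le> 2 * (B m * C) * indicator K x"
          using bndA[of m "r n" x] bnda[of x] by (cases "x \<in> K") auto
      qed
    qed (use K in auto)
    then have "(\<lambda>n. LINT x|lborel. indicator K x * \<bar>A m (r n) x - a x\<bar>) \<longlonglongrightarrow> 0" by simp
    from order_tendstoD(2)[OF this, of "e/4"] e
    have ev: "\<forall>\<^sub>F n in sequentially. (LINT x|lborel. indicator K x * \<bar>A m (r n) x - a x\<bar>) < e / 4"
        by simp
    have ia: "integrable lborel (\<lambda>x. indicator K x * \<bar>A m (r n) x - a x\<bar>)" for n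
    proof (rule Bochner_Integration.integrable_bound[where f="\<lambda>x. 2 * (B m * C) * indicator K x"])
      show "AE x in lborel. norm (indicator K x * \<bar>A m (r n) x - a x\<bar>) \<le> norm (2 * (B m * C) *
          indicator K x)"
      proof (intro always_eventually allI)
        fix x
        show "norm (indicator K x * \<bar>A m (r n) x - a x\<bar>) \<le> norm (2 * (B m * C) * indicator K x)"
          using bndA[of m "r n" x] bnda[of x] by (cases "x \<in> K") auto
      qed
    qed (use K in auto)
    show "\<forall>\<^sub>F (j, k) in sequentially \<times>\<^sub>F sequentially.
         (LINT x|lborel. indicator K x * \<bar>u (r j) x - u (r k) x\<bar>) < e"
      unfolding eventually_prod_filter
    proof (intro exI conjI allI impI, rule ev, rule ev)
      fix j k
      assume j: "(LINT x|lborel. indicator K x * \<bar>A m (r j) x - a x\<bar>) < e / 4"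
        and k: "(LINT x|lborel. indicator K x * \<bar>A m (r k) x - a x\<bar>) < e / 4"
      have iu: "integrable lborel (\<lambda>x. indicator K x * \<bar>A m n x - u n x\<bar>)" for n using iK iA u by
          auto
      note i1 = Bochner_Integration.integrable_add[OF iu[of "r j"] iu[of "r k"]]
      note i2 = Bochner_Integration.integrable_add[OF ia[of j] ia[of k]]
      have "(LINT x|lborel. indicator K x * \<bar>u (r j) x - u (r k) x\<bar>) \<le>
        (LINT x|lborel. (indicator K x * \<bar>A m (r j) x - u (r j) x\<bar> + indicator K x * \<bar>A m (r k) x -
            u (r k) x\<bar>) +
          (indicator K x * \<bar>A m (r j) x - a x\<bar> + indicator K x * \<bar>A m (r k) x - a x\<bar>))"
      proof (rule integral_mono[OF _ Bochner_Integration.integrable_add[OF i1 i2]])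
        show "integrable lborel (\<lambda>x. indicator K x * \<bar>u (r j) x - u (r k) x\<bar>)" using u by (intro iK)
            auto
      qed (auto simp: indicator_def)
      also have "\<dots> = ((LINT x|lborel. indicator K x * \<bar>A m (r j) x - u (r j) x\<bar>) + (LINT x|lborel.
          indicator K x * \<bar>A m (r k) x - u (r k) x\<bar>)) +
          ((LINT x|lborel. indicator K x * \<bar>A m (r j) x - a x\<bar>) + (LINT x|lborel. indicator K x * \<bar>A
              m (r k) x - a x\<bar>))"
        by (simp only: Bochner_Integration.integral_add[OF i1 i2]
            Bochner_Integration.integral_add[OF iu iu] Bochner_Integration.integral_add[OF ia ia])
      finally show "case (j, k) of (j, k) \<Rightarrow> (LINT x|lborel. indicator K x * \<bar>u (r j) x - u (r k) x\<bar>)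
          < e"
        using approx[of "r j"] approx[of "r k"] j k by simp
    qed
  qed
qed

section \<open>Minors are null Lagrangians\<close>

context finite_measure begin

text \<open>From \<open>F G \<le> (max F G)^2\<close> the products are bounded in the power
  \<open>p/2 > 1\<close>. Where \<open>G\<close> is bounded, \<open>F G\<close> is small together
  with \<open>F\<close>; so the product tends to 0 in measure, and by
  \<open>conv_meas_vitali\<close> in mean.\<close>

lemma integral_product_tendsto_0:
  assumes [measurable]: "\<And>i. F i \<in> borel_measurable M" "\<And>i. G i \<in> borel_measurable M"
    and nn: "\<And>i x. 0 \<le> F i x" "\<And>i x. 0 \<le> G i x" and p: "2 < p"
    and int: "\<And>i. integrable M (\<lambda>x. F i x powr p)" "\<And>i. integrable M (\<lambda>x. G i x powr p)"
  shows "\<And>i. integrable M (\<lambda>x. F i x * G i x)"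
    and "(\<And>i. (LINT x|M. F i x powr p) \<le> C) \<Longrightarrow> (\<And>i. (LINT x|M. G i x powr p) \<le> C) \<Longrightarrow>
      conv_meas M \<F> F \<Longrightarrow> ((\<lambda>i. LINT x|M. F i x * G i x) \<longlongrightarrow> 0) \<F>"
proof -
  have le: "(F i x * G i x) powr (p/2) \<le> F i x powr p + G i x powr p" for i x
  proof -
    let ?m = "max (F i x) (G i x)"
    have "F i x * G i x \<le> ?m * ?m" using nn by (intro mult_mono) (auto simp: le_max_iff_disj)
    then have "(F i x * G i x) powr (p/2) \<le> (?m * ?m) powr (p/2)" using nn p by (intro powr_mono2)
        auto
    also have "\<dots> = ?m powr p" using nn[of i x] by (simp add: powr_mult powr_add[symmetric])
    also have "\<dots> \<le> F i x powr p + G i x powr p" by (simp add: max_def)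
    finally show ?thesis .
  qed
  have i2: "integrable M (\<lambda>x. (F i x * G i x) powr (p/2))" for i
    by (rule Bochner_Integration.integrable_bound[OF Bochner_Integration.integrable_add[OF int]])
        (auto intro!: AE_I2 order_trans[OF le])
  have "integrable M (\<lambda>x. (F i x * G i x) powr 1)" for i
    by (rule integrable_powr_le[where p="p/2"]) (use nn p i2 in auto)
  then show ip: "integrable M (\<lambda>x. F i x * G i x)" for i using nn by simp
  assume C: "\<And>i. (LINT x|M. F i x powr p) \<le> C" "\<And>i. (LINT x|M. G i x powr p) \<le> C"
    and F: "conv_meas M \<F> F"
  have "conv_meas M \<F> (\<lambda>i x. F i x * G i x)"
  proof (rule conv_meas_soft[OF _ _ F int(2) _ C(2)])
    fix R e :: real assume e: "0 < e"
    define S where "S = max R 0 powr (1/p)"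
    have S: "S \<ge> 0" by (simp add: S_def)
    have "F i x * G i x \<le> e" if b: "G i x powr p \<le> R" and f: "F i x \<le> e / (S + 1)" for i x
    proof -
      have "G i x = (G i x powr p) powr (1/p)" using nn p by (simp add: powr_powr)
      also have "\<dots> \<le> S" unfolding S_def using b p by (intro powr_mono2) auto
      finally have "G i x \<le> S + 1" by simp
      then have "F i x * G i x \<le> e / (S + 1) * (S + 1)" using f nn S e by (intro mult_mono) auto
      then show ?thesis using S by simp
    qed
    then show "\<exists>d>0. \<forall>i. \<forall>x\<in>space M. G i x powr p \<le> R \<longrightarrow> F i x \<le> d \<longrightarrow> F i x * G i x \<le> e"
      using S e by (intro exI[of _ "e / (S + 1)"]) auto
  qed auto
  moreover have "(LINT x|M. (F i x * G i x) powr (p/2)) \<le> C + C" for i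
  proof -
    have "(LINT x|M. (F i x * G i x) powr (p/2)) \<le> (LINT x|M. F i x powr p + G i x powr p)"
      by (rule integral_mono[OF i2 Bochner_Integration.integrable_add[OF int] le])
    also have "\<dots> = (LINT x|M. F i x powr p) + (LINT x|M. G i x powr p)"
      by (rule Bochner_Integration.integral_add[OF int])
    also have "\<dots> \<le> C + C" by (intro add_mono C)
    finally show ?thesis .
  qed
  ultimately have "((\<lambda>i. LINT x|M. (F i x * G i x) powr 1) \<longlongrightarrow> 0) \<F>"
    using p nn i2 by (intro conv_meas_vitali[where p="p/2" and C="C + C"]) auto
  then show "((\<lambda>i. LINT x|M. F i x * G i x) \<longlongrightarrow> 0) \<F>" using nn by simp
qed

end

section \<open>Integrals over \<open>\<Omega>\<close> and over the whole space\<close>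

lemma finite_measure_restrict_lborel:
  assumes "bounded \<Omega>" "\<Omega> \<in> sets borel"
  shows "finite_measure (restrict_space lborel \<Omega>)"
  by (rule finite_measureI) (use assms emeasure_bounded_finite[OF assms(1)] in \<open>simp add:
      emeasure_restrict_space space_restrict_space\<close>)

lemma restrict_lborel:
  fixes f :: "'a::euclidean_space \<Rightarrow> 'b::{banach,second_countable_topology}"
  assumes "\<Omega> \<in> sets borel" "\<And>x. x \<notin> \<Omega> \<Longrightarrow> f x = 0"
  shows "integrable (restrict_space lborel \<Omega>) f \<longleftrightarrow> integrable lborel f"
    and "(LINT x|restrict_space lborel \<Omega>. f x) = (LINT x|lborel. f x)"
proof -
  have "(\<lambda>x. indicator \<Omega> x *\<^sub>R f x) = f" using assms(2) by (auto simp: indicator_def)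
  then show "integrable (restrict_space lborel \<Omega>) f \<longleftrightarrow> integrable lborel f"
    "(LINT x|restrict_space lborel \<Omega>. f x) = (LINT x|lborel. f x)"
    using assms(1) by (simp_all add: integrable_restrict_space integral_restrict_space)
qed

lemma integrable_restrict_lborel:
  fixes f :: "'a::euclidean_space \<Rightarrow> 'b::{banach,second_countable_topology}"
  assumes "\<Omega> \<in> sets borel" "integrable lborel f"
  shows "integrable (restrict_space lborel \<Omega>) f"
  using assms by (simp add: integrable_restrict_space integrable_mult_indicator)

lemma measurable_restrict_lborel:
  "f \<in> borel_measurable borel \<Longrightarrow> f \<in> borel_measurable (restrict_space lborel \<Omega>)"
  by (rule measurable_restrict_space1) simp

lemma norm_diff_powr_le:
  fixes a b :: "'a::real_normed_vector"
  assumes "0 \<le> p"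
  shows "norm (a - b) powr p \<le> 2 powr p * (norm a powr p + norm b powr p)"
proof -
  have "norm (a - b) powr p \<le> (2 * max (norm a) (norm b)) powr p"
    using assms norm_triangle_ineq4[of a b] by (intro powr_mono2) auto
  also have "\<dots> = 2 powr p * max (norm a) (norm b) powr p"
    by (simp add: powr_mult)
  also have "\<dots> \<le> 2 powr p * (norm a powr p + norm b powr p)"
    by (intro mult_left_mono) (auto simp: max_def)
  finally show ?thesis .
qed

text \<open>A weak gradient is curl free: integrating by parts leaves \<open>v\<close> times the
  difference of the two mixed derivatives of \<open>\<phi>\<close>. Smoothness is on the side of
  \<open>\<phi>\<close>, while \<open>v\<close> stays rough.\<close>

lemma smooth_null_lagrangian:
  fixes v :: "real ^ 2 \<Rightarrow> real"
  assumes v: "weak_grad \<Omega> v h" and h: "\<And>k. integrable lborel (h k)" and \<phi>: "\<phi> \<in> test_functions \<Omega>"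
  shows "(LINT x|lborel. pd 1 \<phi> x * h 2 x - pd 2 \<phi> x * h 1 x) = 0"
proof -
  have "(LINT x|lborel. v x * pd 2 (pd 1 \<phi>) x) = - (LINT x|lborel. h 2 x * pd 1 \<phi> x)"
    "(LINT x|lborel. v x * pd 1 (pd 2 \<phi>) x) = - (LINT x|lborel. h 1 x * pd 2 \<phi> x)"
    using v test_functions_pd[OF \<phi>] unfolding weak_grad_def by auto
  moreover have "pd 2 (pd 1 \<phi>) x = pd 1 (pd 2 \<phi>) x" for x
    by (rule pd_commute[OF test_functionsD(1)[OF \<phi>]])
  ultimately have "(LINT x|lborel. h 2 x * pd 1 \<phi> x) = (LINT x|lborel. h 1 x * pd 2 \<phi> x)" by simp
  moreover have "(LINT x|lborel. pd 1 \<phi> x * h 2 x - pd 2 \<phi> x * h 1 x) =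
     (LINT x|lborel. pd 1 \<phi> x * h 2 x) - (LINT x|lborel. pd 2 \<phi> x * h 1 x)"
    by (rule Bochner_Integration.integral_diff[OF test_mult_integrable[OF test_functions_pd[OF \<phi>] h]
        test_mult_integrable[OF test_functions_pd[OF \<phi>] h]])
  ultimately show ?thesis by (simp add: mult.commute)
qed

text \<open>By \<open>mollifier_powr_le\<close> the errors \<open>conv (\<rho> n) f - f\<close> stay
  bounded in the \<open>p\<close>-th power while tending to 0 in \<open>L^1\<close>, so
  \<open>integral_product_tendsto_0\<close> applies to their product with \<open>h\<close>.\<close>

lemma mollified_product_tendsto:
  fixes f h :: "real ^ 'd \<Rightarrow> real"
  assumes \<Omega>: "bounded \<Omega>" "\<Omega> \<in> sets borel" and \<psi>: "\<psi> \<in> test_functions \<Omega>"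
    and m: "\<And>n. mollifier (r n) (\<rho> n)" and r: "r \<longlonglongrightarrow> 0"
    and f: "integrable lborel f" "integrable lborel (\<lambda>x. \<bar>f x\<bar> powr p)"
    and h: "integrable lborel h" "integrable lborel (\<lambda>x. \<bar>h x\<bar> powr p)" and p: "2 < p"
  shows "integrable lborel (\<lambda>x. \<psi> x * (f x * h x))"
    "integrable lborel (\<lambda>x. \<psi> x * (conv (\<rho> n) f x * h x))"
    "(\<lambda>n. LINT x|lborel. \<psi> x * (conv (\<rho> n) f x * h x)) \<longlonglongrightarrow> (LINT x|lborel. \<psi> x * (f x * h x))"
proof -
  let ?N = "restrict_space lborel \<Omega>"
  interpret N: finite_measure ?N by (rule finite_measure_restrict_lborel[OF \<Omega>])
  have [measurable]: "f \<in> borel_measurable borel" "h \<in> borel_measurable borel" using f(1) h(1) by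
      auto
  have [measurable]: "conv (\<rho> n) f \<in> borel_measurable borel" for n
    by (rule conv_measurable[OF mollifierD(1)[OF m] f(1)])
  have [measurable]: "\<psi> \<in> borel_measurable borel" by (rule test_functions_measurable[OF \<psi>])
  obtain B where B: "B > 0" "\<And>x. \<bar>\<psi> x\<bar> \<le> B" using test_functions_bounded[OF \<psi>] by metis
  have z: "\<psi> x * g = 0" if "x \<notin> \<Omega>" for x g using test_functionsD(6)[OF \<psi> that] by simp
  define F where "F n x = \<bar>conv (\<rho> n) f x - f x\<bar>" for n x
  have mF[measurable]: "F n \<in> borel_measurable borel" for n unfolding F_def by measurable
  have cp: "integrable lborel (\<lambda>x. \<bar>conv (\<rho> n) f x\<bar> powr p)" "(LINT x|lborel. \<bar>conv (\<rho> n) f x\<bar> powr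
      p) \<le> (LINT x|lborel. \<bar>f x\<bar> powr p)" for n
  proof -
    have le: "(\<integral>\<^sup>+x. ennreal (\<bar>conv (\<rho> n) f x\<bar> powr p) \<partial>lborel) \<le> (\<integral>\<^sup>+x. ennreal (\<bar>f x\<bar> powr p)
        \<partial>lborel)"
      using p by (intro mollifier_powr_le[OF m f(1) _ f(2)]) auto
    also have "\<dots> = ennreal (LINT x|lborel. \<bar>f x\<bar> powr p)" by (rule nn_integral_eq_integral[OF f(2)])
        simp
    finally have le: "(\<integral>\<^sup>+x. ennreal (\<bar>conv (\<rho> n) f x\<bar> powr p) \<partial>lborel) \<le> ennreal (LINT x|lborel. \<bar>f
        x\<bar> powr p)" .
    show i: "integrable lborel (\<lambda>x. \<bar>conv (\<rho> n) f x\<bar> powr p)"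
      by (rule integrableI_bounded) (use le in \<open>auto simp: order.strict_trans1\<close>)
    show "(LINT x|lborel. \<bar>conv (\<rho> n) f x\<bar> powr p) \<le> (LINT x|lborel. \<bar>f x\<bar> powr p)"
      using le by (subst (asm) nn_integral_eq_integral[OF i]) auto
  qed
  define I where "I = (LINT x|lborel. \<bar>f x\<bar> powr p)"
  have Fp: "integrable lborel (\<lambda>x. F n x powr p)" "(LINT x|lborel. F n x powr p) \<le> 2 powr p * (I +
      I)" for n
  proof -
    have le: "F n x powr p \<le> 2 powr p * (\<bar>conv (\<rho> n) f x\<bar> powr p + \<bar>f x\<bar> powr p)" for x
      unfolding F_def using norm_diff_powr_le[of p "conv (\<rho> n) f x" "f x"] p by simp
    note ib = integrable_mult_right[OF Bochner_Integration.integrable_add[OF cp(1)[of n] f(2)], of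
        "2 powr p"]
    show i: "integrable lborel (\<lambda>x. F n x powr p)"
      by (rule Bochner_Integration.integrable_bound[OF ib]) (auto intro!: AE_I2 order_trans[OF le])
    have "(LINT x|lborel. F n x powr p) \<le> (LINT x|lborel. 2 powr p * (\<bar>conv (\<rho> n) f x\<bar> powr p + \<bar>f
        x\<bar> powr p))"
      by (rule integral_mono[OF i ib le])
    also have "\<dots> = 2 powr p * ((LINT x|lborel. \<bar>conv (\<rho> n) f x\<bar> powr p) + I)"
      by (simp add: Bochner_Integration.integral_add[OF cp(1) f(2)] I_def)
    also have "\<dots> \<le> 2 powr p * (I + I)" using cp(2)[of n] by (intro mult_left_mono add_mono) (auto
        simp: I_def)
    finally show "(LINT x|lborel. F n x powr p) \<le> 2 powr p * (I + I)" .
  qed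
  have mono: "(LINT x|?N. g x) \<le> (LINT x|lborel. g x)" if "integrable lborel g" "\<And>x. 0 \<le> g x" for g
      :: "real^'d \<Rightarrow> real"
  proof -
    have "(LINT x|?N. g x) = (LINT x|lborel. indicator \<Omega> x *\<^sub>R g x)" using \<Omega> by (simp add:
        integral_restrict_space)
    also have "\<dots> \<le> (LINT x|lborel. g x)"
      by (intro integral_mono integrable_mult_indicator) (use that \<Omega> in \<open>auto simp: indicator_def\<close>)
    finally show ?thesis .
  qed
  \<comment> \<open>The constant family over \<open>unit\<close> extracts the integrability part of
    the product lemma for a single pair of functions.\<close>
  have prodN: "integrable ?N (\<lambda>x. \<bar>f x\<bar> * \<bar>h x\<bar>)"
    by (rule N.integral_product_tendsto_0(1)[where F="\<lambda>_::unit. \<lambda>x. \<bar>f x\<bar>" and G="\<lambda>_ x. \<bar>h x\<bar>" and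
        p=p])
      (use p f h \<Omega> in \<open>auto intro!: measurable_restrict_lborel integrable_restrict_lborel\<close>)
  have prodcN: "integrable ?N (\<lambda>x. \<bar>conv (\<rho> n) f x\<bar> * \<bar>h x\<bar>)" for n
    by (rule N.integral_product_tendsto_0(1)[where F="\<lambda>_::unit. \<lambda>x. \<bar>conv (\<rho> n) f x\<bar>" and G="\<lambda>_ x.
        \<bar>h x\<bar>" and p=p])
      (use p cp h \<Omega> in \<open>auto intro!: measurable_restrict_lborel integrable_restrict_lborel\<close>)
  have toL: "integrable lborel (\<lambda>x. \<psi> x * (a x * h x))" if a: "integrable ?N (\<lambda>x. \<bar>a x\<bar> * \<bar>h x\<bar>)" "a
      \<in> borel_measurable borel" for a :: "real^'d \<Rightarrow> real"
  proof -
    note [measurable] = a(2)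
    have "integrable ?N (\<lambda>x. a x * h x)"
      by (rule Bochner_Integration.integrable_bound[OF a(1)]) (auto intro!:
          measurable_restrict_lborel simp: abs_mult)
    then have "integrable ?N (\<lambda>x. \<psi> x * (a x * h x))"
      by (intro integrable_bounded_mult[OF measurable_restrict_lborel B(2)]) auto
    then show ?thesis by (subst (asm) restrict_lborel(1)) (use \<Omega> z in auto)
  qed
  show i1: "integrable lborel (\<lambda>x. \<psi> x * (f x * h x))" by (rule toL[OF prodN]) auto
  show i2: "integrable lborel (\<lambda>x. \<psi> x * (conv (\<rho> n) f x * h x))" for n by (rule toL[OF prodcN])
      auto
  have Fnn: "0 \<le> F n x" for n x by (simp add: F_def)
  have iF: "integrable lborel (F n)" for n
    unfolding F_def by (rule integrable_abs[OF Bochner_Integration.integrable_diff[OF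
        conv_mollifier_integrable[OF m f(1)] f(1)]])
  have "(\<lambda>n. LINT x|lborel. F n x) \<longlonglongrightarrow> 0" unfolding F_def by (rule mollifier_tendsto_L1[OF m r f(1)])
  then have "(\<lambda>n. LINT x|?N. F n x) \<longlonglongrightarrow> 0"
    by (rule tendsto_sandwich[OF _ _ tendsto_const, rotated 2])
      (auto intro!: always_eventually mono[OF iF] Bochner_Integration.integral_nonneg Fnn)
  then have cF: "conv_meas ?N sequentially F"
    by (intro N.conv_meas_markov integrable_restrict_lborel \<Omega> iF Fnn)
  define C where "C = max (2 powr p * (I + I)) (LINT x|lborel. \<bar>h x\<bar> powr p)"
  have lim: "(\<lambda>n. LINT x|?N. F n x * \<bar>h x\<bar>) \<longlonglongrightarrow> 0" and ipr: "\<And>n. integrable ?N (\<lambda>x. F n x * \<bar>h x\<bar>)"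
  proof -
    have C1: "(LINT x|?N. F n x powr p) \<le> C" for n
      using order_trans[OF mono[OF Fp(1)] Fp(2)] by (auto simp: C_def le_max_iff_disj)
    have C2: "(LINT x|?N. \<bar>h x\<bar> powr p) \<le> C"
      using mono[OF h(2)] by (auto simp: C_def le_max_iff_disj)
    have iFp: "integrable ?N (\<lambda>x. F n x powr p)" for n by (rule integrable_restrict_lborel[OF \<Omega>(2)
        Fp(1)])
    have ihp: "integrable ?N (\<lambda>x. \<bar>h x\<bar> powr p)" by (rule integrable_restrict_lborel[OF \<Omega>(2) h(2)])
    show "(\<lambda>n. LINT x|?N. F n x * \<bar>h x\<bar>) \<longlonglongrightarrow> 0"
      by (rule N.integral_product_tendsto_0(2)[where G="\<lambda>_ x. \<bar>h x\<bar>", OF _ _ _ _ p iFp ihp C1 C2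
          cF])
        (auto intro!: measurable_restrict_lborel simp: F_def)
    show "integrable ?N (\<lambda>x. F n x * \<bar>h x\<bar>)" for n
      by (rule N.integral_product_tendsto_0(1)[where G="\<lambda>_ x. \<bar>h x\<bar>", OF _ _ _ _ p iFp ihp])
        (auto intro!: measurable_restrict_lborel simp: F_def)
  qed
  show "(\<lambda>n. LINT x|lborel. \<psi> x * (conv (\<rho> n) f x * h x)) \<longlonglongrightarrow> (LINT x|lborel. \<psi> x * (f x * h x))"
  proof (rule Lim_null[THEN iffD2], rule Lim_null_comparison[OF always_eventually[OF allI]])
    show "(\<lambda>n. B * (LINT x|?N. F n x * \<bar>h x\<bar>)) \<longlonglongrightarrow> 0" by (rule tendsto_mult_right_zero[OF lim])
    fix n
    have "(LINT x|lborel. \<psi> x * (conv (\<rho> n) f x * h x)) - (LINT x|lborel. \<psi> x * (f x * h x)) =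
       (LINT x|lborel. \<psi> x * (conv (\<rho> n) f x * h x) - \<psi> x * (f x * h x))"
      by (rule Bochner_Integration.integral_diff[OF i2 i1, symmetric])
    also have "\<dots> = (LINT x|?N. \<psi> x * (conv (\<rho> n) f x * h x) - \<psi> x * (f x * h x))"
      by (rule restrict_lborel(2)[symmetric]) (use \<Omega> z in auto)
    finally have eq: "(LINT x|lborel. \<psi> x * (conv (\<rho> n) f x * h x)) - (LINT x|lborel. \<psi> x * (f x * h
        x)) =
       (LINT x|?N. \<psi> x * (conv (\<rho> n) f x * h x) - \<psi> x * (f x * h x))" .
    have "\<bar>LINT x|?N. \<psi> x * (conv (\<rho> n) f x * h x) - \<psi> x * (f x * h x)\<bar> \<le>
      (LINT x|?N. \<bar>\<psi> x * (conv (\<rho> n) f x * h x) - \<psi> x * (f x * h x)\<bar>)" by (rule integral_abs_bound)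
    also have "\<dots> \<le> (LINT x|?N. B * (F n x * \<bar>h x\<bar>))"
    proof (rule integral_mono[OF _ integrable_mult_right[OF ipr]])
      show "integrable ?N (\<lambda>x. \<bar>\<psi> x * (conv (\<rho> n) f x * h x) - \<psi> x * (f x * h x)\<bar>)"
        by (intro integrable_restrict_lborel \<Omega> integrable_abs Bochner_Integration.integrable_diff i1
            i2)
      fix x
      have "\<psi> x * (conv (\<rho> n) f x * h x) - \<psi> x * (f x * h x) = \<psi> x * ((conv (\<rho> n) f x - f x) * h x)"
        by (simp add: algebra_simps)
      then show "\<bar>\<psi> x * (conv (\<rho> n) f x * h x) - \<psi> x * (f x * h x)\<bar> \<le> B * (F n x * \<bar>h x\<bar>)"
        using B by (auto simp: abs_mult F_def intro!: mult_right_mono)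
    qed
    finally show "norm ((LINT x|lborel. \<psi> x * (conv (\<rho> n) f x * h x)) - (LINT x|lborel. \<psi> x * (f x *
        h x))) \<le> B * (LINT x|?N. F n x * \<bar>h x\<bar>)"
      unfolding eq by simp
  qed
qed

lemma compact_in_open_cball:
  fixes K :: "'a::euclidean_space set"
  assumes "compact K" "open \<Omega>" "K \<subseteq> \<Omega>"
  obtains s where "s > 0" "\<And>x. x \<in> K \<Longrightarrow> cball x s \<subseteq> \<Omega>"
proof (cases "\<Omega> = UNIV \<or> K = {}")
  case True then show ?thesis using that[of 1] by auto
next
  case False
  have "\<exists>d>0. \<forall>x\<in>K. \<forall>y\<in>- \<Omega>. d \<le> dist x y"
    by (rule separate_compact_closed) (use assms in auto)
  then obtain d where d: "d > 0" "\<And>x y. x \<in> K \<Longrightarrow> y \<notin> \<Omega> \<Longrightarrow> d \<le> dist x y" by auto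
  have "cball x (d/2) \<subseteq> \<Omega>" if "x \<in> K" for x
  proof
    fix y assume "y \<in> cball x (d/2)"
    then show "y \<in> \<Omega>" using d(2)[OF that, of y] d(1) by (cases "y \<in> \<Omega>") auto
  qed
  then show ?thesis using that[of "d/2"] d(1) by auto
qed

text \<open>The test function \<open>\<eta> * conv (\<rho> n) u\<close> in
  \<open>smooth_null_lagrangian\<close> yields the identity with \<open>u\<close> and
  \<open>g\<close> mollified but \<open>h\<close> left rough; then \<open>n\<close> tends to
  infinity. The right side contains no derivative of \<open>u\<close>, and this is what makes minors
  weakly continuous.\<close>

lemma weak_null_lagrangian:
  fixes u v :: "real ^ 2 \<Rightarrow> real"
  assumes \<Omega>: "open \<Omega>" "bounded \<Omega>" and p: "2 < p" and \<eta>: "\<eta> \<in> test_functions \<Omega>"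
    and u: "weak_grad \<Omega> u g" "integrable lborel u" "integrable lborel (\<lambda>x. \<bar>u x\<bar> powr p)"
    and g: "\<And>k. integrable lborel (g k)" "\<And>k. integrable lborel (\<lambda>x. \<bar>g k x\<bar> powr p)"
    and v: "weak_grad \<Omega> v h" "\<And>k. integrable lborel (h k)" "\<And>k. integrable lborel (\<lambda>x. \<bar>h k x\<bar> powr
        p)"
  shows "(LINT x|lborel. \<eta> x * (g 1 x * h 2 x - g 2 x * h 1 x)) =
    - (LINT x|lborel. u x * (pd 1 \<eta> x * h 2 x - pd 2 \<eta> x * h 1 x))"
proof -
  let ?K = "closure {x. \<eta> x \<noteq> 0}"
  obtain s where s: "s > 0" "\<And>x. x \<in> ?K \<Longrightarrow> cball x s \<subseteq> \<Omega>"
    using compact_in_open_cball[OF test_functionsD(2)[OF \<eta>] \<Omega>(1) test_functionsD(3)[OF \<eta>]] by metis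
  have b\<Omega>: "\<Omega> \<in> sets borel" using \<Omega> by simp
  \<comment> \<open>Radii at most \<open>s\<close>, so that at every point of the support of
    \<open>\<eta>\<close> the mollification sees only \<open>\<Omega>\<close>.\<close>
  define e where "e n = s * inverse (real (Suc n))" for n
  have e: "e n > 0" "e n \<le> s" for n
    using s(1) mult_left_mono[of "inverse (real (Suc n))" 1 s] by (auto simp: e_def field_simps)
  have e0: "e \<longlonglongrightarrow> 0" unfolding e_def by (rule tendsto_mult_right_zero[OF LIMSEQ_inverse_real_of_nat])
  have "\<forall>n. \<exists>\<rho> :: real^2 \<Rightarrow> real. mollifier (e n) \<rho>" using mollifier_exists[OF e(1)] by blast
  then obtain \<rho> :: "nat \<Rightarrow> real^2 \<Rightarrow> real" where \<rho>: "\<And>n. mollifier (e n) (\<rho> n)" by metis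
  note P = mollified_product_tendsto[OF \<Omega>(2) b\<Omega> _ \<rho> e0 _ _ v(2) v(3) p]
  note Pg = P[OF \<eta> g(1) g(2)]
  note Pu = P[OF test_functions_pd[OF \<eta>] u(2) u(3)]
  have zero: "((LINT x|lborel. \<eta> x * (conv (\<rho> n) (g 1) x * h 2 x)) - (LINT x|lborel. \<eta> x * (conv (\<rho>
      n) (g 2) x * h 1 x)))
     + ((LINT x|lborel. pd 1 \<eta> x * (conv (\<rho> n) u x * h 2 x)) - (LINT x|lborel. pd 2 \<eta> x * (conv (\<rho>
         n) u x * h 1 x))) = 0" for n
  proof -
    define \<phi> where "\<phi> x = \<eta> x * conv (\<rho> n) u x" for x
    have \<phi>: "\<phi> \<in> test_functions \<Omega>"
      unfolding \<phi>_def by (rule test_functions_mult[OF \<eta> conv_Ck[OF mollifierD(1)[OF \<rho>] u(2)]])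
    have pd: "pd i \<phi> x = \<eta> x * conv (\<rho> n) (g i) x + pd i \<eta> x * conv (\<rho> n) u x" for i x
    proof -
      have "(conv (\<rho> n) u has_derivative frechet_derivative (conv (\<rho> n) u) (at x)) (at x)"
        using conv_has_derivative[OF mollifierD(1)[OF \<rho>] u(2)] frechet_derivative_works
            differentiable_def by blast
      from has_derivative_mult[OF frechet_derivative_works[THEN iffD1, OF test_functionsD(5)[OF \<eta>]]
          this]
      have "pd i \<phi> x = \<eta> x * pd i (conv (\<rho> n) u) x + pd i \<eta> x * conv (\<rho> n) u x"
        unfolding pd_def \<phi>_def by (simp add: frechet_derivative_eqI)
      moreover have "\<eta> x * pd i (conv (\<rho> n) u) x = \<eta> x * conv (\<rho> n) (g i) x"
      proof (cases "\<eta> x = 0")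
        case False
        then have "x \<in> ?K" using closure_subset[of "{x. \<eta> x \<noteq> 0}"] by auto
        then have "cball x (e n) \<subseteq> \<Omega>" using s(2)[of x] subset_cball[OF e(2)[of n], of x] by blast
        then have "pd i (conv (\<rho> n) u) x = conv (\<rho> n) (g i) x"
          by (intro pd_conv_weak[OF mollifierD(1)[OF \<rho>] mollifierD(4)[OF \<rho>] _ u(2,1)])
        then show ?thesis by simp
      qed simp
      ultimately show ?thesis by simp
    qed
    have "0 = (LINT x|lborel. pd 1 \<phi> x * h 2 x - pd 2 \<phi> x * h 1 x)"
      by (rule smooth_null_lagrangian[OF v(1,2) \<phi>, symmetric])
    also have "\<dots> = (LINT x|lborel. (\<eta> x * (conv (\<rho> n) (g 1) x * h 2 x) - \<eta> x * (conv (\<rho> n) (g 2) x *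
        h 1 x))
       + (pd 1 \<eta> x * (conv (\<rho> n) u x * h 2 x) - pd 2 \<eta> x * (conv (\<rho> n) u x * h 1 x)))"
      by (intro Bochner_Integration.integral_cong refl) (simp add: pd algebra_simps)
    also have "\<dots> = ((LINT x|lborel. \<eta> x * (conv (\<rho> n) (g 1) x * h 2 x)) - (LINT x|lborel. \<eta> x *
        (conv (\<rho> n) (g 2) x * h 1 x)))
     + ((LINT x|lborel. pd 1 \<eta> x * (conv (\<rho> n) u x * h 2 x)) - (LINT x|lborel. pd 2 \<eta> x * (conv (\<rho>
         n) u x * h 1 x)))"
      by (simp only: Bochner_Integration.integral_add[OF Bochner_Integration.integrable_diff[OF
          Pg(2) Pg(2)] Bochner_Integration.integrable_diff[OF Pu(2) Pu(2)]]
        Bochner_Integration.integral_diff[OF Pg(2) Pg(2)] Bochner_Integration.integral_diff[OF Pu(2)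
            Pu(2)])
    finally show ?thesis by simp
  qed
  have "(\<lambda>n. ((LINT x|lborel. \<eta> x * (conv (\<rho> n) (g 1) x * h 2 x)) - (LINT x|lborel. \<eta> x * (conv (\<rho>
      n) (g 2) x * h 1 x)))
     + ((LINT x|lborel. pd 1 \<eta> x * (conv (\<rho> n) u x * h 2 x)) - (LINT x|lborel. pd 2 \<eta> x * (conv (\<rho>
         n) u x * h 1 x))))
    \<longlonglongrightarrow> ((LINT x|lborel. \<eta> x * (g 1 x * h 2 x)) - (LINT x|lborel. \<eta> x * (g 2 x * h 1 x)))
     + ((LINT x|lborel. pd 1 \<eta> x * (u x * h 2 x)) - (LINT x|lborel. pd 2 \<eta> x * (u x * h 1 x)))"
    by (intro tendsto_add tendsto_diff Pg(3) Pu(3))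
  then have "((LINT x|lborel. \<eta> x * (g 1 x * h 2 x)) - (LINT x|lborel. \<eta> x * (g 2 x * h 1 x)))
     + ((LINT x|lborel. pd 1 \<eta> x * (u x * h 2 x)) - (LINT x|lborel. pd 2 \<eta> x * (u x * h 1 x))) = 0"
    unfolding zero by (rule LIMSEQ_unique[OF tendsto_const, symmetric])
  moreover have "(LINT x|lborel. \<eta> x * (g 1 x * h 2 x - g 2 x * h 1 x)) =
     (LINT x|lborel. \<eta> x * (g 1 x * h 2 x)) - (LINT x|lborel. \<eta> x * (g 2 x * h 1 x))"
    unfolding right_diff_distrib by (rule Bochner_Integration.integral_diff[OF Pg(1) Pg(1)])
  moreover have "(LINT x|lborel. u x * (pd 1 \<eta> x * h 2 x - pd 2 \<eta> x * h 1 x)) =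
     (LINT x|lborel. pd 1 \<eta> x * (u x * h 2 x)) - (LINT x|lborel. pd 2 \<eta> x * (u x * h 1 x))"
    unfolding right_diff_distrib mult.left_commute[of "u _"] by (rule
        Bochner_Integration.integral_diff[OF Pu(1) Pu(1)])
  ultimately show ?thesis by linarith
qed

text \<open>On the compact set where \<open>f \<ge> e\<close> the function \<open>g\<close> attains
  its minimum, which is positive since \<open>g = 0\<close> would force \<open>f \<le> 0\<close>;
  half of it serves as \<open>d\<close>.\<close>

lemma compact_soft_implication:
  fixes f g :: "'a::metric_space \<Rightarrow> real"
  assumes K: "compact K" and f: "continuous_on K f" and g: "continuous_on K g" and nn: "\<And>x. x \<in> K \<Longrightarrow>
      0 \<le> g x"
    and imp: "\<And>x. x \<in> K \<Longrightarrow> g x = 0 \<Longrightarrow> f x \<le> 0" and e: "0 < e"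
  shows "\<exists>d>0. \<forall>x\<in>K. g x \<le> d \<longrightarrow> f x \<le> e"
proof -
  define S where "S = K \<inter> f -` {e..}"
  have S: "compact S"
    unfolding S_def using continuous_on_closed_vimage[THEN iffD1, OF compact_imp_closed[OF K] f,
        rule_format, of "{e..}"] K
    by (metis Int_commute closed_atLeast compact_Int_closed inf.left_idem)
  show ?thesis
  proof (cases "S = {}")
    case True
    then show ?thesis by (intro exI[of _ 1]) (force simp: S_def)
  next
    case False
    obtain x where x: "x \<in> S" "\<And>y. y \<in> S \<Longrightarrow> g x \<le> g y"
      using continuous_attains_inf[OF S False continuous_on_subset[OF g]] by (auto simp: S_def)
    then have "g x \<noteq> 0" using imp[of x] e by (auto simp: S_def)
    then have gx: "g x > 0" using nn[of x] x(1) by (auto simp: S_def)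
    have "f y \<le> e" if "y \<in> K" "g y \<le> g x / 2" for y
    proof (rule ccontr)
      assume "\<not> f y \<le> e"
      then have "y \<in> S" using that(1) by (auto simp: S_def)
      then show False using x(2)[of y] that(2) gx by linarith
    qed
    then show ?thesis using gx by (intro exI[of _ "g x / 2"]) auto
  qed
qed

text \<open>The property must survive further thinning, because each new index replaces the
  subsequence found so far by a subsequence of it.\<close>

lemma finite_common_subseq:
  fixes P :: "'a \<Rightarrow> (nat \<Rightarrow> nat) \<Rightarrow> bool"
  assumes I: "finite I"
    and ex: "\<And>i (s :: nat \<Rightarrow> nat). i \<in> I \<Longrightarrow> strict_mono s \<Longrightarrow> \<exists>r :: nat \<Rightarrow> nat. strict_mono r \<and> P i (s \<circ>
        r)"
    and sub: "\<And>i (s :: nat \<Rightarrow> nat) (r :: nat \<Rightarrow> nat). P i s \<Longrightarrow> strict_mono r \<Longrightarrow> P i (s \<circ> r)"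
  shows "\<exists>s. strict_mono s \<and> (\<forall>i\<in>I. P i s)"
  using I ex
proof (induction I rule: finite_induct)
  case empty
  then show ?case using strict_mono_id by blast
next
  case (insert i I)
  then obtain s where s: "strict_mono s" "\<forall>j\<in>I. P j s" by auto
  obtain r where r: "strict_mono r" "P i (s \<circ> r)" using insert.prems[of i s] s(1) by blast
  have "P j (s \<circ> r)" if "j \<in> I" for j
    using sub[of j s r] s(2) that r(1) by blast
  then have "strict_mono (s \<circ> r) \<and> (\<forall>j\<in>insert i I. P j (s \<circ> r))"
    using s(1) r strict_mono_o by blast
  then show ?case by blast
qed

section \<open>Compensated compactness in measure\<close>

definition minor :: "real ^ 2 ^ 'm \<Rightarrow> 'm \<Rightarrow> 'm \<Rightarrow> real" where
  "minor M a b = M $ a $ 1 * M $ b $ 2 - M $ a $ 2 * M $ b $ 1"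

definition null_lag :: "('m::finite \<Rightarrow> 'm \<Rightarrow> real) \<Rightarrow> real ^ 2 ^ 'm \<Rightarrow> real" where
  "null_lag c M = (\<Sum>a\<in>UNIV. \<Sum>b\<in>UNIV. c a b * minor M a b)"

abbreviation pairs :: "(nat \<times> nat) filter" where
  "pairs \<equiv> sequentially \<times>\<^sub>F sequentially"

lemma borel_measurable_vec_nth [measurable (raw)]:
  fixes f :: "'a \<Rightarrow> 'b::euclidean_space ^ 'm"
  assumes "f \<in> borel_measurable M"
  shows "(\<lambda>x. f x $ i) \<in> borel_measurable M"
  by (rule measurable_compose[OF assms borel_measurable_continuous_onI]) (intro continuous_intros)

lemma continuous_on_minor [continuous_intros]:
  "continuous_on S f \<Longrightarrow> continuous_on S (\<lambda>x. minor (f x) a b)"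
  unfolding minor_def by (intro continuous_intros)

lemma continuous_on_null_lag [continuous_intros]:
  "continuous_on S f \<Longrightarrow> continuous_on S (\<lambda>x. null_lag c (f x))"
  unfolding null_lag_def by (intro continuous_intros)

lemma null_lag_measurable [measurable]: "null_lag c \<in> borel_measurable borel"
  by (intro borel_measurable_continuous_onI continuous_intros)

lemma minor_measurable [measurable]: "(\<lambda>M. minor M a b) \<in> borel_measurable borel"
  by (intro borel_measurable_continuous_onI continuous_intros)

lemma entry_le_norm: "\<bar>M $ a $ k\<bar> \<le> norm (M :: real ^ 'd ^ 'm)"
  by (rule order_trans[OF component_le_norm_cart Finite_Cartesian_Product.norm_nth_le])

lemma minor_le: "\<bar>minor M a b\<bar> \<le> 2 * (norm M)\<^sup>2"
proof -
  have "\<bar>minor M a b\<bar> \<le> \<bar>M $ a $ 1\<bar> * \<bar>M $ b $ 2\<bar> + \<bar>M $ a $ 2\<bar> * \<bar>M $ b $ 1\<bar>"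
    unfolding minor_def abs_mult[symmetric] by (rule abs_triangle_ineq4)
  also have "\<dots> \<le> norm M * norm M + norm M * norm M"
    by (intro add_mono mult_mono entry_le_norm) auto
  finally show ?thesis by (simp add: power2_eq_square)
qed

lemma null_lag_le:
  obtains L where "L \<ge> 0" "\<And>M. \<bar>null_lag c M\<bar> \<le> L * (norm M)\<^sup>2"
proof
  show "(\<Sum>a\<in>UNIV. \<Sum>b\<in>UNIV. \<bar>c a b\<bar> * 2) \<ge> 0" by (intro sum_nonneg) auto
  fix M
  have "\<bar>null_lag c M\<bar> \<le> (\<Sum>a\<in>UNIV. \<Sum>b\<in>UNIV. \<bar>c a b\<bar> * (2 * (norm M)\<^sup>2))"
    unfolding null_lag_def
    by (intro order_trans[OF sum_abs] sum_mono) (auto simp: abs_mult intro!: mult_left_mono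
        minor_le)
  then show "\<bar>null_lag c M\<bar> \<le> (\<Sum>a\<in>UNIV. \<Sum>b\<in>UNIV. \<bar>c a b\<bar> * 2) * (norm M)\<^sup>2"
    by (simp add: sum_distrib_right mult.assoc)
qed

lemma conv_meas_fst: "conv_meas N sequentially f \<Longrightarrow> conv_meas N pairs (\<lambda>z. f (fst z))"
  and conv_meas_snd: "conv_meas N sequentially f \<Longrightarrow> conv_meas N pairs (\<lambda>z. f (snd z))"
  unfolding conv_meas_def
  by (auto intro: filterlim_compose[OF _ filterlim_fst] filterlim_compose[OF _ filterlim_snd])

lemma conv_meas_pairs_subseq:
  assumes "conv_meas N pairs (\<lambda>z. f (fst z) (snd z))" "strict_mono r"
  shows "conv_meas N pairs (\<lambda>z. f (r (fst z)) (r (snd z)))"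
proof -
  have "filterlim (\<lambda>z. (r (fst z), r (snd z))) pairs pairs"
    by (intro filterlim_Pair filterlim_compose[OF filterlim_subseq[OF assms(2)]] filterlim_fst
        filterlim_snd)
  from filterlim_compose[OF _ this] show ?thesis
    using assms(1) unfolding conv_meas_def by fastforce
qed

text \<open>Borel representatives vanishing off \<open>\<Omega>\<close> let integrals over
  \<open>\<Omega>\<close> and over the whole space be exchanged freely. The weak equation stays
  restricted to test functions of \<open>\<Omega>\<close>, so the jump at the boundary does no
  harm.\<close>

locale sobolev_bounded =
  fixes \<Omega> :: "(real ^ 2) set" and p C :: real
    and U :: "nat \<Rightarrow> real ^ 2 \<Rightarrow> real ^ 'm" and G :: "nat \<Rightarrow> real ^ 2 \<Rightarrow> real ^ 2 ^ 'm"
  assumes opn: "open \<Omega>" and bdd: "bounded \<Omega>" and p: "2 < p"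
    and measU: "\<And>j. U j \<in> borel_measurable borel" and measG: "\<And>j. G j \<in> borel_measurable borel"
    and outU: "\<And>j x. x \<notin> \<Omega> \<Longrightarrow> U j x = 0" and outG: "\<And>j x. x \<notin> \<Omega> \<Longrightarrow> G j x = 0"
    and intU: "\<And>j. integrable lborel (\<lambda>x. norm (U j x) powr p)"
    and intG: "\<And>j. integrable lborel (\<lambda>x. norm (G j x) powr p)"
    and bndU: "\<And>j. (LINT x|lborel. norm (U j x) powr p) \<le> C"
    and bndG: "\<And>j. (LINT x|lborel. norm (G j x) powr p) \<le> C"
    and weak: "\<And>j i. weak_grad \<Omega> (\<lambda>x. U j x $ i) (\<lambda>k x. G j x $ i $ k)"
begin

declare measU[measurable] measG[measurable]

lemma \<Omega>_sets [measurable]: "\<Omega> \<in> sets borel" using opn by simp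

sublocale N: finite_measure "restrict_space lborel \<Omega>"
  by (rule finite_measure_restrict_lborel[OF bdd \<Omega>_sets])

abbreviation "N \<equiv> restrict_space lborel \<Omega>"

lemma space_N: "space N = \<Omega>" by (simp add: space_restrict_space)

lemma integrable_of_powr:
  fixes f :: "real ^ 2 \<Rightarrow> 'b::euclidean_space"
  assumes "f \<in> borel_measurable borel" "\<And>x. x \<notin> \<Omega> \<Longrightarrow> f x = 0" "integrable lborel (\<lambda>x. norm (f x) powr
      p)"
  shows "integrable lborel f"
proof -
  note [measurable] = assms(1)
  have "integrable N (\<lambda>x. norm (f x) powr 1)"
    by (rule N.integrable_powr_le[where p=p])
      (use p assms in \<open>auto intro!: measurable_restrict_lborel integrable_restrict_lborel\<close>)
  then have "integrable N (\<lambda>x. norm (f x))" by simp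
  then have "integrable N f"
    by (subst (asm) integrable_norm_iff) (auto intro!: measurable_restrict_lborel)
  then show ?thesis using restrict_lborel(1)[OF \<Omega>_sets, of f] assms(2) by simp
qed

lemma comp_powr:
  fixes f :: "real ^ 2 \<Rightarrow> real"
  assumes [measurable]: "f \<in> borel_measurable borel" and le: "\<And>x. \<bar>f x\<bar> \<le> norm (W x)"
    and W: "integrable lborel (\<lambda>x. norm (W x) powr p)"
  shows "integrable lborel (\<lambda>x. \<bar>f x\<bar> powr p)"
  by (rule Bochner_Integration.integrable_bound[OF W]) (use p in \<open>auto intro!: AE_I2 powr_mono2 le\<close>)

lemma comps:
  "integrable lborel (\<lambda>x. U j x $ i)" "integrable lborel (\<lambda>x. \<bar>U j x $ i\<bar> powr p)"
  "integrable lborel (\<lambda>x. G j x $ i $ k)" "integrable lborel (\<lambda>x. \<bar>G j x $ i $ k\<bar> powr p)"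
proof -
  show 1: "integrable lborel (\<lambda>x. \<bar>U j x $ i\<bar> powr p)"
    by (rule comp_powr[OF _ component_le_norm_cart intU]) measurable
  show 2: "integrable lborel (\<lambda>x. \<bar>G j x $ i $ k\<bar> powr p)"
    by (rule comp_powr[OF _ entry_le_norm intG]) measurable
  show "integrable lborel (\<lambda>x. U j x $ i)" by (rule integrable_of_powr) (use 1 outU in auto)
  show "integrable lborel (\<lambda>x. G j x $ i $ k)" by (rule integrable_of_powr) (use 2 outG in auto)
qed

lemma integrable_UG: "integrable lborel (U j)" "integrable lborel (G j)"
  by (rule integrable_of_powr; use outU outG intU intG in auto)+

lemma powr_diff:
  fixes W :: "nat \<Rightarrow> real ^ 2 \<Rightarrow> 'b::euclidean_space"
  assumes [measurable]: "\<And>j. W j \<in> borel_measurable borel" and out: "\<And>j x. x \<notin> \<Omega> \<Longrightarrow> W j x = 0"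
    and int: "\<And>j. integrable lborel (\<lambda>x. norm (W j x) powr p)" and bnd: "\<And>j. (LINT x|lborel. norm (W
        j x) powr p) \<le> C"
  shows "integrable N (\<lambda>x. norm (W j x - W k x) powr p)"
    "(LINT x|N. norm (W j x - W k x) powr p) \<le> 2 powr p * (C + C)"
proof -
  have le: "norm (W j x - W k x) powr p \<le> 2 powr p * (norm (W j x) powr p + norm (W k x) powr p)"
      for x
    using p by (intro norm_diff_powr_le) auto
  have intN: "integrable N (\<lambda>x. norm (W j x) powr p)" for j by (rule integrable_restrict_lborel[OF
      \<Omega>_sets int])
  have bndN: "(LINT x|N. norm (W j x) powr p) \<le> C" for j
    using bnd[of j] out p by (subst restrict_lborel(2)) auto
  note ib = integrable_mult_right[OF Bochner_Integration.integrable_add[OF intN[of j] intN[of k]],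
      of "2 powr p"]
  show i: "integrable N (\<lambda>x. norm (W j x - W k x) powr p)"
    by (rule Bochner_Integration.integrable_bound[OF ib]) (auto intro!: AE_I2 order_trans[OF le]
        measurable_restrict_lborel)
  have "(LINT x|N. norm (W j x - W k x) powr p) \<le> (LINT x|N. 2 powr p * (norm (W j x) powr p + norm
      (W k x) powr p))"
    by (rule integral_mono[OF i ib le])
  also have "\<dots> = 2 powr p * ((LINT x|N. norm (W j x) powr p) + (LINT x|N. norm (W k x) powr p))"
    by (simp add: Bochner_Integration.integral_add[OF intN intN])
  also have "\<dots> \<le> 2 powr p * (C + C)" by (intro mult_left_mono add_mono bndN) auto
  finally show "(LINT x|N. norm (W j x - W k x) powr p) \<le> 2 powr p * (C + C)" .
qed

lemma powr_diff_G:
  "integrable N (\<lambda>x. norm (G j x - G k x) powr p)"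
  "(LINT x|N. norm (G j x - G k x) powr p) \<le> 2 powr p * (C + C)"
  using powr_diff[of G, OF measG outG intG bndG] by blast+

lemma powr_diff_U:
  "integrable N (\<lambda>x. norm (U j x - U k x) powr p)"
  "(LINT x|N. norm (U j x - U k x) powr p) \<le> 2 powr p * (C + C)"
  using powr_diff[of U, OF measU outU intU bndU] by blast+

lemma powr_diff_comp:
  "integrable N (\<lambda>x. \<bar>U j x $ i - U k x $ i\<bar> powr p)"
  "(LINT x|N. \<bar>U j x $ i - U k x $ i\<bar> powr p) \<le> 2 powr p * (C + C)"
proof -
  have le: "\<bar>U j x $ i - U k x $ i\<bar> powr p \<le> norm (U j x - U k x) powr p" for x
    using p component_le_norm_cart[of "U j x - U k x" i] by (intro powr_mono2) auto
  show i: "integrable N (\<lambda>x. \<bar>U j x $ i - U k x $ i\<bar> powr p)"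
    by (rule Bochner_Integration.integrable_bound[OF powr_diff_U(1)]) (auto intro!: AE_I2 le
        measurable_restrict_lborel)
  show "(LINT x|N. \<bar>U j x $ i - U k x $ i\<bar> powr p) \<le> 2 powr p * (C + C)"
    by (rule order_trans[OF integral_mono[OF i powr_diff_U(1) le] powr_diff_U(2)])
qed

text \<open>The sets where a bump exceeds \<open>1/(k+1)\<close> form a countable cover of
  \<open>\<Omega>\<close>, so information tested only against compactly supported functions gives
  convergence in measure on all of \<open>\<Omega>\<close>.\<close>

lemma exhaust_test:
  assumes [measurable]: "\<And>i. f i \<in> borel_measurable N"
    and ex: "\<And>\<eta> c. \<eta> \<in> test_functions \<Omega> \<Longrightarrow> (\<And>x. 0 \<le> \<eta> x) \<Longrightarrow> (\<And>x. \<eta> x \<le> 1) \<Longrightarrow> 0 < c \<Longrightarrow>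
       conv_meas N F (\<lambda>i x. f i x * indicator {x\<in>space N. c < \<eta> x} x)"
  shows "conv_meas N F f"
proof -
  obtain a b :: "nat \<Rightarrow> real ^ 2" where ab: "\<And>n. cbox (a n) (b n) \<subseteq> \<Omega>" "\<Omega> = (\<Union>n. box (a n) (b n))"
    using open_countable_box_cover[OF opn] by metis
  define \<eta> where "\<eta> n = bump (a n) (b n)" for n
  have t: "\<eta> n \<in> test_functions \<Omega>" for n unfolding \<eta>_def by (rule bump_test[OF ab(1)])
  have m: "\<eta> n \<in> borel_measurable N" for n by (rule measurable_restrict_lborel[OF
      test_functions_measurable[OF t]])
  \<comment> \<open>Box number and level are coded in one index to match
    \<open>conv_meas_exhaust\<close>.\<close>
  define A where "A m = {x\<in>space N. inverse (real (Suc (snd (prod_decode m)))) < \<eta> (fst (prod_decode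
      m)) x}" for m
  show ?thesis
  proof (rule N.conv_meas_exhaust)
    show "A n \<in> sets N" for n unfolding A_def using m by measurable
    show "(\<Union>n. A n) = space N"
    proof (intro subset_antisym subsetI)
      fix x assume x: "x \<in> space N"
      then have "x \<in> \<Omega>" by (simp add: space_N)
      then obtain n where "x \<in> box (a n) (b n)" unfolding ab(2) by blast
      then have "0 < \<eta> n x" by (simp add: \<eta>_def bump_pos_iff)
      then obtain k where k: "inverse (real (Suc k)) < \<eta> n x" using reals_Archimedean by blast
      have "x \<in> A (prod_encode (n, k))" using k x by (simp add: A_def)
      then show "x \<in> (\<Union>n. A n)" by blast
    qed (auto simp: A_def)
    show "conv_meas N F (\<lambda>i x. f i x * indicator (A n) x)" for n
      unfolding A_def by (rule ex[OF t]) (auto simp: \<eta>_def bump_bounds)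
  qed simp
qed

text \<open>\<open>rellich\<close> gives compactness on each box whose closure lies in
  \<open>\<Omega>\<close>, and exhaustion makes it global in measure. The components are thinned
  jointly by \<open>finite_common_subseq\<close>.\<close>

lemma cauchy_in_measure_subseq:
  "\<exists>r. strict_mono r \<and> (\<forall>i. conv_meas N pairs (\<lambda>z x. \<bar>U (r (fst z)) x $ i - U (r (snd z)) x $ i\<bar>))"
proof -
  define P where "P i r = conv_meas N pairs (\<lambda>z x. \<bar>U (r (fst z)) x $ i - U (r (snd z)) x $ i\<bar>)" for
      i and r :: "nat \<Rightarrow> nat"
  have "\<exists>r. strict_mono r \<and> (\<forall>i\<in>UNIV. P i r)"
  proof (rule finite_common_subseq)
    show "P i (s \<circ> r)" if "P i s" "strict_mono r" for i s r
      using conv_meas_pairs_subseq[of N "\<lambda>j k x. \<bar>U (s j) x $ i - U (s k) x $ i\<bar>" r] that by (simp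
          add: P_def)
    fix i and s :: "nat \<Rightarrow> nat" assume s: "strict_mono s"
    \<comment> \<open>From \<open>t \<le> 1 + t^p\<close> on \<open>\<Omega>\<close>: a common
      \<open>L^1\<close> bound for all components of maps and gradients.\<close>
    define C1 where "C1 = measure lborel \<Omega> + C"
    have bnd1: "(LINT x|lborel. \<bar>f x\<bar>) \<le> C1"
      if f: "integrable lborel f" "integrable lborel (\<lambda>x. \<bar>f x\<bar> powr p)" "\<And>x. x \<notin> \<Omega> \<Longrightarrow> f x = 0"
        "(LINT x|lborel. \<bar>f x\<bar> powr p) \<le> C" for f :: "real^2 \<Rightarrow> real"
    proof -
      have i\<Omega>: "integrable lborel (indicator \<Omega> :: _ \<Rightarrow> real)"
        using emeasure_bounded_finite[OF bdd] by simp
      have "(LINT x|lborel. \<bar>f x\<bar>) \<le> (LINT x|lborel. indicator \<Omega> x + \<bar>f x\<bar> powr p)"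
      proof (rule integral_mono[OF integrable_abs[OF f(1)] Bochner_Integration.integrable_add[OF i\<Omega>
          f(2)]])
        fix x
        show "\<bar>f x\<bar> \<le> indicator \<Omega> x + \<bar>f x\<bar> powr p"
        proof (cases "\<bar>f x\<bar> \<le> 1")
          case True then show ?thesis using f(3)[of x] by (cases "x \<in> \<Omega>") (auto intro:
              add_increasing2)
        next
          case False
          then have "\<bar>f x\<bar> powr 1 \<le> \<bar>f x\<bar> powr p" using p by (intro powr_mono) auto
          then show ?thesis by (auto intro: add_increasing)
        qed
      qed
      also have "\<dots> = measure lborel \<Omega> + (LINT x|lborel. \<bar>f x\<bar> powr p)"
        by (simp add: Bochner_Integration.integral_add[OF i\<Omega> f(2)])
      also have "\<dots> \<le> C1" using f(4) by (simp add: C1_def)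
      finally show ?thesis .
    qed
    have b1: "(LINT x|lborel. \<bar>U j x $ i\<bar> powr p) \<le> C" for j
      by (rule order_trans[OF integral_mono[OF comps(2) intU] bndU]) (use p in \<open>auto intro!:
          powr_mono2 component_le_norm_cart\<close>)
    have b2: "(LINT x|lborel. \<bar>G j x $ i $ k\<bar> powr p) \<le> C" for j k
      by (rule order_trans[OF integral_mono[OF comps(4) intG] bndG]) (use p in \<open>auto intro!:
          powr_mono2 entry_le_norm\<close>)
    obtain r :: "nat \<Rightarrow> nat" where r: "strict_mono r"
      "\<And>K d e. K \<in> sets borel \<Longrightarrow> emeasure lborel K < \<infinity> \<Longrightarrow> d > 0 \<Longrightarrow> (\<And>x. x \<in> K \<Longrightarrow> cball x d \<subseteq> \<Omega>) \<Longrightarrow> e > 0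
          \<Longrightarrow>
       \<forall>\<^sub>F (j, k) in pairs. (LINT x|lborel. indicator K x * \<bar>U (s (r j)) x $ i - U (s (r k)) x $ i\<bar>)
           < e"
    proof (rule rellich[of "\<lambda>j x. U (s j) x $ i" "\<lambda>j k x. G (s j) x $ i $ k" \<Omega> C1])
      show "(LINT x|lborel. \<bar>U (s j) x $ i\<bar>) \<le> C1" for j
        by (rule bnd1[OF comps(1,2) _ b1]) (simp add: outU)
      show "(LINT x|lborel. \<bar>G (s j) x $ i $ k\<bar>) \<le> C1" for j k
        by (rule bnd1[OF comps(3,4) _ b2]) (simp add: outG)
    qed (auto intro: comps weak)
    obtain a b :: "nat \<Rightarrow> real ^ 2" where ab: "\<And>n. cbox (a n) (b n) \<subseteq> \<Omega>" "\<Omega> = (\<Union>n. box (a n) (b n))"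
      using open_countable_box_cover[OF opn] by metis
    let ?f = "\<lambda>z x. \<bar>U (s (r (fst z))) x $ i - U (s (r (snd z))) x $ i\<bar>"
    have "conv_meas N pairs ?f"
    proof (rule N.conv_meas_exhaust)
      show "?f z \<in> borel_measurable N" for z by (rule measurable_restrict_lborel) measurable
      show "box (a n) (b n) \<in> sets N" for n
        using ab box_subset_cbox by (subst sets_restrict_space_iff) auto
      show "(\<Union>n. box (a n) (b n)) = space N" unfolding space_N by (rule ab(2)[symmetric])
      fix n
      obtain d where d: "d > 0" "\<And>x. x \<in> cbox (a n) (b n) \<Longrightarrow> cball x d \<subseteq> \<Omega>"
        using compact_in_open_cball[OF compact_cbox opn ab(1)] by metis
      let ?K = "box (a n) (b n)"
      have K: "?K \<subseteq> \<Omega>" using ab(1) box_subset_cbox by blast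
      have eq: "(LINT x|N. ?f z x * indicator ?K x) = (LINT x|lborel. indicator ?K x * ?f z x)" for
          z
        using K by (subst restrict_lborel(2)) (auto simp: mult.commute indicator_def)
      have i1: "integrable lborel (?f z)" for z using comps(1) by (intro integrable_abs
          Bochner_Integration.integrable_diff)
      have i2: "integrable N (\<lambda>x. ?f z x * indicator ?K x)" for z
        using integrable_mult_indicator[OF _ i1[of z], of ?K] by (intro integrable_restrict_lborel)
            (auto simp: mult.commute)
      show "conv_meas N pairs (\<lambda>z x. ?f z x * indicator ?K x)"
      proof (rule N.conv_meas_markov[OF i2])
        show "((\<lambda>z. LINT x|N. ?f z x * indicator ?K x) \<longlongrightarrow> 0) pairs"
          unfolding eq
        proof (rule tendstoI)
          fix e :: real assume "0 < e"
          then have "\<forall>\<^sub>F (j, k) in pairs. (LINT x|lborel. indicator ?K x * \<bar>U (s (r j)) x $ i - U (s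
              (r k)) x $ i\<bar>) < e"
            using d box_subset_cbox[of "a n" "b n"] by (intro r(2)[of _ d] emeasure_bounded_finite)
                auto
          then show "\<forall>\<^sub>F z in pairs. dist (LINT x|lborel. indicator ?K x * ?f z x) 0 < e"
            by eventually_elim (auto simp: integral_nonneg_AE)
        qed
      qed auto
    qed
    then show "\<exists>r. strict_mono r \<and> P i (s \<circ> r)" using r(1) by (auto simp: P_def)
  qed simp
  then show ?thesis by (simp add: P_def)
qed

lemma subseq: "strict_mono (r :: nat \<Rightarrow> nat) \<Longrightarrow> sobolev_bounded \<Omega> p C (U \<circ> r) (G \<circ> r)"
  by unfold_locales (auto simp: opn bdd p outU outG intU intG bndU bndG weak)

end

section \<open>Minors along pairs of indices\<close>

locale sobolev_cauchy = sobolev_bounded +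
  assumes cauchy: "\<And>i. conv_meas N pairs (\<lambda>z x. \<bar>U (fst z) x $ i - U (snd z) x $ i\<bar>)"
begin

text \<open>\<open>weak_null_lagrangian\<close>, applied to differences, moves the derivative from
  row \<open>a\<close> to \<open>\<eta>\<close>. What remains is bounded by the integral of the
  difference of the \<open>a\<close>-th components times the norm of the gradient difference, and
  \<open>integral_product_tendsto_0\<close> applies because the first factor tends to 0 in
  measure.\<close>

lemma minor_limit:
  assumes \<eta>: "\<eta> \<in> test_functions \<Omega>"
  shows "integrable lborel (\<lambda>x. \<eta> x * minor (G j x - G k x) a b)"
    "((\<lambda>z. LINT x|N. \<eta> x * minor (G (fst z) x - G (snd z) x) a b) \<longlongrightarrow> 0) pairs"
proof -
  obtain B1 where B1: "B1 > 0" "\<And>x. \<bar>pd 1 \<eta> x\<bar> \<le> B1" using test_functions_bounded[OF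
      test_functions_pd[OF \<eta>]] by metis
  obtain B2 where B2: "B2 > 0" "\<And>x. \<bar>pd 2 \<eta> x\<bar> \<le> B2" using test_functions_bounded[OF
      test_functions_pd[OF \<eta>]] by metis
  obtain B0 where B0: "B0 > 0" "\<And>x. \<bar>\<eta> x\<bar> \<le> B0" using test_functions_bounded[OF \<eta>] by metis
  have [measurable]: "\<eta> \<in> borel_measurable borel" "pd i \<eta> \<in> borel_measurable borel" for i
    by (rule test_functions_measurable[OF \<eta>], rule test_functions_measurable[OF test_functions_pd[OF
        \<eta>]])
  let ?F = "\<lambda>z x. \<bar>U (fst z) x $ a - U (snd z) x $ a\<bar>"
  let ?H = "\<lambda>z x. norm (G (fst z) x - G (snd z) x)"
  have mF: "?F z \<in> borel_measurable N" "?H z \<in> borel_measurable N" for z :: "nat \<times> nat"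
  proof -
    show "?F z \<in> borel_measurable N" by (rule measurable_restrict_lborel) measurable
    show "?H z \<in> borel_measurable N" by (rule measurable_restrict_lborel) measurable
  qed
  have "((\<lambda>z. LINT x|N. ?F z x * ?H z x) \<longlongrightarrow> 0) pairs"
    by (rule N.integral_product_tendsto_0(2)[OF mF _ _ p powr_diff_comp(1) powr_diff_G(1)
        powr_diff_comp(2) powr_diff_G(2) cauchy]) auto
  then have lim: "((\<lambda>z. (B1 + B2) * (LINT x|N. ?F z x * ?H z x)) \<longlongrightarrow> 0) pairs" by (rule
      tendsto_mult_right_zero)
  have iFH: "integrable N (\<lambda>x. ?F z x * ?H z x)" for z :: "nat \<times> nat"
    by (rule N.integral_product_tendsto_0(1)[OF mF _ _ p powr_diff_comp(1) powr_diff_G(1)]) auto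
  have iHH: "integrable N (\<lambda>x. ?H z x * ?H z x)" for z :: "nat \<times> nat"
    by (rule N.integral_product_tendsto_0(1)[OF mF(2) mF(2) _ _ p powr_diff_G(1) powr_diff_G(1)])
        auto
  show "integrable lborel (\<lambda>x. \<eta> x * minor (G j x - G k x) a b)"
  proof -
    have "integrable N (\<lambda>x. \<eta> x * minor (G j x - G k x) a b)"
    proof (rule Bochner_Integration.integrable_bound[OF integrable_mult_right[OF iHH[of "(j, k)"],
        of "B0 * 2"]])
      show "(\<lambda>x. \<eta> x * minor (G j x - G k x) a b) \<in> borel_measurable N"
        by (rule measurable_restrict_lborel) measurable
      show "AE x in N. norm (\<eta> x * minor (G j x - G k x) a b) \<le> norm (B0 * 2 * (?H (j, k) x * ?H (j,
          k) x))"
      proof (rule AE_I2)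
        fix x
        have "norm (\<eta> x * minor (G j x - G k x) a b) \<le> B0 * (2 * (norm (G j x - G k x))\<^sup>2)"
          using B0 by (auto simp: abs_mult intro!: mult_mono minor_le)
        then show "norm (\<eta> x * minor (G j x - G k x) a b) \<le> norm (B0 * 2 * (?H (j, k) x * ?H (j, k)
            x))"
          using B0(1) by (simp add: abs_mult power2_eq_square mult.assoc)
      qed
    qed
    then show ?thesis using outG by (subst (asm) restrict_lborel(1)) (auto simp: minor_def)
  qed
  show "((\<lambda>z. LINT x|N. \<eta> x * minor (G (fst z) x - G (snd z) x) a b) \<longlongrightarrow> 0) pairs"
  proof (rule Lim_null_comparison[OF always_eventually[OF allI] lim])
    fix z :: "nat \<times> nat"
    obtain j k where z: "z = (j, k)" by (cases z)
    let ?u = "\<lambda>i x. U j x $ i - U k x $ i" and ?g = "\<lambda>i l x. G j x $ i $ l - G k x $ i $ l"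
    have w: "weak_grad \<Omega> (?u i) (?g i)" for i by (rule weak_grad_diff[OF weak weak comps(1) comps(1)
        comps(3) comps(3)])
    have iu: "integrable lborel (?u i)" and ig: "integrable lborel (?g i l)" for i l
      by (intro Bochner_Integration.integrable_diff comps)+
    have up: "integrable lborel (\<lambda>x. \<bar>?u i x\<bar> powr p)" for i
      using powr_diff_comp(1)[of j i k] p outU by (subst (asm) restrict_lborel(1)) auto
    have gp: "integrable lborel (\<lambda>x. \<bar>?g i l x\<bar> powr p)" for i l
    proof (rule comp_powr[where W="\<lambda>x. G j x - G k x"])
      show "\<bar>?g i l x\<bar> \<le> norm (G j x - G k x)" for x using entry_le_norm[of "G j x - G k x" i l] by
          simp
      show "integrable lborel (\<lambda>x. norm (G j x - G k x) powr p)"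
        using powr_diff_G(1)[where j=j and k=k] p outG by (subst (asm) restrict_lborel(1)) auto
    qed measurable
    have "(LINT x|N. \<eta> x * minor (G j x - G k x) a b) = (LINT x|lborel. \<eta> x * minor (G j x - G k x)
        a b)"
      using outG by (subst restrict_lborel(2)) (auto simp: minor_def)
    also have "\<dots> = (LINT x|lborel. \<eta> x * (?g a 1 x * ?g b 2 x - ?g a 2 x * ?g b 1 x))"
      by (simp add: minor_def)
    also have "\<dots> = - (LINT x|lborel. ?u a x * (pd 1 \<eta> x * ?g b 2 x - pd 2 \<eta> x * ?g b 1 x))"
      by (rule weak_null_lagrangian[OF opn bdd p \<eta> w iu up ig gp w ig gp])
    also have "(LINT x|lborel. ?u a x * (pd 1 \<eta> x * ?g b 2 x - pd 2 \<eta> x * ?g b 1 x)) =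
      (LINT x|N. ?u a x * (pd 1 \<eta> x * ?g b 2 x - pd 2 \<eta> x * ?g b 1 x))"
      using outU by (subst restrict_lborel(2)) auto
    finally have eq: "(LINT x|N. \<eta> x * minor (G j x - G k x) a b) =
      - (LINT x|N. ?u a x * (pd 1 \<eta> x * ?g b 2 x - pd 2 \<eta> x * ?g b 1 x))" .
    have "\<bar>LINT x|N. ?u a x * (pd 1 \<eta> x * ?g b 2 x - pd 2 \<eta> x * ?g b 1 x)\<bar> \<le>
       (LINT x|N. \<bar>?u a x * (pd 1 \<eta> x * ?g b 2 x - pd 2 \<eta> x * ?g b 1 x)\<bar>)" by (rule
           integral_abs_bound)
    also have "\<dots> \<le> (LINT x|N. (B1 + B2) * (?F z x * ?H z x))"
    proof (rule integral_mono_AE'[OF integrable_mult_right[OF iFH]])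
      show "AE x in N. \<bar>?u a x * (pd 1 \<eta> x * ?g b 2 x - pd 2 \<eta> x * ?g b 1 x)\<bar> \<le> (B1 + B2) * (?F z x
          * ?H z x)"
      proof (rule AE_I2)
        fix x
        have e: "\<bar>?g b l x\<bar> \<le> ?H z x" for l using entry_le_norm[of "G j x - G k x" b l] by (simp
            add: z)
        have "\<bar>pd 1 \<eta> x * ?g b 2 x - pd 2 \<eta> x * ?g b 1 x\<bar> \<le> \<bar>pd 1 \<eta> x\<bar> * \<bar>?g b 2 x\<bar> + \<bar>pd 2 \<eta> x\<bar> *
            \<bar>?g b 1 x\<bar>"
          unfolding abs_mult[symmetric] by (rule abs_triangle_ineq4)
        also have "\<dots> \<le> B1 * ?H z x + B2 * ?H z x"
          using B1 B2 by (intro add_mono mult_mono e) auto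
        finally have "\<bar>?u a x\<bar> * \<bar>pd 1 \<eta> x * ?g b 2 x - pd 2 \<eta> x * ?g b 1 x\<bar> \<le> \<bar>?u a x\<bar> * (B1 * ?H z
            x + B2 * ?H z x)"
          by (intro mult_left_mono) auto
        moreover have r: "(B1 + B2) * (?F z x * ?H z x) = \<bar>?u a x\<bar> * (B1 * ?H z x + B2 * ?H z x)"
          by (simp add: z algebra_simps)
        ultimately show "\<bar>?u a x * (pd 1 \<eta> x * ?g b 2 x - pd 2 \<eta> x * ?g b 1 x)\<bar> \<le> (B1 + B2) * (?F z
            x * ?H z x)"
          by (simp only: abs_mult r)
      qed
    qed (use B1 B2 in auto)
    finally show "norm (LINT x|N. \<eta> x * minor (G (fst z) x - G (snd z) x) a b) \<le> (B1 + B2) * (LINT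
        x|N. ?F z x * ?H z x)"
      using eq by (simp add: z)
  qed
qed

lemma null_lag_limit:
  assumes \<eta>: "\<eta> \<in> test_functions \<Omega>"
  shows "((\<lambda>z. LINT x|N. \<eta> x * null_lag c (G (fst z) x - G (snd z) x)) \<longlongrightarrow> 0) pairs"
proof -
  have i: "integrable N (\<lambda>x. c a b * (\<eta> x * minor (G j x - G k x) a b))" for j k a b
    by (intro integrable_mult_right integrable_restrict_lborel[OF \<Omega>_sets minor_limit(1)[OF \<eta>]])
  have "(LINT x|N. \<eta> x * null_lag c (G j x - G k x)) =
     (\<Sum>a\<in>UNIV. \<Sum>b\<in>UNIV. c a b * (LINT x|N. \<eta> x * minor (G j x - G k x) a b))" for j k
  proof -
    have "(LINT x|N. \<eta> x * null_lag c (G j x - G k x)) =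
       (LINT x|N. (\<Sum>a\<in>UNIV. \<Sum>b\<in>UNIV. c a b * (\<eta> x * minor (G j x - G k x) a b)))"
      by (simp add: null_lag_def sum_distrib_left mult.left_commute)
    also have "\<dots> = (\<Sum>a\<in>UNIV. \<Sum>b\<in>UNIV. LINT x|N. c a b * (\<eta> x * minor (G j x - G k x) a b))"
      by (simp only: Bochner_Integration.integral_sum Bochner_Integration.integrable_sum i)
    finally show ?thesis by simp
  qed
  moreover have "((\<lambda>z. \<Sum>a\<in>UNIV. \<Sum>b\<in>UNIV. c a b * (LINT x|N. \<eta> x * minor (G (fst z) x - G (snd z) x)
      a b)) \<longlongrightarrow> 0) pairs"
    by (intro tendsto_null_sum tendsto_mult_right_zero minor_limit(2)[OF \<eta>])
  ultimately show ?thesis by simp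
qed

text \<open>Here \<open>p > 2\<close> is decisive: quadratic growth bounds these expressions in the
  power \<open>p/2 > 1\<close>, as \<open>conv_meas_signed\<close> requires. Their integrals against
  test functions tend to 0 by \<open>null_lag_limit\<close>.\<close>

lemma null_lag_conv:
  assumes neg: "conv_meas N pairs (\<lambda>z x. - null_lag c (G (fst z) x - G (snd z) x))"
  shows "conv_meas N pairs (\<lambda>z x. \<bar>null_lag c (G (fst z) x - G (snd z) x)\<bar>)"
proof (rule exhaust_test)
  have m: "(\<lambda>x. null_lag c (G (fst z) x - G (snd z) x)) \<in> borel_measurable N" for z :: "nat \<times> nat"
    by (rule measurable_restrict_lborel) measurable
  then show "(\<lambda>x. \<bar>null_lag c (G (fst z) x - G (snd z) x)\<bar>) \<in> borel_measurable N" for z :: "nat \<times>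
      nat" by measurable
  obtain L where L: "L \<ge> 0" "\<And>M. \<bar>null_lag c M\<bar> \<le> L * (norm M)\<^sup>2" using null_lag_le by metis
  have le: "\<bar>null_lag c M\<bar> powr (p/2) \<le> L powr (p/2) * norm M powr p" for M
  proof -
    have "\<bar>null_lag c M\<bar> powr (p/2) \<le> (L * (norm M)\<^sup>2) powr (p/2)" using p L by (intro powr_mono2)
        auto
    also have "\<dots> = L powr (p/2) * norm M powr p"
      using L(1) by (simp add: powr_mult power2_eq_square powr_add[symmetric])
    finally show ?thesis .
  qed
  have ib: "integrable N (\<lambda>x. L powr (p/2) * norm (G (fst z) x - G (snd z) x) powr p)" for z :: "nat
      \<times> nat"
    by (intro integrable_mult_right powr_diff_G(1))
  have i: "integrable N (\<lambda>x. \<bar>null_lag c (G (fst z) x - G (snd z) x)\<bar> powr (p/2))" for z :: "nat \<times>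
      nat"
    by (rule Bochner_Integration.integrable_bound[OF ib]) (use m in \<open>auto intro!: AE_I2 le\<close>)
  have bnd: "(LINT x|N. \<bar>null_lag c (G (fst z) x - G (snd z) x)\<bar> powr (p/2)) \<le> L powr (p/2) * (2
      powr p * (C + C))" for z :: "nat \<times> nat"
  proof -
    have "(LINT x|N. \<bar>null_lag c (G (fst z) x - G (snd z) x)\<bar> powr (p/2)) \<le> (LINT x|N. L powr (p/2)
        * norm (G (fst z) x - G (snd z) x) powr p)"
      by (rule integral_mono[OF i ib le])
    also have "\<dots> \<le> L powr (p/2) * (2 powr p * (C + C))"
      using powr_diff_G(2)[where j="fst z" and k="snd z"] by (simp add: mult_left_mono)
    finally show ?thesis .
  qed
  fix \<eta> and e :: real assume \<eta>: "\<eta> \<in> test_functions \<Omega>" "\<And>x. 0 \<le> \<eta> x" "\<And>x. \<eta> x \<le> 1" and e: "0 < e"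
  show "conv_meas N pairs (\<lambda>z x. \<bar>null_lag c (G (fst z) x - G (snd z) x)\<bar> * indicator {x\<in>space N. e
      < \<eta> x} x)"
    by (rule N.conv_meas_signed[OF m measurable_restrict_lborel[OF test_functions_measurable[OF
        \<eta>(1)]] _ i bnd neg \<eta>(2,3) null_lag_limit[OF \<eta>(1)] e])
      (use p in auto)
qed

end

text \<open>The hypotheses are hierarchical: \<open>c2\<close> has a sign on those pairs where
  \<open>c1\<close> vanishes, and both together separate the points of \<open>S\<close>. This
  matches stacked matrices, where the matrix \<open>h\<close> is identified before
  \<open>X\<close>.\<close>

locale compact_inclusion = sobolev_cauchy \<Omega> p C U G
  for \<Omega> :: "(real ^ 2) set" and p C :: real
    and U :: "nat \<Rightarrow> real ^ 2 \<Rightarrow> real ^ 'm" and G :: "nat \<Rightarrow> real ^ 2 \<Rightarrow> real ^ 2 ^ 'm" +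
  fixes S :: "(real ^ 2 ^ 'm) set" and c1 c2 :: "'m \<Rightarrow> 'm \<Rightarrow> real"
  assumes S: "closed S" "S \<noteq> {}"
    and dist0: "\<And>\<eta>. \<eta> \<in> test_functions \<Omega> \<Longrightarrow> (\<lambda>j. LINT x|restrict_space lborel \<Omega>. infdist (G j x) S *
        \<eta> x) \<longlonglongrightarrow> 0"
    and alg1: "\<And>M1 M2. M1 \<in> S \<Longrightarrow> M2 \<in> S \<Longrightarrow> 0 \<le> null_lag c1 (M1 - M2)"
    and alg2: "\<And>M1 M2. M1 \<in> S \<Longrightarrow> M2 \<in> S \<Longrightarrow> null_lag c1 (M1 - M2) = 0 \<Longrightarrow> 0 \<le> null_lag c2 (M1 - M2)"
    and alg3: "\<And>M1 M2. M1 \<in> S \<Longrightarrow> M2 \<in> S \<Longrightarrow> null_lag c1 (M1 - M2) = 0 \<Longrightarrow> null_lag c2 (M1 - M2) = 0 \<Longrightarrow> M1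
        = M2"
begin

section \<open>Strong convergence under the differential inclusion\<close>

lemma infdist_measurable [measurable]: "(\<lambda>M. infdist M S) \<in> borel_measurable borel"
  by (intro borel_measurable_continuous_onI continuous_intros)

lemma integrable_N: "integrable N (U j)" "integrable N (G j)"
  by (intro integrable_restrict_lborel \<Omega>_sets integrable_UG)+

lemma meas_N: "U j \<in> borel_measurable N" "G j \<in> borel_measurable N"
  using measurable_restrict_lborel[OF measU] measurable_restrict_lborel[OF measG] by auto

lemma infdist_integrable: "integrable N (\<lambda>x. infdist (G j x) S)"
proof -
  obtain M where M: "M \<in> S" using S(2) by blast
  show ?thesis
  proof (rule Bochner_Integration.integrable_bound[where f="\<lambda>x. norm (G j x) + norm M"])
    show "AE x in N. norm (infdist (G j x) S) \<le> norm (norm (G j x) + norm M)"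
    proof (rule AE_I2)
      fix x
      have "infdist (G j x) S \<le> norm (G j x - M)" using infdist_le[OF M, of "G j x"] by (simp add:
          dist_norm)
      also have "\<dots> \<le> norm (G j x) + norm M" by (rule norm_triangle_ineq4)
      finally show "norm (infdist (G j x) S) \<le> norm (norm (G j x) + norm M)" by (simp add:
          infdist_nonneg)
    qed
  qed (use integrable_N in \<open>auto intro!: measurable_restrict_lborel\<close>)
qed

lemma infdist_conv: "conv_meas N sequentially (\<lambda>j x. infdist (G j x) S)"
proof (rule exhaust_test)
  show mi: "(\<lambda>x. infdist (G j x) S) \<in> borel_measurable N" for j
    by (rule measurable_restrict_lborel) measurable
  fix \<eta> and c :: real assume \<eta>: "\<eta> \<in> test_functions \<Omega>" "\<And>x. 0 \<le> \<eta> x" "\<And>x. \<eta> x \<le> 1" and c: "0 < c"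
  have m\<eta>: "\<eta> \<in> borel_measurable N" by (rule measurable_restrict_lborel[OF
      test_functions_measurable[OF \<eta>(1)]])
  have i: "integrable N (\<lambda>x. (1/c) * (\<eta> x * infdist (G j x) S))" for j
    using \<eta>(2,3) by (intro integrable_mult_right integrable_bounded_mult[OF m\<eta> _ infdist_integrable,
        of 1]) auto
  have "(\<lambda>j. (1/c) * (LINT x|N. infdist (G j x) S * \<eta> x)) \<longlonglongrightarrow> 0"
    by (rule tendsto_mult_right_zero[OF dist0[OF \<eta>(1)]])
  then have "(\<lambda>j. LINT x|N. (1/c) * (\<eta> x * infdist (G j x) S)) \<longlonglongrightarrow> 0"
    by (simp only: integral_mult_right_zero mult.commute[of "\<eta> _"])
  then have cm: "conv_meas N sequentially (\<lambda>j x. (1/c) * (\<eta> x * infdist (G j x) S))"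
    using \<eta>(2) c by (intro N.conv_meas_markov i) (auto simp: infdist_nonneg)
  show "conv_meas N sequentially (\<lambda>j x. infdist (G j x) S * indicator {x\<in>space N. c < \<eta> x} x)"
  proof (rule N.conv_meas_mono[OF _ _ cm])
    show "(\<lambda>x. infdist (G j x) S * indicator {x\<in>space N. c < \<eta> x} x) \<in> borel_measurable N" for j
      using mi m\<eta> by measurable
    show "(\<lambda>x. (1/c) * (\<eta> x * infdist (G j x) S)) \<in> borel_measurable N" for j
      using mi m\<eta> by measurable
    fix j x assume "x \<in> space N"
    show "infdist (G j x) S * indicator {x\<in>space N. c < \<eta> x} x \<le> (1/c) * (\<eta> x * infdist (G j x) S)"
    proof (cases "c < \<eta> x")
      case True
      then have "1 * infdist (G j x) S \<le> (\<eta> x / c) * infdist (G j x) S"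
        using c by (intro mult_right_mono infdist_nonneg) auto
      then show ?thesis using True \<open>x \<in> space N\<close> by simp
    next
      case False
      then show ?thesis using c \<eta>(2)[of x] by (simp add: infdist_nonneg)
    qed
  qed
qed

text \<open>A bridge from exact to approximate statements: \<open>imp\<close> speaks of zeros of
  \<open>g\<close>, \<open>compact_soft_implication\<close> makes it uniform on a ball of matrices,
  and \<open>conv_meas_soft\<close> with \<open>p\<close>-th powers as weight controls the points
  where the gradients leave the ball.\<close>

lemma soft_conv:
  fixes f g :: "(real ^ 2 ^ 'm) \<times> (real ^ 2 ^ 'm) \<Rightarrow> real"
  assumes f: "continuous_on UNIV f" and g: "continuous_on UNIV g" and nn: "\<And>M. 0 \<le> g M"
    and imp: "\<And>M. g M = 0 \<Longrightarrow> f M \<le> 0"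
    and conv: "conv_meas N pairs (\<lambda>z x. g (G (fst z) x, G (snd z) x))"
  shows "conv_meas N pairs (\<lambda>z x. f (G (fst z) x, G (snd z) x))"
proof (rule N.conv_meas_soft[OF _ _ conv])
  have [measurable]: "f \<in> borel_measurable (borel \<Otimes>\<^sub>M borel)" "g \<in> borel_measurable (borel \<Otimes>\<^sub>M
      borel)"
    using f g by (auto simp: borel_prod intro: borel_measurable_continuous_onI)
  show "(\<lambda>x. f (G (fst z) x, G (snd z) x)) \<in> borel_measurable N" for z :: "nat \<times> nat"
    by (rule measurable_restrict_lborel) measurable
  show "(\<lambda>x. g (G (fst z) x, G (snd z) x)) \<in> borel_measurable N" for z :: "nat \<times> nat"
    by (rule measurable_restrict_lborel) measurable
  let ?b = "\<lambda>z x. norm (G (fst z) x) powr p + norm (G (snd z) x) powr p"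
  have intN: "integrable N (\<lambda>x. norm (G j x) powr p)" for j by (rule integrable_restrict_lborel[OF
      \<Omega>_sets intG])
  have bndN: "(LINT x|N. norm (G j x) powr p) \<le> C" for j
    using bndG[of j] outG p by (subst restrict_lborel(2)) auto
  show "integrable N (?b z)" for z :: "nat \<times> nat" by (intro Bochner_Integration.integrable_add intN)
  show "(LINT x|N. ?b z x) \<le> C + C" for z :: "nat \<times> nat"
    unfolding Bochner_Integration.integral_add[OF intN intN] by (intro add_mono bndN)
  fix R e :: real assume e: "0 < e"
  \<comment> \<open>The bound \<open>norm M powr p \<le> R\<close> confines \<open>M\<close> to the
    ball of this radius; \<open>max\<close> covers negative \<open>R\<close>.\<close>
  define \<rho> where "\<rho> = max R 0 powr (1/p)"
  define K :: "((real ^ 2 ^ 'm) \<times> (real ^ 2 ^ 'm)) set" where "K = cball 0 \<rho> \<times> cball 0 \<rho>"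
  have K: "compact K" unfolding K_def by (intro compact_Times compact_cball)
  have "\<exists>d>0. \<forall>M\<in>K. g M \<le> d \<longrightarrow> f M \<le> e"
    by (rule compact_soft_implication[OF K continuous_on_subset[OF f] continuous_on_subset[OF g] nn
        imp e]) auto
  then obtain d where d: "d > 0" "\<And>M. M \<in> K \<Longrightarrow> g M \<le> d \<Longrightarrow> f M \<le> e" by blast
  have inK: "norm M \<le> \<rho>" if "norm M powr p \<le> R" for M :: "real ^ 2 ^ 'm"
  proof -
    have "norm M = (norm M powr p) powr (1/p)" using p by (simp add: powr_powr)
    also have "\<dots> \<le> \<rho>" unfolding \<rho>_def using that p by (intro powr_mono2) auto
    finally show ?thesis .
  qed
  have "f (G j x, G k x) \<le> e" if b: "norm (G j x) powr p + norm (G k x) powr p \<le> R" and g: "g (G j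
      x, G k x) \<le> d" for j k x
  proof (rule d(2)[OF _ g])
    have "norm (G j x) powr p \<le> R" "norm (G k x) powr p \<le> R"
      using b powr_ge_zero[of "norm (G j x)" p] powr_ge_zero[of "norm (G k x)" p] by linarith+
    then show "(G j x, G k x) \<in> K" by (auto simp: K_def intro: inK)
  qed
  then show "\<exists>d>0. \<forall>z. \<forall>x\<in>space N. ?b z x \<le> R \<longrightarrow> g (G (fst z) x, G (snd z) x) \<le> d \<longrightarrow> f (G (fst z) x, G
      (snd z) x) \<le> e"
    using d(1) by blast
qed auto

text \<open>Smallness is handed on in a chain: distance to \<open>S\<close>, negative part of
  \<open>c1\<close>, all of \<open>c1\<close>, negative part of \<open>c2\<close>, all of
  \<open>c2\<close>, difference of gradients. Each passage from a negative part to an absolute value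
  is \<open>null_lag_conv\<close>, each other one \<open>soft_conv\<close>.\<close>

lemma gradient_conv: "conv_meas N pairs (\<lambda>z x. norm (G (fst z) x - G (snd z) x))"
proof -
  define d where "d M = max (infdist (fst M) S) (infdist (snd M) S)" for M
  define n1 where "n1 M = \<bar>null_lag c1 (fst M - snd M)\<bar>" for M
  define n2 where "n2 M = \<bar>null_lag c2 (fst M - snd M)\<bar>" for M
  have cd: "continuous_on UNIV d" and cn1: "continuous_on UNIV n1" and cn2: "continuous_on UNIV n2"
    unfolding d_def[abs_def] n1_def[abs_def] n2_def[abs_def] by (intro continuous_intros)+
  have d_nn: "0 \<le> d M" for M by (simp add: d_def infdist_nonneg le_max_iff_disj)
  have dS: "fst M \<in> S" "snd M \<in> S" if "d M = 0" for M
  proof -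
    have "infdist (fst M) S \<le> 0" "infdist (snd M) S \<le> 0" using that unfolding d_def by (auto simp:
        max_def split: if_splits)
    then have "infdist (fst M) S = 0" "infdist (snd M) S = 0" using infdist_nonneg by (auto intro:
        antisym)
    then show "fst M \<in> S" "snd M \<in> S" using in_closed_iff_infdist_zero[OF S] by auto
  qed
  have meas2: "(\<lambda>x. F (G (fst z) x, G (snd z) x)) \<in> borel_measurable N"
    if "continuous_on UNIV F" for F :: "_ \<Rightarrow> real" and z :: "nat \<times> nat"
  proof -
    have [measurable]: "F \<in> borel_measurable (borel \<Otimes>\<^sub>M borel)"
      using that by (auto simp: borel_prod intro: borel_measurable_continuous_onI)
    show ?thesis by (rule measurable_restrict_lborel) measurable
  qed
  have mi: "(\<lambda>x. infdist (G j x) S) \<in> borel_measurable N" for j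
    by (rule measurable_restrict_lborel) measurable
  have conv_d: "conv_meas N pairs (\<lambda>z x. d (G (fst z) x, G (snd z) x))"
    unfolding d_def fst_conv snd_conv
    by (rule N.conv_meas_max[OF mi mi conv_meas_fst[OF infdist_conv] conv_meas_snd[OF
        infdist_conv]])
  have "conv_meas N pairs (\<lambda>z x. (\<lambda>M. - null_lag c1 (fst M - snd M)) (G (fst z) x, G (snd z) x))"
    by (rule soft_conv[OF _ cd d_nn _ conv_d]) (use alg1 dS in \<open>auto intro!: continuous_intros\<close>)
  then have conv1: "conv_meas N pairs (\<lambda>z x. n1 (G (fst z) x, G (snd z) x))"
    unfolding n1_def fst_conv snd_conv by (rule null_lag_conv)
  \<comment> \<open>A maximum of nonnegative functions vanishes exactly where all of them do, so it
    packs a conjunction of conditions into the single control function of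
    \<open>soft_conv\<close>.\<close>
  have conv_d1: "conv_meas N pairs (\<lambda>z x. max (d (G (fst z) x, G (snd z) x)) (n1 (G (fst z) x, G
      (snd z) x)))"
    by (rule N.conv_meas_max[OF meas2[OF cd] meas2[OF cn1] conv_d conv1])
  have d1: "d M = 0" "n1 M = 0" if "max (d M) (n1 M) = 0" for M
    using that d_nn[of M] by (auto simp: n1_def max_def split: if_splits)
  have "conv_meas N pairs (\<lambda>z x. (\<lambda>M. - null_lag c2 (fst M - snd M)) (G (fst z) x, G (snd z) x))"
  proof (rule soft_conv[OF _ _ _ _ conv_d1])
    fix M :: "(real ^ 2 ^ 'm) \<times> (real ^ 2 ^ 'm)" assume "max (d M) (n1 M) = 0"
    from d1[OF this] show "- null_lag c2 (fst M - snd M) \<le> 0" using alg2 dS by (simp add: n1_def)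
  qed (use d_nn in \<open>auto intro!: continuous_intros cd cn1 simp: le_max_iff_disj\<close>)
  then have conv2: "conv_meas N pairs (\<lambda>z x. n2 (G (fst z) x, G (snd z) x))"
    unfolding n2_def fst_conv snd_conv by (rule null_lag_conv)
  have conv_d2: "conv_meas N pairs (\<lambda>z x. max (max (d (G (fst z) x, G (snd z) x)) (n1 (G (fst z) x,
      G (snd z) x))) (n2 (G (fst z) x, G (snd z) x)))"
    by (intro N.conv_meas_max borel_measurable_max meas2 cd cn1 cn2 conv_d conv1 conv2)
  have "conv_meas N pairs (\<lambda>z x. (\<lambda>M. norm (fst M - snd M)) (G (fst z) x, G (snd z) x))"
  proof (rule soft_conv[OF _ _ _ _ conv_d2])
    fix M :: "(real ^ 2 ^ 'm) \<times> (real ^ 2 ^ 'm)" assume m: "max (max (d M) (n1 M)) (n2 M) = 0"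
    then have "n2 M = 0" "max (d M) (n1 M) = 0"
      using d_nn[of M] by (auto simp: n1_def n2_def max_def split: if_splits)
    with d1[of M] have "fst M = snd M" using alg3 dS by (simp add: n1_def n2_def)
    then show "norm (fst M - snd M) \<le> 0" by simp
  qed (use d_nn in \<open>auto intro!: continuous_intros cd cn1 cn2 simp: le_max_iff_disj\<close>)
  then show ?thesis by simp
qed

text \<open>Maps and gradients are combined into pairs so that one subsequence makes both converge
  almost everywhere.\<close>

lemma L1_Cauchy:
  "((\<lambda>(j, k). LINT x|N. norm ((U j x, G j x) - (U k x, G k x))) \<longlongrightarrow> 0) pairs"
proof -
  have mG: "(\<lambda>x. norm (G (fst z) x - G (snd z) x)) \<in> borel_measurable N" for z :: "nat \<times> nat"
    by (rule measurable_restrict_lborel) measurable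
  have mU: "(\<lambda>x. \<bar>U (fst z) x $ i - U (snd z) x $ i\<bar>) \<in> borel_measurable N" for z :: "nat \<times> nat" and
      i
    by (rule measurable_restrict_lborel) measurable
  have "((\<lambda>z. LINT x|N. norm (G (fst z) x - G (snd z) x) powr 1) \<longlongrightarrow> 0) pairs"
    by (rule N.conv_meas_vitali[OF mG _ _ _ powr_diff_G(1) powr_diff_G(2) gradient_conv]) (use p in
        auto)
  then have lG: "((\<lambda>z. LINT x|N. norm (G (fst z) x - G (snd z) x)) \<longlongrightarrow> 0) pairs" by simp
  have "((\<lambda>z. LINT x|N. \<bar>U (fst z) x $ i - U (snd z) x $ i\<bar> powr 1) \<longlongrightarrow> 0) pairs" for i
    by (rule N.conv_meas_vitali[OF mU _ _ _ powr_diff_comp(1) powr_diff_comp(2) cauchy]) (use p in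
        auto)
  then have lU: "((\<lambda>z. LINT x|N. \<bar>U (fst z) x $ i - U (snd z) x $ i\<bar>) \<longlongrightarrow> 0) pairs" for i by simp
  have lim: "((\<lambda>z. (\<Sum>i\<in>UNIV. LINT x|N. \<bar>U (fst z) x $ i - U (snd z) x $ i\<bar>) + (LINT x|N. norm (G
      (fst z) x - G (snd z) x))) \<longlongrightarrow> 0) pairs"
    using tendsto_add[OF tendsto_null_sum[OF lU] lG] by simp
  have iU: "integrable N (\<lambda>x. \<bar>U (fst z) x $ i - U (snd z) x $ i\<bar>)" for z :: "nat \<times> nat" and i
    by (intro integrable_restrict_lborel[OF \<Omega>_sets] integrable_abs
        Bochner_Integration.integrable_diff comps)
  have iG: "integrable N (\<lambda>x. norm (G (fst z) x - G (snd z) x))" for z :: "nat \<times> nat"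
    using integrable_N by (intro integrable_norm Bochner_Integration.integrable_diff)
  have iS: "integrable N (\<lambda>x. \<Sum>i\<in>UNIV. \<bar>U (fst z) x $ i - U (snd z) x $ i\<bar>)" for z :: "nat \<times> nat"
    by (intro Bochner_Integration.integrable_sum iU)
  show ?thesis
  proof (rule Lim_null_comparison[OF always_eventually[OF allI] lim])
    fix z :: "nat \<times> nat"
    obtain j k where z: "z = (j, k)" by (cases z)
    have le: "norm ((U j x, G j x) - (U k x, G k x)) \<le> (\<Sum>i\<in>UNIV. \<bar>U j x $ i - U k x $ i\<bar>) + norm (G
        j x - G k x)" for x
    proof -
      have "norm ((U j x, G j x) - (U k x, G k x)) \<le> norm (U j x - U k x) + norm (G j x - G k x)"
        using norm_Pair_le[of "U j x - U k x" "G j x - G k x"] by simp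
      then show ?thesis using norm_le_l1_cart[of "U j x - U k x"] by simp
    qed
    have "(LINT x|N. norm ((U j x, G j x) - (U k x, G k x))) \<le> (LINT x|N. (\<Sum>i\<in>UNIV. \<bar>U j x $ i - U k
        x $ i\<bar>) + norm (G j x - G k x))"
      by (rule integral_mono_AE'[OF Bochner_Integration.integrable_add[OF iS[of "(j,k)", simplified]
          iG[of "(j,k)", simplified]] AE_I2[OF le]])
        (auto intro!: AE_I2 add_nonneg_nonneg sum_nonneg)
    also have "\<dots> = (\<Sum>i\<in>UNIV. LINT x|N. \<bar>U j x $ i - U k x $ i\<bar>) + (LINT x|N. norm (G j x - G k x))"
      using iS[of "(j,k)"] iG[of "(j,k)"] iU[of "(j,k)"] by (simp add:
          Bochner_Integration.integral_add Bochner_Integration.integral_sum)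
    finally show "norm (case z of (j, k) \<Rightarrow> LINT x|N. norm ((U j x, G j x) - (U k x, G k x)))
       \<le> (\<Sum>i\<in>UNIV. LINT x|N. \<bar>U (fst z) x $ i - U (snd z) x $ i\<bar>) + (LINT x|N. norm (G (fst z) x - G
           (snd z) x))"
      by (simp add: z integral_nonneg_AE)
  qed
qed

text \<open>The Cauchy property yields an almost everywhere limit of the pairs of map and gradient.
  \<open>AE_limit_Lp\<close> adds integrability and strong convergence; the weak equation then
  passes to the limit by \<open>L^1\<close> convergence and the inclusion by Fatou's lemma.\<close>

lemma strong_limit:
  "\<exists>r V H. strict_mono (r :: nat \<Rightarrow> nat) \<and> V \<in> borel_measurable borel \<and> H \<in> borel_measurable borel \<and>
     (\<forall>x. x \<notin> \<Omega> \<longrightarrow> V x = 0) \<and> (\<forall>x. x \<notin> \<Omega> \<longrightarrow> H x = 0) \<and>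
     integrable N (\<lambda>x. norm (V x) powr p) \<and> integrable N (\<lambda>x. norm (H x) powr p) \<and>
     (\<forall>q. 1 \<le> q \<and> q < p \<longrightarrow> (\<lambda>n. LINT x|N. norm (U (r n) x - V x) powr q) \<longlonglongrightarrow> 0) \<and>
     (\<forall>q. 1 \<le> q \<and> q < p \<longrightarrow> (\<lambda>n. LINT x|N. norm (G (r n) x - H x) powr q) \<longlonglongrightarrow> 0) \<and>
     (\<forall>i. weak_grad \<Omega> (\<lambda>x. V x $ i) (\<lambda>k x. H x $ i $ k)) \<and>
     (AE x in N. H x \<in> S)"
proof -
  have iW: "integrable N (\<lambda>x. (U j x, G j x))" for j
    by (rule Bochner_Integration.integrable_bound[where f="\<lambda>x. norm (U j x) + norm (G j x)"])
      (use integrable_N norm_Pair_le meas_N in \<open>auto intro!: AE_I2 order_trans[OF norm_Pair_le]\<close>)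
  obtain r :: "nat \<Rightarrow> nat" where r: "strict_mono r" "AE x in N. convergent (\<lambda>n. (U (r n) x, G (r n)
      x))"
    using N.Cauchy_L1_AE_subseq[OF iW L1_Cauchy] by blast
  define V where "V x = lim (\<lambda>n. U (r n) x)" for x
  define H where "H x = lim (\<lambda>n. G (r n) x)" for x
  have mV[measurable]: "V \<in> borel_measurable borel" unfolding V_def[abs_def] by (rule
      borel_measurable_lim_metric) simp
  have mH[measurable]: "H \<in> borel_measurable borel" unfolding H_def[abs_def] by (rule
      borel_measurable_lim_metric) simp
  have out: "V x = 0" "H x = 0" if "x \<notin> \<Omega>" for x using that by (simp_all add: V_def H_def outU outG)
  have aeV: "AE x in N. (\<lambda>n. U (r n) x) \<longlonglongrightarrow> V x" and aeH: "AE x in N. (\<lambda>n. G (r n) x) \<longlonglongrightarrow> H x"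
  proof -
    have "convergent (\<lambda>n. U (r n) x)" "convergent (\<lambda>n. G (r n) x)" if "convergent (\<lambda>n. (U (r n) x, G
        (r n) x))" for x
    proof -
      from that obtain L where L: "(\<lambda>n. (U (r n) x, G (r n) x)) \<longlonglongrightarrow> L" by (auto simp: convergent_def)
      show "convergent (\<lambda>n. U (r n) x)" using tendsto_fst[OF L] by (auto simp: convergent_def)
      show "convergent (\<lambda>n. G (r n) x)" using tendsto_snd[OF L] by (auto simp: convergent_def)
    qed
    then show "AE x in N. (\<lambda>n. U (r n) x) \<longlonglongrightarrow> V x" "AE x in N. (\<lambda>n. G (r n) x) \<longlonglongrightarrow> H x"
      using r(2) by (auto simp: V_def H_def convergent_LIMSEQ_iff elim!: eventually_mono)
  qed
  have bN: "(LINT x|N. norm (U j x) powr p) \<le> C" "(LINT x|N. norm (G j x) powr p) \<le> C" for j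
    using bndU[of j] bndG[of j] outU outG p by (subst restrict_lborel(2); auto)+
  have iN: "integrable N (\<lambda>x. norm (U j x) powr p)" "integrable N (\<lambda>x. norm (G j x) powr p)" for j
    by (intro integrable_restrict_lborel[OF \<Omega>_sets] intU intG)+
  have p1: "1 < p" using p by simp
  note LV = N.AE_limit_Lp[OF meas_N(1) measurable_restrict_lborel[OF mV] iN(1) bN(1) p1 aeV]
  note LH = N.AE_limit_Lp[OF meas_N(2) measurable_restrict_lborel[OF mH] iN(2) bN(2) p1 aeH]
  have z: "norm (V x) powr p = 0" "norm (H x) powr p = 0" if "x \<notin> \<Omega>" for x using out[OF that] by
      simp_all
  have "integrable lborel (\<lambda>x. norm (V x) powr p)"
    by (rule iffD1[OF restrict_lborel(1)[OF \<Omega>_sets] LV(1)]) (rule z(1))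
  moreover have "integrable lborel (\<lambda>x. norm (H x) powr p)"
    by (rule iffD1[OF restrict_lborel(1)[OF \<Omega>_sets] LH(1)]) (rule z(2))
  ultimately have intV: "integrable lborel V" and intH: "integrable lborel H"
    by (auto intro: integrable_of_powr mV mH out)
  \<comment> \<open>Pairing with a bounded test function is continuous under \<open>L^1\<close>
    convergence; this carries both sides of the weak equation to the limit.\<close>
  have pass: "(\<lambda>n. LINT x|lborel. f n x * \<psi> x) \<longlonglongrightarrow> (LINT x|lborel. g x * \<psi> x)"
    if \<psi>: "\<psi> \<in> test_functions \<Omega>" and i: "\<And>n. integrable lborel (f n)" "integrable lborel g"
      and le: "\<And>n x. \<bar>f n x - g x\<bar> \<le> D n x" and D: "\<And>n. integrable N (D n)" "(\<lambda>n. LINT x|N. D n x) \<longlonglongrightarrow>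
          0"
    for \<psi> g :: "real ^ 2 \<Rightarrow> real" and f D
  proof -
    obtain B where B: "B > 0" "\<And>x. \<bar>\<psi> x\<bar> \<le> B" using test_functions_bounded[OF \<psi>] by metis
    note i1 = test_mult_integrable[OF \<psi> i(1)] and i2 = test_mult_integrable[OF \<psi> i(2)]
    show ?thesis
    proof (rule Lim_null[THEN iffD2], rule Lim_null_comparison[OF always_eventually[OF allI]])
      show "(\<lambda>n. B * (LINT x|N. D n x)) \<longlonglongrightarrow> 0" by (rule tendsto_mult_right_zero[OF D(2)])
      fix n
      have "(LINT x|lborel. f n x * \<psi> x) - (LINT x|lborel. g x * \<psi> x) = (LINT x|lborel. \<psi> x * f n x
          - \<psi> x * g x)"
        unfolding Bochner_Integration.integral_diff[OF i1 i2] by (simp add: mult.commute)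
      also have "\<dots> = (LINT x|N. \<psi> x * f n x - \<psi> x * g x)"
        by (rule restrict_lborel(2)[OF \<Omega>_sets, symmetric]) (simp add: test_functionsD(6)[OF \<psi>])
      finally have eq: "(LINT x|lborel. f n x * \<psi> x) - (LINT x|lborel. g x * \<psi> x) = (LINT x|N. \<psi> x *
          f n x - \<psi> x * g x)" .
      have "\<bar>LINT x|N. \<psi> x * f n x - \<psi> x * g x\<bar> \<le> (LINT x|N. \<bar>\<psi> x * f n x - \<psi> x * g x\<bar>)" by (rule
          integral_abs_bound)
      also have "\<dots> \<le> (LINT x|N. B * D n x)"
      proof (rule integral_mono[OF _ integrable_mult_right[OF D(1)]])
        show "integrable N (\<lambda>x. \<bar>\<psi> x * f n x - \<psi> x * g x\<bar>)"
          by (intro integrable_restrict_lborel[OF \<Omega>_sets] integrable_abs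
              Bochner_Integration.integrable_diff i1 i2)
        fix x
        show "\<bar>\<psi> x * f n x - \<psi> x * g x\<bar> \<le> B * D n x"
          unfolding right_diff_distrib[symmetric] abs_mult using B le[of n x] by (intro mult_mono)
              auto
      qed
      finally show "norm ((LINT x|lborel. f n x * \<psi> x) - (LINT x|lborel. g x * \<psi> x)) \<le> B * (LINT
          x|N. D n x)"
        unfolding eq by simp
    qed
  qed
  have iVN: "integrable N (\<lambda>x. norm (U j x - V x))" and iHN: "integrable N (\<lambda>x. norm (G j x - H x))"
      for j
    by (intro integrable_norm Bochner_Integration.integrable_diff integrable_N
        integrable_restrict_lborel[OF \<Omega>_sets] intV intH)+
  have L1V: "(\<lambda>n. LINT x|N. norm (U (r n) x - V x)) \<longlonglongrightarrow> 0" using LV(2)[of 1] p by simp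
  have L1H: "(\<lambda>n. LINT x|N. norm (G (r n) x - H x)) \<longlonglongrightarrow> 0" using LH(2)[of 1] p by simp
  have icomp: "integrable lborel (\<lambda>x. V x $ i)" "integrable lborel (\<lambda>x. H x $ i $ k)" for i k
  proof -
    show "integrable lborel (\<lambda>x. V x $ i)"
      by (rule Bochner_Integration.integrable_bound[OF intV]) (auto intro!: AE_I2
          component_le_norm_cart)
    show "integrable lborel (\<lambda>x. H x $ i $ k)"
      by (rule Bochner_Integration.integrable_bound[OF intH]) (auto intro!: AE_I2 entry_le_norm)
  qed
  have "weak_grad \<Omega> (\<lambda>x. V x $ i) (\<lambda>k x. H x $ i $ k)" for i
    unfolding weak_grad_def
  proof (intro ballI allI)
    fix \<phi> k assume \<phi>: "\<phi> \<in> test_functions \<Omega>"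
    have 1: "(\<lambda>n. LINT x|lborel. U (r n) x $ i * pd k \<phi> x) \<longlonglongrightarrow> (LINT x|lborel. V x $ i * pd k \<phi> x)"
      by (rule pass[OF test_functions_pd[OF \<phi>] comps(1) icomp(1) _ iVN L1V])
        (simp add: component_le_norm_cart[of "U _ _ - V _", simplified])
    have 2: "(\<lambda>n. LINT x|lborel. G (r n) x $ i $ k * \<phi> x) \<longlonglongrightarrow> (LINT x|lborel. H x $ i $ k * \<phi> x)"
      by (rule pass[OF \<phi> comps(3) icomp(2) _ iHN L1H])
        (simp add: entry_le_norm[of "G _ _ - H _", simplified])
    have "(\<lambda>n. LINT x|lborel. U (r n) x $ i * pd k \<phi> x) = (\<lambda>n. - (LINT x|lborel. G (r n) x $ i $ k *
        \<phi> x))"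
      using weak \<phi> unfolding weak_grad_def by simp
    then show "(LINT x|lborel. V x $ i * pd k \<phi> x) = - (LINT x|lborel. H x $ i $ k * \<phi> x)"
      using LIMSEQ_unique[OF 1] tendsto_minus[OF 2] by simp
  qed
  moreover have "AE x in N. H x \<in> S"
  proof -
    obtain a b :: "nat \<Rightarrow> real ^ 2" where ab: "\<And>n. cbox (a n) (b n) \<subseteq> \<Omega>" "\<Omega> = (\<Union>n. box (a n) (b n))"
      using open_countable_box_cover[OF opn] by metis
    have "AE x in N. ennreal (infdist (H x) S * bump (a m) (b m) x) = 0" for m
    proof -
      let ?\<eta> = "bump (a m) (b m)"
      have \<eta>: "?\<eta> \<in> test_functions \<Omega>" by (rule bump_test[OF ab(1)])
      have m\<eta>[measurable]: "?\<eta> \<in> borel_measurable borel" by (rule test_functions_measurable[OF \<eta>])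
      have mi[measurable]: "(\<lambda>x. infdist (G j x) S * ?\<eta> x) \<in> borel_measurable N" for j
        by (rule measurable_restrict_lborel) measurable
      have mH'[measurable]: "(\<lambda>x. infdist (H x) S * ?\<eta> x) \<in> borel_measurable N"
        by (rule measurable_restrict_lborel) measurable
      have i: "integrable N (\<lambda>x. infdist (G j x) S * ?\<eta> x)" for j
      proof -
        have "\<bar>?\<eta> x\<bar> \<le> 1" for x using bump_bounds[of "a m" "b m" x] by simp
        from integrable_bounded_mult[OF measurable_restrict_lborel[OF m\<eta>] this infdist_integrable]
        show ?thesis by (simp add: mult.commute)
      qed
      \<comment> \<open>Fatou's lemma: the weighted distance of the limit has integral 0. As the
        weight is positive in the box and \<open>S\<close> is closed, \<open>H x\<close> lies in
        \<open>S\<close> almost everywhere there.\<close>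
      have "(\<integral>\<^sup>+x. ennreal (infdist (H x) S * ?\<eta> x) \<partial>N) = (\<integral>\<^sup>+x. liminf (\<lambda>n. ennreal (infdist (G (r
          n) x) S * ?\<eta> x)) \<partial>N)"
        using aeH by (intro nn_integral_cong_AE, eventually_elim)
          (auto intro!: lim_imp_Liminf[symmetric] tendsto_ennrealI tendsto_mult tendsto_infdist)
      also have "\<dots> \<le> liminf (\<lambda>n. \<integral>\<^sup>+x. ennreal (infdist (G (r n) x) S * ?\<eta> x) \<partial>N)"
        by (rule nn_integral_liminf) auto
      also have "(\<lambda>n. \<integral>\<^sup>+x. ennreal (infdist (G (r n) x) S * ?\<eta> x) \<partial>N) = (\<lambda>n. ennreal (LINT x|N.
          infdist (G (r n) x) S * ?\<eta> x))"
        by (intro ext nn_integral_eq_integral[OF i] AE_I2) (simp add: infdist_nonneg bump_bounds)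
      also have "liminf (\<lambda>n. ennreal (LINT x|N. infdist (G (r n) x) S * ?\<eta> x)) = ennreal 0"
        using LIMSEQ_subseq_LIMSEQ[OF dist0[OF \<eta>] r(1)]
        by (intro lim_imp_Liminf tendsto_ennrealI) (auto simp: o_def)
      finally have "(\<integral>\<^sup>+x. ennreal (infdist (H x) S * ?\<eta> x) \<partial>N) = 0" by simp
      then show ?thesis by (subst (asm) nn_integral_0_iff_AE) auto
    qed
    then have "AE x in N. \<forall>m. ennreal (infdist (H x) S * bump (a m) (b m) x) = 0" by (subst
        AE_all_countable) blast
    moreover have "AE x in N. x \<in> \<Omega>" by (rule AE_I2) (simp add: space_N)
    ultimately show ?thesis
    proof eventually_elim
      case (elim x)
      obtain m where "x \<in> box (a m) (b m)" using elim(2) unfolding ab(2) by blast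
      then have "bump (a m) (b m) x > 0" by (simp add: bump_pos_iff)
      moreover have "infdist (H x) S * bump (a m) (b m) x \<le> 0" using elim(1) by (simp add:
          ennreal_eq_0_iff)
      ultimately have "infdist (H x) S = 0" using infdist_nonneg[of "H x" S] by (auto simp:
          mult_le_0_iff)
      then show ?case using in_closed_iff_infdist_zero[OF S] by auto
    qed
  qed
  ultimately show ?thesis using r(1) mV mH out LV LH
    by (intro exI[of _ r] exI[of _ V] exI[of _ H]) blast
qed

end

text \<open>The maps must be Cauchy in measure before minors can be controlled, so a first
  subsequence \<open>s\<close> is taken for that and a second one \<open>r\<close> for the strong
  limit.\<close>

theorem (in sobolev_bounded) compensated_compactness:
  assumes S: "closed S" "S \<noteq> {}"
    and dist0: "\<And>\<eta>. \<eta> \<in> test_functions \<Omega> \<Longrightarrow> (\<lambda>j. LINT x|N. infdist (G j x) S * \<eta> x) \<longlonglongrightarrow> 0"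
    and alg: "\<And>M1 M2. M1 \<in> S \<Longrightarrow> M2 \<in> S \<Longrightarrow> 0 \<le> null_lag c1 (M1 - M2)"
      "\<And>M1 M2. M1 \<in> S \<Longrightarrow> M2 \<in> S \<Longrightarrow> null_lag c1 (M1 - M2) = 0 \<Longrightarrow> 0 \<le> null_lag c2 (M1 - M2)"
      "\<And>M1 M2. M1 \<in> S \<Longrightarrow> M2 \<in> S \<Longrightarrow> null_lag c1 (M1 - M2) = 0 \<Longrightarrow> null_lag c2 (M1 - M2) = 0 \<Longrightarrow> M1 = M2"
  shows "\<exists>r V H. strict_mono (r :: nat \<Rightarrow> nat) \<and> V \<in> borel_measurable borel \<and> H \<in> borel_measurable
      borel \<and>
     (\<forall>x. x \<notin> \<Omega> \<longrightarrow> V x = 0) \<and> (\<forall>x. x \<notin> \<Omega> \<longrightarrow> H x = 0) \<and>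
     integrable N (\<lambda>x. norm (V x) powr p) \<and> integrable N (\<lambda>x. norm (H x) powr p) \<and>
     (\<forall>q. 1 \<le> q \<and> q < p \<longrightarrow> (\<lambda>n. LINT x|N. norm (U (r n) x - V x) powr q) \<longlonglongrightarrow> 0) \<and>
     (\<forall>q. 1 \<le> q \<and> q < p \<longrightarrow> (\<lambda>n. LINT x|N. norm (G (r n) x - H x) powr q) \<longlonglongrightarrow> 0) \<and>
     (\<forall>i. weak_grad \<Omega> (\<lambda>x. V x $ i) (\<lambda>k x. H x $ i $ k)) \<and>
     (AE x in N. H x \<in> S)"
proof -
  obtain s where s: "strict_mono s"
    "\<And>i. conv_meas N pairs (\<lambda>z x. \<bar>U (s (fst z)) x $ i - U (s (snd z)) x $ i\<bar>)"
    using cauchy_in_measure_subseq by blast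
  interpret sub: sobolev_bounded \<Omega> p C "U \<circ> s" "G \<circ> s" by (rule subseq[OF s(1)])
  interpret sub: compact_inclusion \<Omega> p C "U \<circ> s" "G \<circ> s" S c1 c2
  proof unfold_locales
    show "conv_meas N pairs (\<lambda>z x. \<bar>(U \<circ> s) (fst z) x $ i - (U \<circ> s) (snd z) x $ i\<bar>)" for i
      using s(2) by simp
    show "(\<lambda>j. LINT x|N. infdist ((G \<circ> s) j x) S * \<eta> x) \<longlonglongrightarrow> 0" if "\<eta> \<in> test_functions \<Omega>" for \<eta>
      using LIMSEQ_subseq_LIMSEQ[OF dist0[OF that] s(1)] by (simp add: o_def)
  qed (use S alg in auto)
  obtain r V H where *: "strict_mono (r :: nat \<Rightarrow> nat)" "V \<in> borel_measurable borel" "H \<in>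
      borel_measurable borel"
     "(\<forall>x. x \<notin> \<Omega> \<longrightarrow> V x = 0) \<and> (\<forall>x. x \<notin> \<Omega> \<longrightarrow> H x = 0)"
     "integrable N (\<lambda>x. norm (V x) powr p) \<and> integrable N (\<lambda>x. norm (H x) powr p)"
     "\<forall>q. 1 \<le> q \<and> q < p \<longrightarrow> (\<lambda>n. LINT x|N. norm ((U \<circ> s) (r n) x - V x) powr q) \<longlonglongrightarrow> 0"
     "\<forall>q. 1 \<le> q \<and> q < p \<longrightarrow> (\<lambda>n. LINT x|N. norm ((G \<circ> s) (r n) x - H x) powr q) \<longlonglongrightarrow> 0"
     "\<forall>i. weak_grad \<Omega> (\<lambda>x. V x $ i) (\<lambda>k x. H x $ i $ k)" "AE x in N. H x \<in> S"
    using sub.strong_limit by blast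
  show ?thesis
    by (rule exI[of _ "s \<circ> r"], rule exI[of _ V], rule exI[of _ H]) (use * strict_mono_o[OF s(1)
        *(1)] in \<open>simp add: o_def\<close>)
qed

section \<open>The area function\<close>

text \<open>The three abbreviations are the entries of \<open>g = I + X^T X\<close>.\<close>

abbreviation gram11 :: "real ^ 2 ^ 'n::{finite,linorder} \<Rightarrow> real" where "gram11 X \<equiv> 1 + (\<Sum>i\<in>UNIV. (X
    $ i $ 1)\<^sup>2)"
abbreviation gram12 :: "real ^ 2 ^ 'n::{finite,linorder} \<Rightarrow> real" where "gram12 X \<equiv> (\<Sum>i\<in>UNIV. X $ i $
    1 * X $ i $ 2)"
abbreviation gram22 :: "real ^ 2 ^ 'n::{finite,linorder} \<Rightarrow> real" where "gram22 X \<equiv> 1 + (\<Sum>i\<in>UNIV. (X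
    $ i $ 2)\<^sup>2)"

text \<open>The sum over all ordered pairs is symmetric and vanishes on the diagonal, so it is twice
  the sum over \<open>a \<le> b\<close>; the full sum expands directly.\<close>

lemma lagrange_identity:
  fixes x y :: "'n::{finite,linorder} \<Rightarrow> real"
  shows "(\<Sum>(a, b)\<in>{(a, b). a \<le> b}. (x a * y b - y a * x b)\<^sup>2) = (\<Sum>i\<in>UNIV. (x i)\<^sup>2) * (\<Sum>i\<in>UNIV. (y
      i)\<^sup>2) - (\<Sum>i\<in>UNIV. x i * y i)\<^sup>2"
proof -
  let ?f = "\<lambda>(a, b). (x a * y b - y a * x b)\<^sup>2"
  let ?T = "\<Sum>z\<in>UNIV. ?f z"
  have U: "(UNIV :: ('n \<times> 'n) set) = {(a, b). a \<le> b} \<union> {(a, b). b \<le> a}" by auto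
  have I: "{(a, b). a \<le> b} \<inter> {(a, b). b \<le> a} = ((\<lambda>a::'n. (a, a)) ` UNIV)" by auto
  have zero: "sum ?f ((\<lambda>a::'n. (a, a)) ` UNIV) = 0" by (rule sum.neutral) auto
  have sym: "sum ?f {(a, b). b \<le> a} = sum ?f {(a, b). a \<le> b}"
    by (rule sum.reindex_bij_witness[where i=prod.swap and j=prod.swap])
      (auto simp: power2_eq_square algebra_simps)
  have "?T = sum ?f {(a, b). a \<le> b} + sum ?f {(a, b). b \<le> a}"
    unfolding U by (subst sum_Un) (auto simp: I zero)
  then have T: "?T = 2 * sum ?f {(a, b). a \<le> b}" using sym by simp
  have "?T = (\<Sum>a\<in>UNIV. \<Sum>b\<in>UNIV. (x a)\<^sup>2 * (y b)\<^sup>2 + (y a)\<^sup>2 * (x b)\<^sup>2 - 2 * (x a * y a * (x b * y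
      b)))"
    unfolding UNIV_Times_UNIV[symmetric] sum.cartesian_product[symmetric]
    by (intro sum.cong refl) (simp add: power2_eq_square algebra_simps)
  also have "\<dots> = 2 * ((\<Sum>i\<in>UNIV. (x i)\<^sup>2) * (\<Sum>i\<in>UNIV. (y i)\<^sup>2) - (\<Sum>i\<in>UNIV. x i * y i)\<^sup>2)"
    by (simp add: sum.distrib sum_subtractf sum_distrib_left[symmetric] sum_distrib_right[symmetric]
        power2_eq_square[of "sum _ _"])
  finally show ?thesis using T by simp
qed

text \<open>By the Lagrange identity the expression under the root is
  \<open>det (I + X^T X)\<close>, the squared area density of the graph of a map with differential
  \<open>X\<close>.\<close>

lemma area_eq: "area X = sqrt (gram11 X * gram22 X - (gram12 X)\<^sup>2)" and area_arg_ge1: "gram11 X *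
    gram22 X - (gram12 X)\<^sup>2 \<ge> 1"
proof -
  have n: "(norm X)\<^sup>2 = (\<Sum>i\<in>UNIV. (X $ i $ 1)\<^sup>2) + (\<Sum>i\<in>UNIV. (X $ i $ 2)\<^sup>2)"
    unfolding power2_norm_eq_inner by (simp add: inner_vec_def sum_2 power2_eq_square sum.distrib)
  have d: "det (rows_submatrix X a b) = X $ a $ 1 * X $ b $ 2 - X $ a $ 2 * X $ b $ 1" for a b
    by (simp add: rows_submatrix_def det_2 vector_2)
  have eq: "1 + (norm X)\<^sup>2 + (\<Sum>(a, b)\<in>{(a, b). a \<le> b}. (det (rows_submatrix X a b))\<^sup>2) = gram11 X *
      gram22 X - (gram12 X)\<^sup>2"
    unfolding d n using lagrange_identity[of "\<lambda>i. X $ i $ 1" "\<lambda>i. X $ i $ 2"] by (simp add: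
        algebra_simps)
  show "area X = sqrt (gram11 X * gram22 X - (gram12 X)\<^sup>2)" unfolding area_def eq ..
  show "gram11 X * gram22 X - (gram12 X)\<^sup>2 \<ge> 1" unfolding eq[symmetric] by (simp add: sum_nonneg
      add_nonneg_nonneg case_prod_beta)
qed

lemma area_sq: "(area X)\<^sup>2 = gram11 X * gram22 X - (gram12 X)\<^sup>2" and area_pos: "area X > 0"
  using area_arg_ge1[of X] by (auto simp: area_eq)

text \<open>In matrix form this is \<open>X adj(g) / area X\<close>, the shape produced by
  differentiating the square root of \<open>det g\<close>.\<close>

definition area_grad :: "real ^ 2 ^ 'n::{finite,linorder} \<Rightarrow> real ^ 2 ^ 'n::{finite,linorder}" where
  "area_grad X = (\<chi> i. vector [(gram22 X * X $ i $ 1 - gram12 X * X $ i $ 2) / area X, (gram11 X * X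
      $ i $ 2 - gram12 X * X $ i $ 1) / area X])"

lemma gradient_area:
  fixes X :: "real ^ 2 ^ 'n::{finite,linorder}"
  shows "gradient area X = area_grad X"
proof (rule gradient_eqI)
  have c: "((\<lambda>X::real^2^'n::{finite,linorder}. X $ i $ k) has_derivative (\<lambda>H. H $ i $ k)) (at X)"
      for i k
    by (intro bounded_linear_imp_has_derivative bounded_linear_compose[OF bounded_linear_vec_nth
        bounded_linear_vec_nth])
  let ?a = "\<lambda>X::real^2^'n::{finite,linorder}. gram11 X * gram22 X - (gram12 X)\<^sup>2"
  let ?dP = "\<lambda>H::real^2^'n::{finite,linorder}. \<Sum>i\<in>UNIV. 2 * X $ i $ 1 * H $ i $ 1"
  let ?dR = "\<lambda>H::real^2^'n::{finite,linorder}. \<Sum>i\<in>UNIV. 2 * X $ i $ 2 * H $ i $ 2"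
  let ?dQ = "\<lambda>H::real^2^'n::{finite,linorder}. \<Sum>i\<in>UNIV. X $ i $ 1 * H $ i $ 2 + H $ i $ 1 * X $ i $
      2"
  have P: "(gram11 has_derivative ?dP) (at X)" and R: "(gram22 has_derivative ?dR) (at X)" and Q:
      "(gram12 has_derivative ?dQ) (at X)"
    by (auto intro!: derivative_eq_intros c simp: mult_ac sum.distrib)
  have "(?a has_derivative (\<lambda>H. gram11 X * ?dR H + ?dP H * gram22 X - 2 * gram12 X * ?dQ H)) (at X)"
    by (rule has_derivative_eq_rhs[OF has_derivative_diff[OF has_derivative_mult[OF P R]
        has_derivative_power[OF Q, of 2]]])
      (auto simp: fun_eq_iff algebra_simps)
  then have "((\<lambda>X. sqrt (?a X)) has_derivative (\<lambda>H. (gram11 X * ?dR H + ?dP H * gram22 X - 2 *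
      gram12 X * ?dQ H) * (inverse (sqrt (?a X)) / 2))) (at X)"
    using area_arg_ge1[of X] by (intro has_derivative_real_sqrt) auto
  moreover have "(\<lambda>H. (gram11 X * ?dR H + ?dP H * gram22 X - 2 * gram12 X * ?dQ H) * (inverse (sqrt
      (?a X)) / 2)) = (\<lambda>H. H \<bullet> area_grad X)"
  proof
    fix H :: "real^2^'n::{finite,linorder}"
    have "(gram11 X * ?dR H + ?dP H * gram22 X - 2 * gram12 X * ?dQ H) * (inverse (sqrt (?a X)) / 2)
        =
       (gram11 X * ?dR H + ?dP H * gram22 X - 2 * gram12 X * ?dQ H) / 2 / area X"
      unfolding area_eq[symmetric] by (simp add: field_simps)
    also have "(gram11 X * ?dR H + ?dP H * gram22 X - 2 * gram12 X * ?dQ H) / 2 =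
       (\<Sum>i\<in>UNIV. H $ i $ 1 * (gram22 X * X $ i $ 1 - gram12 X * X $ i $ 2) + H $ i $ 2 * (gram11 X *
           X $ i $ 2 - gram12 X * X $ i $ 1))"
    proof -
      have "gram11 X * ?dR H + ?dP H * gram22 X - 2 * gram12 X * ?dQ H = (\<Sum>i\<in>UNIV. gram11 X * (2 * X
          $ i $ 2 * H $ i $ 2) + (2 * X $ i $ 1 * H $ i $ 1) * gram22 X
         - 2 * gram12 X * (X $ i $ 1 * H $ i $ 2 + H $ i $ 1 * X $ i $ 2))"
      proof -
        have "P * (\<Sum>i\<in>UNIV. f i) + (\<Sum>i\<in>UNIV. g i) * R - 2 * Q * (\<Sum>i\<in>UNIV. h i) =
           (\<Sum>i\<in>UNIV. P * f i + g i * R - 2 * Q * h i)" for P Q R :: real and f g h :: "'n \<Rightarrow> real"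
          by (simp add: sum.distrib sum_subtractf sum_distrib_left sum_distrib_right)
        then show ?thesis .
      qed
      also have "\<dots> = (\<Sum>i\<in>UNIV. 2 * (H $ i $ 1 * (gram22 X * X $ i $ 1 - gram12 X * X $ i $ 2) + H $
          i $ 2 * (gram11 X * X $ i $ 2 - gram12 X * X $ i $ 1)))"
      proof (rule sum.cong[OF refl])
        fix i
        \<comment> \<open>Opaque names keep the simplifier from distributing products over the sums
          inside the entries of \<open>g\<close>.\<close>
        define P Q R where "P = gram11 X" and "Q = gram12 X" and "R = gram22 X"
        show "gram11 X * (2 * X $ i $ 2 * H $ i $ 2) + (2 * X $ i $ 1 * H $ i $ 1) * gram22 X
         - 2 * gram12 X * (X $ i $ 1 * H $ i $ 2 + H $ i $ 1 * X $ i $ 2) =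
         2 * (H $ i $ 1 * (gram22 X * X $ i $ 1 - gram12 X * X $ i $ 2) + H $ i $ 2 * (gram11 X * X
             $ i $ 2 - gram12 X * X $ i $ 1))"
          unfolding P_def[symmetric] Q_def[symmetric] R_def[symmetric] by (simp add: algebra_simps)
      qed
      finally show ?thesis unfolding sum_distrib_left[symmetric] by simp
    qed
    also have "\<dots> / area X = H \<bullet> area_grad X"
      by (simp add: area_grad_def inner_vec_def sum_2 sum_divide_distrib add_divide_distrib)
    finally show "(gram11 X * ?dR H + ?dP H * gram22 X - 2 * gram12 X * ?dQ H) * (inverse (sqrt (?a
        X)) / 2) = H \<bullet> area_grad X" .
  qed
  ultimately show "GDERIV area X :> area_grad X"
    by (simp add: gderiv_def area_eq[abs_def])
qed

text \<open>Together with the next two, the entries of \<open>h\<close>; dividing by the root of the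
  determinant normalizes \<open>g\<close> within its conformal class.\<close>

definition conf11 :: "real ^ 2 ^ 'n::{finite,linorder} \<Rightarrow> real" where "conf11 X = gram11 X / area X"
definition conf12 :: "real ^ 2 ^ 'n::{finite,linorder} \<Rightarrow> real" where "conf12 X = gram12 X / area X"
definition conf22 :: "real ^ 2 ^ 'n::{finite,linorder} \<Rightarrow> real" where "conf22 X = gram22 X / area X"

lemma conf_pos: "conf11 X > 0" "conf22 X > 0"
  unfolding conf11_def conf22_def using area_pos[of X] by (auto intro!: divide_pos_pos
      add_pos_nonneg sum_nonneg)

lemma conf_det: "conf11 X * conf22 X - (conf12 X)\<^sup>2 = 1"
proof -
  have "conf11 X * conf22 X - (conf12 X)\<^sup>2 = (gram11 X * gram22 X - (gram12 X)\<^sup>2) / (area X)\<^sup>2"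
    by (simp add: conf11_def conf12_def conf22_def power2_eq_square diff_divide_distrib)
  then show ?thesis using area_sq[of X] area_pos[of X] area_arg_ge1[of X] by simp
qed

lemma A_area_entries:
  "A_area X $ i $ 1 = conf12 X * X $ i $ 1 - conf11 X * X $ i $ 2"
  "A_area X $ i $ 2 = conf22 X * X $ i $ 1 - conf12 X * X $ i $ 2"
  unfolding A_area_def gradient_area area_grad_def J_def matrix_matrix_mult_def conf11_def
      conf12_def conf22_def
  by (simp_all add: sum_2 vector_2 diff_divide_distrib)

text \<open>From \<open>X^T X = g - I\<close> and \<open>g adj(g) = (area X)^2 I\<close>, the
  product of \<open>X^T\<close> with the gradient is \<open>area X I - adj(g) / area X\<close>.
  After multiplication by \<open>J\<close> the term \<open>area X J\<close> cancels, and
  \<open>adj(g) J = J g\<close> turns the rest into \<open>- J h\<close>.\<close>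

lemma B_area_entries:
  "B_area X $ 1 $ 1 = - conf12 X" "B_area X $ 1 $ 2 = - conf22 X"
  "B_area X $ 2 $ 1 = conf11 X" "B_area X $ 2 $ 2 = conf12 X"
proof -
  let ?a = "area X"
  have a: "?a \<noteq> 0" using area_pos[of X] by simp
  define P Q R where "P = gram11 X" and "Q = gram12 X" and "R = gram22 X"
  have D: "?a * ?a = P * R - Q * Q" using area_sq[of X] by (simp add: P_def Q_def R_def
      power2_eq_square)
  have s1: "(\<Sum>i\<in>UNIV. X $ i $ 1 * X $ i $ 1) = P - 1" and s2: "(\<Sum>i\<in>UNIV. X $ i $ 2 * X $ i $ 2) = R
      - 1"
    and s3: "(\<Sum>i\<in>UNIV. X $ i $ 1 * X $ i $ 2) = Q" and s4: "(\<Sum>i\<in>UNIV. X $ i $ 2 * X $ i $ 1) = Q"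
    by (simp_all add: P_def Q_def R_def power2_eq_square mult.commute)
  have g1: "area_grad X $ i $ 1 = (R * X $ i $ 1 - Q * X $ i $ 2) / ?a" and g2: "area_grad X $ i $ 2
      = (P * X $ i $ 2 - Q * X $ i $ 1) / ?a" for i
    by (simp_all add: area_grad_def P_def Q_def R_def)
  have t: "(\<Sum>i\<in>UNIV. X $ i $ k * ((c * X $ i $ l - d * X $ i $ m) / ?a)) =
     (c * (\<Sum>i\<in>UNIV. X $ i $ k * X $ i $ l) - d * (\<Sum>i\<in>UNIV. X $ i $ k * X $ i $ m)) / ?a" for k l m
         and c d :: real
    by (simp add: sum_divide_distrib sum_distrib_left sum_subtractf[symmetric] algebra_simps
        diff_divide_distrib)
  have B: "B_area X $ k $ 1 = - (\<Sum>i\<in>UNIV. X $ i $ k * area_grad X $ i $ 2) - ?a * J $ k $ 1"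
    "B_area X $ k $ 2 = (\<Sum>i\<in>UNIV. X $ i $ k * area_grad X $ i $ 1) - ?a * J $ k $ 2" for k
    unfolding B_area_def gradient_area matrix_matrix_mult_def by (simp_all add: sum_2 J_def vector_2
        transpose_def)
  \<comment> \<open>Writes \<open>area X\<close> with denominator \<open>area X\<close>, so that it
    combines with the other fraction.\<close>
  have D': "?a = (P * R - Q * Q) / ?a" using D a by (simp add: field_simps)
  show "B_area X $ 1 $ 1 = - conf12 X" "B_area X $ 2 $ 2 = conf12 X"
    unfolding B g1 g2 t s1 s2 s3 s4 conf12_def Q_def[symmetric] using a by (simp_all add: J_def
        vector_2 field_simps)
  have "B_area X $ 1 $ 2 = (R * (P - 1) - Q * Q) / ?a - (P * R - Q * Q) / ?a"
    unfolding B g1 g2 t s1 s2 s3 s4 using D' by (simp add: J_def vector_2)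
  also have "\<dots> = - R / ?a" by (simp add: diff_divide_distrib[symmetric] algebra_simps)
  finally show "B_area X $ 1 $ 2 = - conf22 X" by (simp only: conf22_def R_def minus_divide_left)
  have "B_area X $ 2 $ 1 = - ((P * (R - 1) - Q * Q) / ?a) + (P * R - Q * Q) / ?a"
    unfolding B g1 g2 t s1 s2 s3 s4 using D' by (simp add: J_def vector_2)
  also have "\<dots> = P / ?a" by (simp add: add_divide_distrib[symmetric] diff_divide_distrib[symmetric]
      algebra_simps)
  finally show "B_area X $ 2 $ 1 = conf11 X" by (simp only: conf11_def P_def)
qed

section \<open>The set \<open>C_area\<close>: closedness and separating minors\<close>

lemma stack_entries [simp]:
  "stack X Y Z $ Inl a = X $ a" "stack X Y Z $ Inr (Inl a) = Y $ a" "stack X Y Z $ Inr (Inr c) = Z $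
      c"
  by (simp_all add: stack_def)

lemma all_sum3_iff: "(\<forall>i :: 'a + 'b + 'c. P i) \<longleftrightarrow> (\<forall>a. P (Inl a)) \<and> (\<forall>b. P (Inr (Inl b))) \<and> (\<forall>c. P
    (Inr (Inr c)))"
  by (metis sum.exhaust)

text \<open>The first block of \<open>M\<close> already determines the only candidate for
  \<open>X\<close>, so no existential quantifier remains. In this form closedness is immediate,
  since the conditions are equations between continuous functions of \<open>M\<close>.\<close>

lemma C_area_iff:
  fixes M :: "real ^ 2 ^ ('n::{finite,linorder} + 'n + 2)"
  defines "X \<equiv> (\<chi> a. M $ Inl a)"
  shows "M \<in> C_area \<longleftrightarrow>
    (\<forall>a. M $ Inr (Inl a) $ 1 = conf12 X * X $ a $ 1 - conf11 X * X $ a $ 2 \<and>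
         M $ Inr (Inl a) $ 2 = conf22 X * X $ a $ 1 - conf12 X * X $ a $ 2) \<and>
    M $ Inr (Inr 1) $ 1 = - conf12 X \<and> M $ Inr (Inr 1) $ 2 = - conf22 X \<and>
    M $ Inr (Inr 2) $ 1 = conf11 X \<and> M $ Inr (Inr 2) $ 2 = conf12 X"
proof -
  have "M \<in> C_area \<longleftrightarrow> M = stack X (A_area X) (B_area X)"
    by (auto simp: C_area_def X_def)
  also have "\<dots> \<longleftrightarrow> (\<forall>a. M $ Inr (Inl a) = A_area X $ a) \<and> (\<forall>c. M $ Inr (Inr c) = B_area X $ c)"
    by (simp add: vec_eq_iff[of M] all_sum3_iff X_def)
  finally show ?thesis
    by (simp add: vec_eq_iff forall_2 A_area_entries B_area_entries)
qed

lemma C_area_closed: "closed (C_area :: (real ^ 2 ^ ('n::{finite,linorder} + 'n + 2)) set)"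
proof -
  let ?X = "\<lambda>M :: real ^ 2 ^ ('n::{finite,linorder} + 'n + 2). (\<chi> a. M $ Inl a)"
  have nz: "area X \<noteq> 0" for X :: "real ^ 2 ^ 'n::{finite,linorder}" using area_pos[of X] by simp
  have c: "continuous_on UNIV (\<lambda>M. area (?X M))"
    unfolding area_eq by (simp, intro continuous_intros)
  have "continuous_on UNIV (\<lambda>M. conf11 (?X M))" "continuous_on UNIV (\<lambda>M. conf12 (?X M))"
      "continuous_on UNIV (\<lambda>M. conf22 (?X M))"
    unfolding conf11_def conf12_def conf22_def by (intro continuous_on_divide c; simp add: nz; intro
        continuous_intros)+
  then have "closed {M. M \<in> (C_area :: (real ^ 2 ^ ('n::{finite,linorder} + 'n + 2)) set)}"
    unfolding C_area_iff
    by (intro closed_Collect_conj closed_Collect_all closed_Collect_eq continuous_intros)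
  then show ?thesis by simp
qed

text \<open>The sign turns the form into \<open>- det\<close> of the block \<open>B\<close>, which
  on differences of points of \<open>C_area\<close> is \<open>- det (h1 - h2)\<close> and hence
  nonnegative. The nested conditionals let the double sum collapse one index at a time.\<close>

definition lag_B :: "'n + 'n + 2 \<Rightarrow> 'n + 'n + 2 \<Rightarrow> real" where
  "lag_B a b = (if a = Inr (Inr 1) then if b = Inr (Inr 2) then - 1 else 0 else 0)"

definition lag_XA :: "'n + 'n + 2 \<Rightarrow> 'n + 'n + 2 \<Rightarrow> real" where
  "lag_XA a b = (case a of Inl i \<Rightarrow> if b = Inr (Inl i) then 1 else 0 | Inr _ \<Rightarrow> 0)"

lemma null_lag_B: "null_lag lag_B M = - minor M (Inr (Inr 1)) (Inr (Inr 2))"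
proof -
  have "(\<Sum>b\<in>UNIV. lag_B a b * minor M a b) = (if a = Inr (Inr 1) then - minor M (Inr (Inr 1)) (Inr
      (Inr 2)) else 0)" for a
    by (simp add: lag_B_def if_distrib[of "\<lambda>x. x * _"] cong: if_cong)
  then show ?thesis by (simp add: null_lag_def)
qed

lemma null_lag_XA:
  fixes M :: "real ^ 2 ^ ('n::finite + 'n + 2)"
  shows "null_lag lag_XA M = (\<Sum>i\<in>UNIV. minor M (Inl i) (Inr (Inl i)))"
proof -
  have "(\<Sum>b\<in>UNIV. lag_XA a b * minor M a b) = (case a of Inl i \<Rightarrow> minor M (Inl i) (Inr (Inl i)) | Inr
      _ \<Rightarrow> 0)" for a
    by (cases a) (simp_all add: lag_XA_def if_distrib[of "\<lambda>x. x * _"] cong: if_cong)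
  then have "null_lag lag_XA M = (\<Sum>a\<in>UNIV <+> (UNIV :: ('n + 2) set). case a of Inl i \<Rightarrow> minor M (Inl
      i) (Inr (Inl i)) | Inr _ \<Rightarrow> 0)"
    by (simp add: null_lag_def)
  also have "\<dots> = (\<Sum>i\<in>UNIV. minor M (Inl i) (Inr (Inl i)))"
    by (subst sum.Plus) (auto simp: o_def)
  finally show ?thesis .
qed

text \<open>Multiplication by \<open>p1 p2\<close> allows \<open>r1\<close> and \<open>r2\<close> to
  be eliminated through the determinant conditions, and a sum of squares is left. For positive
  \<open>p1\<close> and \<open>p2\<close> it exhibits \<open>det (h1 - h2) \<le> 0\<close>, with
  equality only for \<open>h1 = h2\<close>.\<close>

lemma conformal_identity:
  fixes p1 p2 q1 q2 r1 r2 :: real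
  assumes "p1 * r1 - q1\<^sup>2 = 1" "p2 * r2 - q2\<^sup>2 = 1"
  shows "p1 * p2 * ((q1 - q2)\<^sup>2 - (p1 - p2) * (r1 - r2)) = (p1 - p2)\<^sup>2 + (p1 * q2 - p2 * q1)\<^sup>2"
proof -
  have "p1 * r1 = 1 + q1\<^sup>2" "p2 * r2 = 1 + q2\<^sup>2" using assms by simp_all
  then show ?thesis by algebra
qed

text \<open>\<open>p\<close>, \<open>q\<close> and \<open>r\<close> are the entries of
  \<open>h\<close>; membership becomes a list of scalar relations ready for algebra.\<close>

lemma C_area_cases:
  fixes M :: "real ^ 2 ^ ('n::{finite,linorder} + 'n + 2)"
  assumes "M \<in> C_area"
  obtains p q r where "p > 0" "r > 0" "p * r - q\<^sup>2 = 1"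
    "\<And>a. M $ Inr (Inl a) $ 1 = q * M $ Inl a $ 1 - p * M $ Inl a $ 2"
    "\<And>a. M $ Inr (Inl a) $ 2 = r * M $ Inl a $ 1 - q * M $ Inl a $ 2"
    "M $ Inr (Inr 1) $ 1 = - q" "M $ Inr (Inr 1) $ 2 = - r" "M $ Inr (Inr 2) $ 1 = p" "M $ Inr (Inr
        2) $ 2 = q"
proof -
  define X where "X = (\<chi> a. M $ Inl a)"
  show ?thesis
    using that[of "conf11 X" "conf22 X" "conf12 X"] conf_pos[of X] conf_det[of X] assms[unfolded
        C_area_iff]
    by (simp add: X_def)
qed

lemma C_area_algebra:
  fixes M1 M2 :: "real ^ 2 ^ ('n::{finite,linorder} + 'n + 2)"
  assumes "M1 \<in> C_area" "M2 \<in> C_area"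
  shows "0 \<le> null_lag lag_B (M1 - M2)"
    and "null_lag lag_B (M1 - M2) = 0 \<Longrightarrow> 0 \<le> null_lag lag_XA (M1 - M2)"
    and "null_lag lag_B (M1 - M2) = 0 \<Longrightarrow> null_lag lag_XA (M1 - M2) = 0 \<Longrightarrow> M1 = M2"
proof -
  obtain p1 q1 r1 where 1: "p1 > 0" "r1 > 0" "p1 * r1 - q1\<^sup>2 = 1"
    "\<And>a. M1 $ Inr (Inl a) $ 1 = q1 * M1 $ Inl a $ 1 - p1 * M1 $ Inl a $ 2"
    "\<And>a. M1 $ Inr (Inl a) $ 2 = r1 * M1 $ Inl a $ 1 - q1 * M1 $ Inl a $ 2"
    "M1 $ Inr (Inr 1) $ 1 = - q1" "M1 $ Inr (Inr 1) $ 2 = - r1" "M1 $ Inr (Inr 2) $ 1 = p1" "M1 $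
        Inr (Inr 2) $ 2 = q1"
    using C_area_cases[OF assms(1)] by metis
  obtain p2 q2 r2 where 2: "p2 > 0" "r2 > 0" "p2 * r2 - q2\<^sup>2 = 1"
    "\<And>a. M2 $ Inr (Inl a) $ 1 = q2 * M2 $ Inl a $ 1 - p2 * M2 $ Inl a $ 2"
    "\<And>a. M2 $ Inr (Inl a) $ 2 = r2 * M2 $ Inl a $ 1 - q2 * M2 $ Inl a $ 2"
    "M2 $ Inr (Inr 1) $ 1 = - q2" "M2 $ Inr (Inr 1) $ 2 = - r2" "M2 $ Inr (Inr 2) $ 1 = p2" "M2 $
        Inr (Inr 2) $ 2 = q2"
    using C_area_cases[OF assms(2)] by metis
  have D: "null_lag lag_B (M1 - M2) = (q1 - q2)\<^sup>2 - (p1 - p2) * (r1 - r2)"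
    by (simp add: null_lag_B minor_def 1 2 power2_eq_square algebra_simps)
  have id: "p1 * p2 * null_lag lag_B (M1 - M2) = (p1 - p2)\<^sup>2 + (p1 * q2 - p2 * q1)\<^sup>2"
    unfolding D by (rule conformal_identity[OF 1(3) 2(3)])
  have pp: "p1 * p2 > 0" using 1(1) 2(1) by simp
  show "0 \<le> null_lag lag_B (M1 - M2)"
    using id pp by (metis sum_power2_ge_zero zero_le_mult_iff not_less less_asym)
  \<comment> \<open>The first square gives \<open>p1 = p2\<close>, the second then
    \<open>q1 = q2\<close>, and the determinant conditions give \<open>r1 = r2\<close>.\<close>
  have eq: "p1 = p2" "q1 = q2" "r1 = r2" if "null_lag lag_B (M1 - M2) = 0"
  proof -
    have "(p1 - p2)\<^sup>2 + (p1 * q2 - p2 * q1)\<^sup>2 = 0"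
      unfolding id[symmetric] that by (rule mult_zero_right)
    then have e: "p1 - p2 = 0 \<and> p1 * q2 - p2 * q1 = 0" by (simp only: sum_power2_eq_zero_iff)
    then show p: "p1 = p2" by simp
    have "p2 * q2 = p2 * q1" using conjunct2[OF e] unfolding p by (simp only: right_minus_eq)
    then show q: "q1 = q2" using 2(1) by simp
    have "p1 * r1 = p1 * r2" using 1(3) 2(3) unfolding p q by linarith
    then show "r1 = r2" using 1(1) by simp
  qed
  \<comment> \<open>With a common \<open>h\<close> the minor is
    \<open>r x^2 - 2 q x y + p y^2\<close>, where \<open>(x, y)\<close> is the difference of the
    \<open>i\<close>-th rows. Multiplying by \<open>p1\<close> and using
    \<open>p1 r1 = 1 + q1^2\<close> completes the square.\<close>
  have quad: "minor (M1 - M2) (Inl i) (Inr (Inl i)) * p1 = (p1 * (M1 - M2) $ Inl i $ 2 - q1 * (M1 -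
      M2) $ Inl i $ 1)\<^sup>2 + ((M1 - M2) $ Inl i $ 1)\<^sup>2"
    if z: "null_lag lag_B (M1 - M2) = 0" for i
  proof -
    define x y where "x = M1 $ Inl i $ 1 - M2 $ Inl i $ 1" and "y = M1 $ Inl i $ 2 - M2 $ Inl i $ 2"
    have m: "minor (M1 - M2) (Inl i) (Inr (Inl i)) = x * (r1 * x - q1 * y) - y * (q1 * x - p1 * y)"
      by (simp add: minor_def 1(4,5) 2(4,5) eq[OF z, symmetric] x_def y_def algebra_simps)
    have "minor (M1 - M2) (Inl i) (Inr (Inl i)) * p1 = (p1 * r1) * x\<^sup>2 - 2 * q1 * p1 * x * y + p1\<^sup>2
        * y\<^sup>2"
      unfolding m by (simp add: power2_eq_square algebra_simps)
    also have "p1 * r1 = 1 + q1\<^sup>2" using 1(3) by simp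
    also have "(1 + q1\<^sup>2) * x\<^sup>2 - 2 * q1 * p1 * x * y + p1\<^sup>2 * y\<^sup>2 = (p1 * y - q1 * x)\<^sup>2 + x\<^sup>2"
      by (simp add: power2_eq_square algebra_simps)
    finally show ?thesis by (simp add: x_def y_def)
  qed
  have nn: "0 \<le> minor (M1 - M2) (Inl i) (Inr (Inl i))" if "null_lag lag_B (M1 - M2) = 0" for i
  proof -
    have "0 \<le> minor (M1 - M2) (Inl i) (Inr (Inl i)) * p1" unfolding quad[OF that] by simp
    then show ?thesis using 1(1) by (simp add: zero_le_mult_iff)
  qed
  show "0 \<le> null_lag lag_XA (M1 - M2)" if "null_lag lag_B (M1 - M2) = 0"
    unfolding null_lag_XA by (intro sum_nonneg nn[OF that])
  show "M1 = M2" if z: "null_lag lag_B (M1 - M2) = 0" and z2: "null_lag lag_XA (M1 - M2) = 0"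
  proof -
    have "minor (M1 - M2) (Inl i) (Inr (Inl i)) = 0" for i
      using z2 unfolding null_lag_XA by (subst (asm) sum_nonneg_eq_0_iff) (auto intro: nn[OF z])
    then have "(p1 * (M1 - M2) $ Inl i $ 2 - q1 * (M1 - M2) $ Inl i $ 1)\<^sup>2 + ((M1 - M2) $ Inl i $
        1)\<^sup>2 = 0" for i
      using quad[OF z, of i] by simp
    then have e: "p1 * (M1 - M2) $ Inl i $ 2 - q1 * (M1 - M2) $ Inl i $ 1 = 0 \<and> (M1 - M2) $ Inl i $
        1 = 0" for i
      unfolding sum_power2_eq_zero_iff by blast
    have x: "M1 $ Inl i $ 1 = M2 $ Inl i $ 1" "M1 $ Inl i $ 2 = M2 $ Inl i $ 2" for i
      using e[of i] 1(1) by auto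
    show ?thesis
      unfolding vec_eq_iff forall_2 all_sum3_iff using x eq[OF z] by (simp add: 1 2)
  qed
qed

section \<open>Sobolev spaces over the Lebesgue measure\<close>

lemma AE_lebesgue_on_iff:
  assumes "\<Omega> \<in> sets borel"
  shows "(AE x in lebesgue_on \<Omega>. P x) \<longleftrightarrow> (AE x in restrict_space lborel \<Omega>. P x)"
  using assms by (simp add: AE_restrict_space_iff AE_completion_iff)

lemma borel_lebesgue_on:
  assumes "f \<in> borel_measurable borel"
  shows "f \<in> borel_measurable (lebesgue_on \<Omega>)"
  using assms by (intro measurable_restrict_space1 measurable_completion) simp

lemma lebesgue_on_borel:
  fixes f :: "'a::euclidean_space \<Rightarrow> 'b::{banach,second_countable_topology}"
  assumes "\<Omega> \<in> sets borel" "f \<in> borel_measurable borel"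
  shows "integrable (lebesgue_on \<Omega>) f \<longleftrightarrow> integrable (restrict_space lborel \<Omega>) f"
    "(LINT x|lebesgue_on \<Omega>. f x) = (LINT x|restrict_space lborel \<Omega>. f x)"
  using assms by (simp_all add: integrable_restrict_space integral_restrict_space
      integrable_completion integral_completion)

lemma finite_measure_lebesgue_on:
  assumes "bounded \<Omega>" "\<Omega> \<in> sets borel"
  shows "finite_measure (lebesgue_on \<Omega>)"
  by (rule finite_measureI) (use assms emeasure_bounded_finite[OF assms(1)] in \<open>simp add:
      emeasure_restrict_space\<close>)

text \<open>Each of the finitely many coordinates is modified on a null set, and the indicator
  forces the value 0 off \<open>\<Omega>\<close>, the form in which the arguments over
  \<open>lborel\<close> expect their functions.\<close>

lemma borel_representative:
  fixes f :: "'a::euclidean_space \<Rightarrow> 'b::euclidean_space"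
  assumes \<Omega>: "\<Omega> \<in> sets borel" and f: "f \<in> borel_measurable (lebesgue_on \<Omega>)"
  obtains g where "g \<in> borel_measurable borel" "\<And>x. x \<notin> \<Omega> \<Longrightarrow> g x = 0" "AE x in lebesgue_on \<Omega>. f x = g
      x"
proof -
  have F: "(\<lambda>x. indicator \<Omega> x *\<^sub>R f x) \<in> borel_measurable lebesgue"
    using f \<Omega> by (subst (asm) borel_measurable_restrict_space_iff) auto
  have "\<forall>b. \<exists>g'\<in>borel_measurable lborel. AE x in lborel. (indicator \<Omega> x *\<^sub>R f x) \<bullet> b = g' x"
    using F by (intro allI completion_ex_borel_measurable_real borel_measurable_inner) auto
  then obtain h where h: "\<And>b. h b \<in> borel_measurable lborel" "\<And>b. AE x in lborel. (indicator \<Omega> x *\<^sub>R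
      f x) \<bullet> b = h b x"
    by metis
  define g where "g x = indicator \<Omega> x *\<^sub>R (\<Sum>b\<in>Basis. h b x *\<^sub>R b)" for x
  have [measurable]: "h b \<in> borel_measurable borel" for b using h(1)[of b] by simp
  have "AE x in lborel. \<forall>b\<in>(Basis :: 'b set). (indicator \<Omega> x *\<^sub>R f x) \<bullet> b = h b x"
    using h(2) by (intro AE_finite_allI) auto
  then have "AE x in lborel. x \<in> \<Omega> \<longrightarrow> f x = g x"
  proof (eventually_elim, intro impI)
    fix x assume *: "\<forall>b\<in>(Basis :: 'b set). (indicator \<Omega> x *\<^sub>R f x) \<bullet> b = h b x" and x: "x \<in> \<Omega>"
    have "f x = (\<Sum>b\<in>Basis. (f x \<bullet> b) *\<^sub>R b)" by (rule euclidean_representation[symmetric])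
    also have "\<dots> = g x" using * x by (auto simp: g_def intro!: sum.cong)
    finally show "f x = g x" .
  qed
  then have "AE x in lebesgue_on \<Omega>. f x = g x"
    using \<Omega> by (simp add: AE_restrict_space_iff AE_completion_iff)
  moreover have "g \<in> borel_measurable borel" unfolding g_def[abs_def] using \<Omega> by measurable
  ultimately show ?thesis using that[of g] by (simp add: g_def)
qed

text \<open>Local integrability gives measurability on every closed box in \<open>\<Omega>\<close>,
  and countably many of these cover \<open>\<Omega>\<close>.\<close>

lemma locally_integrable_measurable:
  fixes f :: "real ^ 'd \<Rightarrow> 'b::euclidean_space"
  assumes \<Omega>: "open \<Omega>" and f: "locally_integrable \<Omega> f"
  shows "f \<in> borel_measurable (lebesgue_on \<Omega>)"
proof -
  obtain a b :: "nat \<Rightarrow> real ^ 'd" where ab: "\<And>n. cbox (a n) (b n) \<subseteq> \<Omega>" "\<Omega> = (\<Union>n. box (a n) (b n))"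
    using open_countable_box_cover[OF \<Omega>] by metis
  show ?thesis
  proof (rule measurable_piecewise_restrict[where C="range (\<lambda>n. cbox (a n) (b n))"])
    fix K assume "K \<in> range (\<lambda>n. cbox (a n) (b n))"
    then obtain n where K: "K = cbox (a n) (b n)" by auto
    have KO: "\<Omega> \<inter> K = K" using ab(1)[of n] K by auto
    show "K \<inter> space (lebesgue_on \<Omega>) \<in> sets (lebesgue_on \<Omega>)"
      using KO K \<Omega> by (subst sets_restrict_space_iff) (auto simp: Int_commute)
    have "integrable (lebesgue_on K) f" using f ab(1)[of n] K by (auto simp: locally_integrable_def)
    then show "f \<in> borel_measurable (restrict_space (lebesgue_on \<Omega>) K)"
      using KO K \<Omega> by (subst restrict_restrict_space) auto
  next
    show "space (lebesgue_on \<Omega>) \<subseteq> \<Union> (range (\<lambda>n. cbox (a n) (b n)))"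
      unfolding space_lebesgue_on ab(2) by (intro UN_mono box_subset_cbox subset_refl)
  qed simp
qed

lemma locally_integrable_test:
  fixes f :: "real ^ 'd \<Rightarrow> real"
  assumes \<Omega>: "open \<Omega>" and f: "locally_integrable \<Omega> f" and \<phi>: "\<phi> \<in> test_functions \<Omega>"
  shows "integrable (lebesgue_on \<Omega>) (\<lambda>x. f x * \<phi> x)"
proof -
  let ?K = "closure {x. \<phi> x \<noteq> 0}"
  obtain B where B: "B > 0" "\<And>x. \<bar>\<phi> x\<bar> \<le> B" using test_functions_bounded[OF \<phi>] by metis
  have K: "compact ?K" "?K \<subseteq> \<Omega>" by (rule test_functionsD[OF \<phi>])+
  have "integrable (lebesgue_on ?K) f" using f K by (simp add: locally_integrable_def)
  then have "integrable lebesgue (\<lambda>x. indicator ?K x *\<^sub>R f x)"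
    by (subst (asm) integrable_restrict_space) auto
  then have "integrable lebesgue (\<lambda>x. \<phi> x * (indicator ?K x *\<^sub>R f x))"
    using borel_lebesgue_on[OF test_functions_measurable[OF \<phi>], of UNIV]
    by (intro integrable_bounded_mult[OF _ B(2)]) (auto simp: lebesgue_on_UNIV_eq)
  also have "(\<lambda>x. \<phi> x * (indicator ?K x *\<^sub>R f x)) = (\<lambda>x. indicator \<Omega> x *\<^sub>R (f x * \<phi> x))"
    using K(2) closure_subset[of "{x. \<phi> x \<noteq> 0}"] by (auto simp: fun_eq_iff indicator_def)
  finally show ?thesis using \<Omega> by (subst integrable_restrict_space) auto
qed

lemma locally_integrable_nth:
  fixes f :: "real ^ 'd \<Rightarrow> 'b::euclidean_space ^ 'm"
  shows "locally_integrable \<Omega> f \<Longrightarrow> locally_integrable \<Omega> (\<lambda>x. f x $ i)"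
  unfolding locally_integrable_def by (auto intro: integrable_bounded_linear[OF
      bounded_linear_vec_nth])

lemma has_weak_derivative_diff:
  assumes \<Omega>: "open \<Omega>" and u: "has_weak_derivative \<Omega> u G" and v: "has_weak_derivative \<Omega> v H"
  shows "has_weak_derivative \<Omega> (\<lambda>x. u x - v x) (\<lambda>x. G x - H x)"
  unfolding has_weak_derivative_def
proof (intro conjI ballI allI)
  have lu: "locally_integrable \<Omega> u" "locally_integrable \<Omega> v" and lG: "locally_integrable \<Omega> G"
      "locally_integrable \<Omega> H"
    using u v by (auto simp: has_weak_derivative_def)
  then show "locally_integrable \<Omega> (\<lambda>x. u x - v x)" "locally_integrable \<Omega> (\<lambda>x. G x - H x)"
    by (auto simp: locally_integrable_def)
  fix \<phi> i k assume \<phi>: "\<phi> \<in> test_functions \<Omega>"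
  note t1 = locally_integrable_test[OF \<Omega> locally_integrable_nth test_functions_deriv[OF \<phi>]]
  note t2 = locally_integrable_test[OF \<Omega> locally_integrable_nth[OF locally_integrable_nth] \<phi>]
  have "(LINT x|lebesgue_on \<Omega>. (u x - v x) $ i * frechet_derivative \<phi> (at x) (axis k 1)) =
     (LINT x|lebesgue_on \<Omega>. u x $ i * frechet_derivative \<phi> (at x) (axis k 1)) - (LINT x|lebesgue_on
         \<Omega>. v x $ i * frechet_derivative \<phi> (at x) (axis k 1))"
    unfolding vector_minus_component left_diff_distrib
    by (rule Bochner_Integration.integral_diff[OF t1[OF lu(1)] t1[OF lu(2)]])
  moreover have "(LINT x|lebesgue_on \<Omega>. (G x - H x) $ i $ k * \<phi> x) =
     (LINT x|lebesgue_on \<Omega>. G x $ i $ k * \<phi> x) - (LINT x|lebesgue_on \<Omega>. H x $ i $ k * \<phi> x)"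
    unfolding vector_minus_component left_diff_distrib
    by (rule Bochner_Integration.integral_diff[OF t2[OF lG(1)] t2[OF lG(2)]])
  ultimately show "(LINT x|lebesgue_on \<Omega>. (u x - v x) $ i * frechet_derivative \<phi> (at x) (axis k 1))
      =
        - (LINT x|lebesgue_on \<Omega>. (G x - H x) $ i $ k * \<phi> x)"
    using u v \<phi> by (simp add: has_weak_derivative_def)
qed

text \<open>The difference of two weak derivatives is a weak derivative of 0, so its entries are
  annihilated by all test functions. A Borel representative of it is passed to
  \<open>weak_derivative_unique\<close>.\<close>

lemma has_weak_derivative_unique:
  fixes u :: "real ^ 'd \<Rightarrow> real ^ 'm"
  assumes \<Omega>: "open \<Omega>" and u: "has_weak_derivative \<Omega> u G" "has_weak_derivative \<Omega> u H"
  shows "AE x in lebesgue_on \<Omega>. G x = H x"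
proof -
  have b\<Omega>: "\<Omega> \<in> sets borel" using \<Omega> by simp
  define E where "E x = G x - H x" for x
  have E: "has_weak_derivative \<Omega> (\<lambda>x. 0) E"
    using has_weak_derivative_diff[OF \<Omega> u] by (simp add: E_def[abs_def])
  then have lE: "locally_integrable \<Omega> E" by (simp add: has_weak_derivative_def)
  have mE: "E \<in> borel_measurable (lebesgue_on \<Omega>)" by (rule locally_integrable_measurable[OF \<Omega> lE])
  obtain D where D: "D \<in> borel_measurable borel" "\<And>x. x \<notin> \<Omega> \<Longrightarrow> D x = 0" "AE x in lebesgue_on \<Omega>. E x =
      D x"
    using borel_representative[OF b\<Omega> mE] by metis
  note [measurable] = D(1)
  have aeD: "AE x in lebesgue. x \<in> \<Omega> \<longrightarrow> E x = D x" using D(3) b\<Omega> by (simp add: AE_restrict_space_iff)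
  have "AE x in lborel. x \<in> \<Omega> \<longrightarrow> D x $ i $ k = 0" for i k
  proof (rule weak_derivative_unique[OF \<Omega>])
    fix K assume K: "compact K" "K \<subseteq> \<Omega>"
    have [measurable]: "K \<in> sets borel" using K by (simp add: compact_imp_closed)
    have "integrable (lebesgue_on K) (\<lambda>x. E x $ i $ k)"
      using locally_integrable_nth[OF locally_integrable_nth[OF lE]] K by (simp add:
          locally_integrable_def)
    then have i: "integrable lebesgue (\<lambda>x. indicator K x *\<^sub>R (E x $ i $ k))"
      by (subst (asm) integrable_restrict_space) auto
    have m: "(\<lambda>x. indicator K x * D x $ i $ k) \<in> borel_measurable lborel" by measurable
    have "integrable lebesgue (\<lambda>x. indicator K x * D x $ i $ k)"
    proof (rule integrable_cong_AE_imp[OF i])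
      show "(\<lambda>x. indicator K x * D x $ i $ k) \<in> borel_measurable lebesgue" by (rule
          measurable_completion[OF m])
      show "AE x in lebesgue. indicator K x *\<^sub>R (E x $ i $ k) = indicator K x * D x $ i $ k"
        using aeD by eventually_elim (use K(2) in \<open>auto simp: indicator_def\<close>)
    qed
    then show "integrable lborel (\<lambda>x. indicator K x * D x $ i $ k)" using m by (simp add:
        integrable_completion)
  next
    fix \<phi> assume \<phi>: "\<phi> \<in> test_functions \<Omega>"
    have [measurable]: "\<phi> \<in> borel_measurable borel" by (rule test_functions_measurable[OF \<phi>])
    have "(LINT x|lborel. D x $ i $ k * \<phi> x) = (LINT x|restrict_space lborel \<Omega>. D x $ i $ k * \<phi> x)"
      by (rule restrict_lborel(2)[OF b\<Omega>, symmetric]) (simp add: D(2))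
    also have "\<dots> = (LINT x|lebesgue_on \<Omega>. D x $ i $ k * \<phi> x)"
      by (rule lebesgue_on_borel(2)[OF b\<Omega>, symmetric]) measurable
    also have "\<dots> = (LINT x|lebesgue_on \<Omega>. E x $ i $ k * \<phi> x)"
    proof (rule integral_cong_AE)
      show "(\<lambda>x. D x $ i $ k * \<phi> x) \<in> borel_measurable (lebesgue_on \<Omega>)" by (rule borel_lebesgue_on)
          measurable
      show "(\<lambda>x. E x $ i $ k * \<phi> x) \<in> borel_measurable (lebesgue_on \<Omega>)"
        by (intro borel_measurable_times borel_measurable_vec_nth mE borel_lebesgue_on
            test_functions_measurable[OF \<phi>])
      show "AE x in lebesgue_on \<Omega>. D x $ i $ k * \<phi> x = E x $ i $ k * \<phi> x" using D(3) by
          eventually_elim simp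
    qed
    also have "\<dots> = 0"
    proof -
      have "(LINT x|lebesgue_on \<Omega>. (0 :: real^'m) $ i * frechet_derivative \<phi> (at x) (axis k 1)) = -
          (LINT x|lebesgue_on \<Omega>. E x $ i $ k * \<phi> x)"
        using E \<phi> unfolding has_weak_derivative_def by blast
      then show ?thesis by simp
    qed
    finally show "(LINT x|lborel. D x $ i $ k * \<phi> x) = 0" .
  qed
  then have "AE x in lborel. \<forall>i k. x \<in> \<Omega> \<longrightarrow> D x $ i $ k = 0"
    by (intro AE_all_countable[THEN iffD2] allI)
  then have "AE x in lborel. x \<in> \<Omega> \<longrightarrow> D x = 0" by eventually_elim (simp add: vec_eq_iff)
  then have "AE x in lebesgue_on \<Omega>. D x = 0" using b\<Omega> by (simp add: AE_restrict_space_iff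
      AE_completion_iff)
  with D(3) show ?thesis by eventually_elim (simp add: E_def)
qed

text \<open>\<open>weak_D\<close> is an arbitrary choice, but as soon as some weak derivative exists
  the choice is one itself, hence measurable and unique up to null sets.\<close>

lemma weak_D_eq:
  assumes "open \<Omega>" "has_weak_derivative \<Omega> u G"
  shows "AE x in lebesgue_on \<Omega>. weak_D \<Omega> u x = G x"
    and "weak_D \<Omega> u \<in> borel_measurable (lebesgue_on \<Omega>)"
proof -
  have w: "has_weak_derivative \<Omega> u (weak_D \<Omega> u)" unfolding weak_D_def by (rule someI[where
      P="has_weak_derivative \<Omega> u", OF assms(2)])
  show "AE x in lebesgue_on \<Omega>. weak_D \<Omega> u x = G x" by (rule has_weak_derivative_unique[OF assms(1) w
      assms(2)])
  show "weak_D \<Omega> u \<in> borel_measurable (lebesgue_on \<Omega>)"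
    using w by (intro locally_integrable_measurable assms(1)) (simp add: has_weak_derivative_def)
qed

text \<open>Passing to representatives changes no integral, and the values 0 off
  \<open>\<Omega>\<close> turn integrals over \<open>\<Omega>\<close> into integrals over the whole
  space.\<close>

lemma weak_grad_of_weak_derivative:
  fixes U :: "real ^ 'd \<Rightarrow> real ^ 'm"
  assumes \<Omega>: "open \<Omega>" and w: "has_weak_derivative \<Omega> u G"
    and U: "U \<in> borel_measurable borel" "\<And>x. x \<notin> \<Omega> \<Longrightarrow> U x = 0" "AE x in lebesgue_on \<Omega>. u x = U x"
    and H: "H \<in> borel_measurable borel" "\<And>x. x \<notin> \<Omega> \<Longrightarrow> H x = 0" "AE x in lebesgue_on \<Omega>. G x = H x"
  shows "weak_grad \<Omega> (\<lambda>x. U x $ i) (\<lambda>k x. H x $ i $ k)"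
  unfolding weak_grad_def
proof (intro ballI allI)
  fix \<phi> k assume \<phi>: "\<phi> \<in> test_functions \<Omega>"
  have b\<Omega>: "\<Omega> \<in> sets borel" using \<Omega> by simp
  have mu: "u \<in> borel_measurable (lebesgue_on \<Omega>)" "G \<in> borel_measurable (lebesgue_on \<Omega>)"
    using w by (auto intro!: locally_integrable_measurable[OF \<Omega>] simp: has_weak_derivative_def)
  note [measurable] = U(1) H(1)
  have [measurable]: "\<phi> \<in> borel_measurable borel" "pd k \<phi> \<in> borel_measurable borel"
    by (rule test_functions_measurable[OF \<phi>], rule test_functions_measurable[OF test_functions_pd[OF
        \<phi>]])
  have "(LINT x|lborel. U x $ i * pd k \<phi> x) = (LINT x|restrict_space lborel \<Omega>. U x $ i * pd k \<phi> x)"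
    by (rule restrict_lborel(2)[OF b\<Omega>, symmetric]) (simp add: U(2))
  also have "\<dots> = (LINT x|lebesgue_on \<Omega>. U x $ i * pd k \<phi> x)"
    by (rule lebesgue_on_borel(2)[OF b\<Omega>, symmetric]) measurable
  also have "\<dots> = (LINT x|lebesgue_on \<Omega>. u x $ i * pd k \<phi> x)"
  proof (rule integral_cong_AE)
    show "(\<lambda>x. U x $ i * pd k \<phi> x) \<in> borel_measurable (lebesgue_on \<Omega>)" by (rule borel_lebesgue_on)
        measurable
    show "(\<lambda>x. u x $ i * pd k \<phi> x) \<in> borel_measurable (lebesgue_on \<Omega>)"
      by (intro borel_measurable_times borel_measurable_vec_nth mu borel_lebesgue_on
          test_functions_measurable[OF test_functions_pd[OF \<phi>]])
    show "AE x in lebesgue_on \<Omega>. U x $ i * pd k \<phi> x = u x $ i * pd k \<phi> x" using U(3) by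
        eventually_elim simp
  qed
  also have "\<dots> = - (LINT x|lebesgue_on \<Omega>. G x $ i $ k * \<phi> x)"
    using w \<phi> by (simp add: has_weak_derivative_def pd_def)
  also have "(LINT x|lebesgue_on \<Omega>. G x $ i $ k * \<phi> x) = (LINT x|lebesgue_on \<Omega>. H x $ i $ k * \<phi> x)"
  proof (rule integral_cong_AE)
    show "(\<lambda>x. H x $ i $ k * \<phi> x) \<in> borel_measurable (lebesgue_on \<Omega>)" by (rule borel_lebesgue_on)
        measurable
    show "(\<lambda>x. G x $ i $ k * \<phi> x) \<in> borel_measurable (lebesgue_on \<Omega>)"
      by (intro borel_measurable_times borel_measurable_vec_nth mu borel_lebesgue_on
          test_functions_measurable[OF \<phi>])
    show "AE x in lebesgue_on \<Omega>. G x $ i $ k * \<phi> x = H x $ i $ k * \<phi> x" using H(3) by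
        eventually_elim simp
  qed
  also have "\<dots> = (LINT x|restrict_space lborel \<Omega>. H x $ i $ k * \<phi> x)"
    by (rule lebesgue_on_borel(2)[OF b\<Omega>]) measurable
  also have "\<dots> = (LINT x|lborel. H x $ i $ k * \<phi> x)"
    by (rule restrict_lborel(2)[OF b\<Omega>]) (simp add: H(2))
  finally show "(LINT x|lborel. U x $ i * pd k \<phi> x) = - (LINT x|lborel. H x $ i $ k * \<phi> x)" .
qed

lemma has_weak_derivative_of_weak_grad:
  fixes V :: "real ^ 'd \<Rightarrow> real ^ 'm"
  assumes \<Omega>: "open \<Omega>" and w: "\<And>i. weak_grad \<Omega> (\<lambda>x. V x $ i) (\<lambda>k x. H x $ i $ k)"
    and V: "V \<in> borel_measurable borel" "\<And>x. x \<notin> \<Omega> \<Longrightarrow> V x = 0" "integrable lborel V"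
    and H: "H \<in> borel_measurable borel" "\<And>x. x \<notin> \<Omega> \<Longrightarrow> H x = 0" "integrable lborel H"
  shows "has_weak_derivative \<Omega> V H"
  unfolding has_weak_derivative_def
proof (intro conjI ballI allI)
  have b\<Omega>: "\<Omega> \<in> sets borel" using \<Omega> by simp
  note [measurable] = V(1) H(1)
  have loc: "locally_integrable \<Omega> f" if "integrable lborel f" "f \<in> borel_measurable borel" for f ::
      "real^'d \<Rightarrow> 'c::euclidean_space"
    unfolding locally_integrable_def
  proof (intro allI impI)
    fix K assume "compact K \<and> K \<subseteq> \<Omega>"
    then have "K \<in> sets borel" by (simp add: compact_imp_closed)
    then show "integrable (lebesgue_on K) f"
      using that integrable_restrict_lborel by (subst lebesgue_on_borel(1)) auto
  qed
  show "locally_integrable \<Omega> V" by (rule loc) (use V in auto)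
  show "locally_integrable \<Omega> H" by (rule loc) (use H in auto)
  fix \<phi> i k assume \<phi>: "\<phi> \<in> test_functions \<Omega>"
  have [measurable]: "\<phi> \<in> borel_measurable borel" "pd k \<phi> \<in> borel_measurable borel"
    by (rule test_functions_measurable[OF \<phi>], rule test_functions_measurable[OF test_functions_pd[OF
        \<phi>]])
  have "(LINT x|lebesgue_on \<Omega>. V x $ i * pd k \<phi> x) = (LINT x|lborel. V x $ i * pd k \<phi> x)"
    by (subst lebesgue_on_borel(2)[OF b\<Omega>], measurable, rule restrict_lborel(2)[OF b\<Omega>]) (simp add:
        V(2))
  moreover have "(LINT x|lebesgue_on \<Omega>. H x $ i $ k * \<phi> x) = (LINT x|lborel. H x $ i $ k * \<phi> x)"
    by (subst lebesgue_on_borel(2)[OF b\<Omega>], measurable, rule restrict_lborel(2)[OF b\<Omega>]) (simp add: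
        H(2))
  ultimately show "(LINT x|lebesgue_on \<Omega>. V x $ i * frechet_derivative \<phi> (at x) (axis k 1)) = -
      (LINT x|lebesgue_on \<Omega>. H x $ i $ k * \<phi> x)"
    using w[of i] \<phi> by (simp add: weak_grad_def pd_def)
qed

section \<open>Compactness in Sobolev spaces\<close>

lemma Lp_mono:
  fixes f :: "real ^ 'd \<Rightarrow> 'b::euclidean_space"
  assumes \<Omega>: "open \<Omega>" "bounded \<Omega>" and f: "f \<in> Lp p \<Omega>" and q: "0 < q" "q \<le> p"
  shows "f \<in> Lp q \<Omega>"
proof -
  interpret L: finite_measure "lebesgue_on \<Omega>" using \<Omega> by (intro finite_measure_lebesgue_on) auto
  have "f \<in> borel_measurable (lebesgue_on \<Omega>)" "integrable (lebesgue_on \<Omega>) (\<lambda>x. norm (f x) powr p)"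
    using f by (auto simp: Lp_def)
  then show ?thesis unfolding Lp_def using q L.integrable_powr_le[of "\<lambda>x. norm (f x)" q p] by auto
qed

lemma W1p_mono:
  "open \<Omega> \<Longrightarrow> bounded \<Omega> \<Longrightarrow> u \<in> W1p p \<Omega> \<Longrightarrow> 0 < q \<Longrightarrow> q \<le> p \<Longrightarrow> u \<in> W1p q \<Omega>"
  unfolding W1p_def by (auto intro: Lp_mono)

theorem compactness_in_W1p:
  fixes \<Omega> :: "(real ^ 2) set" and U :: "nat \<Rightarrow> real ^ 2 \<Rightarrow> real ^ 'm"
  assumes \<Omega>: "open \<Omega>" "bounded \<Omega>" and p: "2 < p" and bU: "bounded_in_W1p p \<Omega> U"
    and S: "closed S" "S \<noteq> {}"
    and dist0: "\<And>\<eta>. \<eta> \<in> test_functions \<Omega> \<Longrightarrow>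
      (\<lambda>j. LINT x|lebesgue_on \<Omega>. infdist (weak_D \<Omega> (U j) x) S * \<eta> x) \<longlonglongrightarrow> 0"
    and alg: "\<And>M1 M2. M1 \<in> S \<Longrightarrow> M2 \<in> S \<Longrightarrow> 0 \<le> null_lag c1 (M1 - M2)"
      "\<And>M1 M2. M1 \<in> S \<Longrightarrow> M2 \<in> S \<Longrightarrow> null_lag c1 (M1 - M2) = 0 \<Longrightarrow> 0 \<le> null_lag c2 (M1 - M2)"
      "\<And>M1 M2. M1 \<in> S \<Longrightarrow> M2 \<in> S \<Longrightarrow> null_lag c1 (M1 - M2) = 0 \<Longrightarrow> null_lag c2 (M1 - M2) = 0 \<Longrightarrow> M1 = M2"
  shows "\<exists>(r :: nat \<Rightarrow> nat) V. strict_mono r \<and>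
    (\<forall>q. 1 \<le> q \<and> q < p \<longrightarrow> converges_in_W1p q \<Omega> (U \<circ> r) V) \<and>
    (AE x in lebesgue_on \<Omega>. weak_D \<Omega> V x \<in> S)"
proof -
  let ?L = "lebesgue_on \<Omega>" and ?N = "restrict_space lborel \<Omega>"
  have b\<Omega>: "\<Omega> \<in> sets borel" using \<Omega> by simp
  have W: "U j \<in> W1p p \<Omega>" for j using bU by (simp add: bounded_in_W1p_def)
  obtain M0 where M0: "\<And>j. W1p_norm p \<Omega> (U j) \<le> M0" using bU by (auto simp: bounded_in_W1p_def)
  have "\<forall>j. \<exists>G. has_weak_derivative \<Omega> (U j) G \<and> G \<in> Lp p \<Omega>" using W by (simp add: W1p_def)
  then obtain D where D: "\<And>j. has_weak_derivative \<Omega> (U j) (D j)" "\<And>j. D j \<in> Lp p \<Omega>" by metis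
  have UL: "U j \<in> Lp p \<Omega>" for j using W by (simp add: W1p_def)
  have mU: "U j \<in> borel_measurable ?L" and mD: "D j \<in> borel_measurable ?L" for j
    using UL[of j] D(2)[of j] by (auto simp: Lp_def)
  have "\<forall>j. \<exists>g. g \<in> borel_measurable borel \<and> (\<forall>x. x \<notin> \<Omega> \<longrightarrow> g x = 0) \<and> (AE x in ?L. U j x = g x)"
    by (rule allI, rule borel_representative[OF b\<Omega> mU]) blast
  from choice[OF this] obtain u where u0: "\<forall>j. u j \<in> borel_measurable borel \<and> (\<forall>x. x \<notin> \<Omega> \<longrightarrow> u j x =
      0) \<and> (AE x in ?L. U j x = u j x)" ..
  then have u: "\<And>j. u j \<in> borel_measurable borel" "\<And>j x. x \<notin> \<Omega> \<Longrightarrow> u j x = 0" "\<And>j. AE x in ?L. U j x =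
      u j x"
    by blast+
  have "\<forall>j. \<exists>g. g \<in> borel_measurable borel \<and> (\<forall>x. x \<notin> \<Omega> \<longrightarrow> g x = 0) \<and> (AE x in ?L. D j x = g x)"
    by (rule allI, rule borel_representative[OF b\<Omega> mD]) blast
  from choice[OF this] obtain g where g0: "\<forall>j. g j \<in> borel_measurable borel \<and> (\<forall>x. x \<notin> \<Omega> \<longrightarrow> g j x =
      0) \<and> (AE x in ?L. D j x = g j x)" ..
  then have g: "\<And>j. g j \<in> borel_measurable borel" "\<And>j x. x \<notin> \<Omega> \<Longrightarrow> g j x = 0" "\<And>j. AE x in ?L. D j x =
      g j x"
    by blast+
  note [measurable] = u(1) g(1)
  have wD: "AE x in ?L. weak_D \<Omega> (U j) x = g j x" and mwD: "weak_D \<Omega> (U j) \<in> borel_measurable ?L"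
      for j
  proof -
    show "AE x in ?L. weak_D \<Omega> (U j) x = g j x"
      using weak_D_eq(1)[OF \<Omega>(1) D(1)[of j]] g(3)[of j] by eventually_elim simp
    show "weak_D \<Omega> (U j) \<in> borel_measurable ?L" by (rule weak_D_eq(2)[OF \<Omega>(1) D(1)])
  qed
  \<comment> \<open>Used both for maps and for gradients, hence with a free range type.\<close>
  have transfer: "integrable lborel (\<lambda>x. norm (h x) powr p)" "(LINT x|lborel. norm (h x) powr p) =
      (LINT x|?L. norm (f x) powr p)"
    if f: "f \<in> borel_measurable ?L" "integrable ?L (\<lambda>x. norm (f x) powr p)" and [measurable]: "h \<in>
        borel_measurable borel"
      and h: "\<And>x. x \<notin> \<Omega> \<Longrightarrow> h x = 0" "AE x in ?L. f x = h x" for f h :: "real ^ 2 \<Rightarrow>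
          'b::euclidean_space"
  proof -
    have m: "(\<lambda>x. norm (h x) powr p) \<in> borel_measurable borel" by measurable
    have ae: "AE x in ?L. norm (f x) powr p = norm (h x) powr p" using h(2) by eventually_elim simp
    have z: "norm (h x) powr p = 0" if "x \<notin> \<Omega>" for x using h(1)[OF that] by simp
    have "integrable ?L (\<lambda>x. norm (h x) powr p)"
      by (rule integrable_cong_AE_imp[OF f(2) borel_lebesgue_on[OF m] ae])
    then have "integrable ?N (\<lambda>x. norm (h x) powr p)" by (rule iffD1[OF lebesgue_on_borel(1)[OF b\<Omega>
        m]])
    then show "integrable lborel (\<lambda>x. norm (h x) powr p)"
      by (rule iffD1[OF restrict_lborel(1)[OF b\<Omega>], rotated]) (rule z)
    have "(LINT x|lborel. norm (h x) powr p) = (LINT x|?N. norm (h x) powr p)"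
      by (rule restrict_lborel(2)[OF b\<Omega>, symmetric]) (rule z)
    also have "\<dots> = (LINT x|?L. norm (h x) powr p)" by (rule lebesgue_on_borel(2)[OF b\<Omega> m,
        symmetric])
    also have "\<dots> = (LINT x|?L. norm (f x) powr p)"
      by (rule integral_cong_AE) (use f(1) borel_lebesgue_on[OF m] ae in \<open>auto elim:
          eventually_mono\<close>)
    finally show "(LINT x|lborel. norm (h x) powr p) = (LINT x|?L. norm (f x) powr p)" .
  qed
  note tU = transfer[OF mU _ u(1) u(2) u(3)] and tG = transfer[OF mwD _ g(1) g(2) wD]
  have iU: "integrable ?L (\<lambda>x. norm (U j x) powr p)" for j using UL[of j] by (simp add: Lp_def)
  have iwD: "integrable ?L (\<lambda>x. norm (weak_D \<Omega> (U j) x) powr p)" for j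
  proof -
    have "integrable ?L (\<lambda>x. norm (D j x) powr p)" using D(2)[of j] by (simp add: Lp_def)
    then show ?thesis
    proof (rule integrable_cong_AE_imp)
      show "(\<lambda>x. norm (weak_D \<Omega> (U j) x) powr p) \<in> borel_measurable ?L" using mwD[of j] by
          measurable
      show "AE x in ?L. norm (D j x) powr p = norm (weak_D \<Omega> (U j) x) powr p"
        using weak_D_eq(1)[OF \<Omega>(1) D(1)[of j]] by eventually_elim simp
    qed
  qed
  \<comment> \<open>\<open>W1p_norm\<close> contains the exponent \<open>1/p\<close>, so the bound
    \<open>M0\<close> on it becomes a \<open>p\<close>-th power for each of the two integrals;
    \<open>max\<close> secures a nonnegative base.\<close>
  define C where "C = max M0 0 powr p"
  have bnd: "(LINT x|?L. norm (U j x) powr p) \<le> C" "(LINT x|?L. norm (weak_D \<Omega> (U j) x) powr p) \<le> C"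
      for j
  proof -
    let ?a = "LINT x|?L. norm (U j x) powr p" and ?b = "LINT x|?L. norm (weak_D \<Omega> (U j) x) powr p"
    have nn: "0 \<le> ?a" "0 \<le> ?b" by (auto intro!: Bochner_Integration.integral_nonneg)
    have "?a + ?b = ((?a + ?b) powr (1 / p)) powr p" using p nn by (simp add: powr_powr)
    also have "\<dots> \<le> C" unfolding C_def using M0[of j] p by (intro powr_mono2) (auto simp:
        W1p_norm_def)
    finally have "?a + ?b \<le> C" .
    with nn show "?a \<le> C" "?b \<le> C" by linarith+
  qed
  interpret sobolev_bounded \<Omega> p C u g
  proof unfold_locales
    show "integrable lborel (\<lambda>x. norm (u j x) powr p)" for j by (rule tU(1)[OF iU])
    show "integrable lborel (\<lambda>x. norm (g j x) powr p)" for j by (rule tG(1)[OF iwD])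
    show "(LINT x|lborel. norm (u j x) powr p) \<le> C" for j using tU(2)[OF iU] bnd(1)[of j] by simp
    show "(LINT x|lborel. norm (g j x) powr p) \<le> C" for j using tG(2)[OF iwD] bnd(2)[of j] by simp
    show "weak_grad \<Omega> (\<lambda>x. u j x $ i) (\<lambda>k x. g j x $ i $ k)" for i j
      by (rule weak_grad_of_weak_derivative[OF \<Omega>(1) D(1) u g])
  qed (use \<Omega> p u g in auto)
  have dist1: "(\<lambda>j. LINT x|N. infdist (g j x) S * \<eta> x) \<longlonglongrightarrow> 0" if \<eta>: "\<eta> \<in> test_functions \<Omega>" for \<eta>
  proof -
    have [measurable]: "\<eta> \<in> borel_measurable borel" by (rule test_functions_measurable[OF \<eta>])
    have mi[measurable]: "(\<lambda>M. infdist M S) \<in> borel_measurable borel"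
      by (intro borel_measurable_continuous_onI continuous_intros)
    have "(LINT x|?L. infdist (weak_D \<Omega> (U j) x) S * \<eta> x) = (LINT x|N. infdist (g j x) S * \<eta> x)" for
        j
    proof -
      have m: "(\<lambda>x. infdist (g j x) S * \<eta> x) \<in> borel_measurable borel" by measurable
      have m2: "(\<lambda>x. infdist (weak_D \<Omega> (U j) x) S * \<eta> x) \<in> borel_measurable ?L"
        by (intro borel_measurable_times measurable_compose[OF mwD mi] borel_lebesgue_on
            test_functions_measurable[OF \<eta>])
      have "(LINT x|?L. infdist (weak_D \<Omega> (U j) x) S * \<eta> x) = (LINT x|?L. infdist (g j x) S * \<eta> x)"
        by (rule integral_cong_AE[OF m2 borel_lebesgue_on[OF m]]) (use wD[of j] in \<open>eventually_elim,
            simp\<close>)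
      then show ?thesis using lebesgue_on_borel(2)[OF b\<Omega> m] by simp
    qed
    then show ?thesis using dist0[OF \<eta>] by simp
  qed
  obtain r V H where r: "strict_mono (r :: nat \<Rightarrow> nat)" and mV[measurable]: "V \<in> borel_measurable
      borel" "H \<in> borel_measurable borel"
    and out: "\<And>x. x \<notin> \<Omega> \<Longrightarrow> V x = 0" "\<And>x. x \<notin> \<Omega> \<Longrightarrow> H x = 0"
    and iV: "integrable N (\<lambda>x. norm (V x) powr p)" "integrable N (\<lambda>x. norm (H x) powr p)"
    and cV: "\<And>q. 1 \<le> q \<Longrightarrow> q < p \<Longrightarrow> (\<lambda>n. LINT x|N. norm (u (r n) x - V x) powr q) \<longlonglongrightarrow> 0"
    and cH: "\<And>q. 1 \<le> q \<Longrightarrow> q < p \<Longrightarrow> (\<lambda>n. LINT x|N. norm (g (r n) x - H x) powr q) \<longlonglongrightarrow> 0"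
    and wV: "\<And>i. weak_grad \<Omega> (\<lambda>x. V x $ i) (\<lambda>k x. H x $ i $ k)"
    and HS: "AE x in N. H x \<in> S"
    using compensated_compactness[OF S dist1 alg] by blast
  have VL: "V \<in> Lp p \<Omega>" "H \<in> Lp p \<Omega>"
    using iV borel_lebesgue_on[OF mV(1)] borel_lebesgue_on[OF mV(2)] lebesgue_on_borel(1)[OF b\<Omega>, of
        "\<lambda>x. norm (V x) powr p"] lebesgue_on_borel(1)[OF b\<Omega>, of "\<lambda>x. norm (H x) powr p"]
    by (auto simp: Lp_def)
  have z: "norm (V x) powr p = 0" "norm (H x) powr p = 0" if "x \<notin> \<Omega>" for x using out[OF that] by
      simp_all
  have "integrable lborel (\<lambda>x. norm (V x) powr p)"
    by (rule iffD1[OF restrict_lborel(1)[OF b\<Omega>] iV(1)]) (rule z(1))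
  moreover have "integrable lborel (\<lambda>x. norm (H x) powr p)"
    by (rule iffD1[OF restrict_lborel(1)[OF b\<Omega>] iV(2)]) (rule z(2))
  ultimately have iVH: "integrable lborel V" "integrable lborel H"
    by (auto intro: integrable_of_powr mV out)
  have wdV: "has_weak_derivative \<Omega> V H"
    by (rule has_weak_derivative_of_weak_grad[OF \<Omega>(1) wV mV(1) out(1) iVH(1) mV(2) out(2) iVH(2)])
  have VW: "V \<in> W1p p \<Omega>" using VL wdV by (auto simp: W1p_def)
  have "converges_in_W1p q \<Omega> (U \<circ> r) V" if q: "1 \<le> q" "q < p" for q
    unfolding converges_in_W1p_def
  proof (intro conjI allI)
    show "(U \<circ> r) j \<in> W1p q \<Omega>" for j using W1p_mono[OF \<Omega> W[of "r j"], of q] q by simp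
    show "V \<in> W1p q \<Omega>" using W1p_mono[OF \<Omega> VW, of q] q by simp
    \<comment> \<open>The norm of a difference involves \<open>weak_D\<close> of that difference, a
      choice of its own; it agrees almost everywhere with \<open>g (r j) - H\<close>.\<close>
    let ?wd = "\<lambda>j. weak_D \<Omega> (\<lambda>x. U (r j) x - V x)"
    have a: "(LINT x|?L. norm (U (r j) x - V x) powr q) = (LINT x|N. norm (u (r j) x - V x) powr q)"
        for j
    proof -
      have m: "(\<lambda>x. norm (u (r j) x - V x) powr q) \<in> borel_measurable borel" by measurable
      have m2: "(\<lambda>x. norm (U (r j) x - V x) powr q) \<in> borel_measurable ?L"
        by (rule measurable_compose[OF borel_measurable_diff[OF mU borel_lebesgue_on[OF mV(1)]]])
            measurable
      have "(LINT x|?L. norm (U (r j) x - V x) powr q) = (LINT x|?L. norm (u (r j) x - V x) powr q)"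
        by (rule integral_cong_AE[OF m2 borel_lebesgue_on[OF m]]) (use u(3)[of "r j"] in
            \<open>eventually_elim, simp\<close>)
      then show ?thesis using lebesgue_on_borel(2)[OF b\<Omega> m] by simp
    qed
    have b: "(LINT x|?L. norm (?wd j x) powr q) = (LINT x|N. norm (g (r j) x - H x) powr q)" for j
    proof -
      note wdd = has_weak_derivative_diff[OF \<Omega>(1) D(1)[of "r j"] wdV]
      have m: "(\<lambda>x. norm (g (r j) x - H x) powr q) \<in> borel_measurable borel" by measurable
      have m2: "(\<lambda>x. norm (?wd j x) powr q) \<in> borel_measurable ?L"
        using weak_D_eq(2)[OF \<Omega>(1) wdd] by measurable
      have "AE x in ?L. norm (?wd j x) powr q = norm (g (r j) x - H x) powr q"
        using weak_D_eq(1)[OF \<Omega>(1) wdd] g(3)[of "r j"] by eventually_elim simp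
      then have "(LINT x|?L. norm (?wd j x) powr q) = (LINT x|?L. norm (g (r j) x - H x) powr q)"
        by (rule integral_cong_AE[OF m2 borel_lebesgue_on[OF m]])
      then show ?thesis using lebesgue_on_borel(2)[OF b\<Omega> m] by simp
    qed
    have "(\<lambda>j. (LINT x|N. norm (u (r j) x - V x) powr q) + (LINT x|N. norm (g (r j) x - H x) powr
        q)) \<longlonglongrightarrow> 0"
      using tendsto_add[OF cV[OF q] cH[OF q]] by simp
    then have "(\<lambda>j. ((LINT x|N. norm (u (r j) x - V x) powr q) + (LINT x|N. norm (g (r j) x - H x)
        powr q)) powr (1 / q)) \<longlonglongrightarrow> 0 powr (1 / q)"
      using q by (intro tendsto_powr2 tendsto_const) (auto intro!: always_eventually
          add_nonneg_nonneg Bochner_Integration.integral_nonneg)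
    then show "(\<lambda>j. W1p_norm q \<Omega> (\<lambda>x. (U \<circ> r) j x - V x)) \<longlonglongrightarrow> 0"
      by (simp add: W1p_norm_def a b)
  qed
  moreover have "AE x in ?L. weak_D \<Omega> V x \<in> S"
  proof -
    have "AE x in ?L. H x \<in> S" using HS by (simp add: AE_lebesgue_on_iff[OF b\<Omega>])
    with weak_D_eq(1)[OF \<Omega>(1) wdV] show ?thesis by eventually_elim simp
  qed
  ultimately show ?thesis using r by blast
qed

theorem theorem5p4:
  fixes \<Omega> :: "(real ^ 2) set" and p :: real
    and U :: "nat \<Rightarrow> real ^ 2 \<Rightarrow> real ^ ('n::{finite,linorder} + 'n + 2)"
  assumes "bounded \<Omega>" "convex \<Omega>" "open \<Omega>"
    and "p > 2"
    and "bounded_in_W1p p \<Omega> U"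
    and "\<forall>\<eta>\<in>test_functions \<Omega>.
      (\<lambda>j. LINT x|lebesgue_on \<Omega>. infdist (weak_D \<Omega> (U j) x) C_area * \<eta> x) \<longlonglongrightarrow> 0"
  shows "\<exists>(r :: nat \<Rightarrow> nat) (V :: real ^ 2 \<Rightarrow> real ^ ('n + 'n + 2)).
    strict_mono r \<and>
    (\<forall>q. 1 \<le> q \<and> q < p \<longrightarrow> converges_in_W1p q \<Omega> (U \<circ> r) V) \<and>
    (AE x in lebesgue_on \<Omega>. weak_D \<Omega> V x \<in> C_area)"
proof (rule compactness_in_W1p[OF assms(3,1,4,5) C_area_closed])
  show "(C_area :: (real ^ 2 ^ ('n + 'n + 2)) set) \<noteq> {}" by (auto simp: C_area_def)
  show "(\<lambda>j. LINT x|lebesgue_on \<Omega>. infdist (weak_D \<Omega> (U j) x) C_area * \<eta> x) \<longlonglongrightarrow> 0"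
    if "\<eta> \<in> test_functions \<Omega>" for \<eta> using assms(6) that by blast
\<comment> \<open>Unification with the three sign conditions selects the forms: \<open>lag_B\<close>
  in the first place and \<open>lag_XA\<close> in the second.\<close>
qed (fact C_area_algebra)+

end
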